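(* Let $\mathcal{C}$ be a pivotal fusion category over $\mathbb{C}$ and let $n \ge 1$ be an integer. If the monoidal category $\mathcal{C}$ admits a braiding, then $\nu_n(\mathcal{C}) \in \mathbb{R}$.
   Context: Everything is over $\mathbb{C}$. A fusion category is a $\mathbb{C}$-linear semisimple rigid monoidal category with finite-dimensional Hom-spaces and finitely many isomorphism classes of simple objects, whose unit object $\mathbf{1}$ is simple (taken strictly unital) and with $\mathrm{End}(V) \cong \mathbb{C}$ for every simple $V$. $\mathrm{Irr}(\mathcal{C})$ is a set of representatives of isomorphism classes of simple objects. $V^*$ denotes the left dual of $V$ with duality morphisms $b_V: \mathbf{1} \to V \otimes V^*$, $d_V: V^* \otimes V \to \mathbf{1}$; $a$ denotes the associativity isomorphism $a_{X,Y,Z}:(X\otimes Y)\otimes Z\to X\otimes(Y\otimes Z)$. A pivotal structure is an isomorphism of monoidal functors $j: \mathrm{id}_{\mathcal{C}} \to (-)^{**}$; a pivotal fusion category is a fusion category equipped with one. The pivotal dimension is $\mathrm{pdim}(V) = d_{V^*} \circ (j_V \otimes \mathrm{id}_{V^*}) \circ b_V \in \mathrm{End}(\mathbf{1}) = \mathbb{C}$. Frobenius-Schur indicators: put $V^{\otimes 0} = \mathbf{1}$, $V^{\otimes 1} = V$, $V^{\otimes n} = V \otimes V^{\otimes (n-1)}$. Let $D_{V,W}: \mathrm{Hom}(\mathbf{1}, V \otimes W) \to \mathrm{Hom}(\mathbf{1}, W \otimes V^{**})$ be the composite of the duality isomorphisms $\mathrm{Hom}(\mathbf{1}, V \otimes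 W) \cong \mathrm{Hom}(V^*, W) \cong \mathrm{Hom}(\mathbf{1}, W \otimes V^{**})$, i.e. $D_{V,W}(f) = (\tilde f \otimes \mathrm{id}_{V^{**}}) \circ b_{V^*}$ with $\tilde f = (d_V \otimes \mathrm{id}_W) \circ a_{V^*,V,W}^{-1} \circ (\mathrm{id}_{V^*} \otimes f)$. For $n \ge 1$ define the linear automorphism $E_V^{(n)}$ of $\mathrm{Hom}(\mathbf{1}, V^{\otimes n})$ by $E_V^{(n)}(f) = a_V^{(n)} \circ (\mathrm{id}_{V^{\otimes (n-1)}} \otimes j_V^{-1}) \circ D_{V, V^{\otimes (n-1)}}(f)$, where $a_V^{(n)}: V^{\otimes(n-1)} \otimes V \to V^{\otimes n}$ is the canonical isomorphism built from associators. The $n$-th Frobenius-Schur indicator of $V$ is $\nu_n(V) = \mathrm{Tr}(E_V^{(n)})$. For a pivotal fusion category, $\nu_n(\mathcal{C}) := \sum_{V \in \mathrm{Irr}(\mathcal{C})} \nu_n(V)\, \mathrm{pdim}(V)$. *)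

theory Defs
  imports Complex_Main
begin

section \<open>Linear categories\<close>

text \<open>
  Every element of the type \<open>'o\<close> is an object. The morphisms live in one ambient complex vector
  space \<open>'m\<close> (addition from the type class, scalar multiplication \<open>scl\<close>), in which
  the Hom-spaces are subspaces; composition and tensor product of morphisms are only constrained on
  the Hom-spaces. This is no loss of generality: for a linear category given by separate Hom-spaces
  take for \<open>'m\<close> their direct sum and extend composition and tensor product bilinearly.
  Composition is written in the applicative order: \<open>g \<cdot> f\<close> is \<open>g\<close> after \<open>f\<close>.
\<close>

record ('o, 'm) category_data =
  hom :: "'o \<Rightarrow> 'o \<Rightarrow> 'm set"
  comp_mor :: "'m \<Rightarrow> 'm \<Rightarrow> 'm"  (infixl "\<cdot>\<index>" 65)
  ident :: "'o \<Rightarrow> 'm"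
  scl :: "complex \<Rightarrow> 'm \<Rightarrow> 'm"

definition bilinear_on ::
  "(complex \<Rightarrow> 'm \<Rightarrow> 'm::ab_group_add) \<Rightarrow> 'm set \<Rightarrow> 'm set \<Rightarrow> ('m \<Rightarrow> 'm \<Rightarrow> 'm) \<Rightarrow> bool" where
  "bilinear_on s A B p \<longleftrightarrow>
     (\<forall>x\<in>A. \<forall>x'\<in>A. \<forall>y\<in>B. p (x + x') y = p x y + p x' y) \<and>
     (\<forall>x\<in>A. \<forall>y\<in>B. \<forall>y'\<in>B. p x (y + y') = p x y + p x y') \<and>
     (\<forall>c. \<forall>x\<in>A. \<forall>y\<in>B. p (s c x) y = s c (p x y) \<and> p x (s c y) = s c (p x y))"

locale linear_category =
  fixes C :: "('o, 'm::ab_group_add, 'z) category_data_scheme" (structure)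
  assumes vector_space: "vector_space (scl C)"
    and hom_subspace: "module.subspace (scl C) (hom C X Y)"
    and ident_in_hom: "ident C X \<in> hom C X X"
    and comp_in_hom: "\<lbrakk>g \<in> hom C Y Z; f \<in> hom C X Y\<rbrakk> \<Longrightarrow> g \<cdot> f \<in> hom C X Z"
    and comp_ident: "f \<in> hom C X Y \<Longrightarrow> f \<cdot> ident C X = f"
    and ident_comp: "f \<in> hom C X Y \<Longrightarrow> ident C Y \<cdot> f = f"
    and comp_assoc: "\<lbrakk>h \<in> hom C Z W; g \<in> hom C Y Z; f \<in> hom C X Y\<rbrakk>
          \<Longrightarrow> (h \<cdot> g) \<cdot> f = h \<cdot> (g \<cdot> f)"
    and comp_bilinear: "bilinear_on (scl C) (hom C Y Z) (hom C X Y) (\<cdot>)"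

definition inverse_pair ::
  "('o, 'm, 'z) category_data_scheme \<Rightarrow> 'o \<Rightarrow> 'o \<Rightarrow> 'm \<Rightarrow> 'm \<Rightarrow> bool" where
  "inverse_pair C X Y f g \<longleftrightarrow>
     f \<in> hom C X Y \<and> g \<in> hom C Y X \<and> g \<cdot> f = ident C X \<and> f \<cdot> g = ident C Y"
  for C (structure)

definition is_iso :: "('o, 'm, 'z) category_data_scheme \<Rightarrow> 'o \<Rightarrow> 'o \<Rightarrow> 'm \<Rightarrow> bool" where
  "is_iso C X Y f \<longleftrightarrow> (\<exists>g. inverse_pair C X Y f g)"

definition isomorphic :: "('o, 'm, 'z) category_data_scheme \<Rightarrow> 'o \<Rightarrow> 'o \<Rightarrow> bool" where
  "isomorphic C X Y \<longleftrightarrow> (\<exists>f. is_iso C X Y f)"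

definition minv :: "('o, 'm, 'z) category_data_scheme \<Rightarrow> 'o \<Rightarrow> 'o \<Rightarrow> 'm \<Rightarrow> 'm" where
  "minv C X Y f = (THE g. inverse_pair C X Y f g)"

definition monic :: "('o, 'm, 'z) category_data_scheme \<Rightarrow> 'o \<Rightarrow> 'o \<Rightarrow> 'm \<Rightarrow> bool" where
  "monic C X Y f \<longleftrightarrow> f \<in> hom C X Y \<and>
     (\<forall>W. \<forall>u \<in> hom C W X. \<forall>v \<in> hom C W X. f \<cdot> u = f \<cdot> v \<longrightarrow> u = v)"
  for C (structure)

definition epic :: "('o, 'm, 'z) category_data_scheme \<Rightarrow> 'o \<Rightarrow> 'o \<Rightarrow> 'm \<Rightarrow> bool" where
  "epic C X Y f \<longleftrightarrow> f \<in> hom C X Y \<and>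
     (\<forall>W. \<forall>u \<in> hom C Y W. \<forall>v \<in> hom C Y W. u \<cdot> f = v \<cdot> f \<longrightarrow> u = v)"
  for C (structure)

definition is_kernel ::
  "('o, 'm::zero, 'z) category_data_scheme \<Rightarrow> 'o \<Rightarrow> 'o \<Rightarrow> 'm \<Rightarrow> 'o \<Rightarrow> 'm \<Rightarrow> bool" where
  "is_kernel C X Y f K k \<longleftrightarrow> k \<in> hom C K X \<and> f \<cdot> k = 0 \<and>
     (\<forall>W. \<forall>u \<in> hom C W X. f \<cdot> u = 0 \<longrightarrow> (\<exists>!v. v \<in> hom C W K \<and> k \<cdot> v = u))"
  for C (structure)

definition is_cokernel ::
  "('o, 'm::zero, 'z) category_data_scheme \<Rightarrow> 'o \<Rightarrow> 'o \<Rightarrow> 'm \<Rightarrow> 'o \<Rightarrow> 'm \<Rightarrow> bool" where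
  "is_cokernel C X Y f Q q \<longleftrightarrow> q \<in> hom C Y Q \<and> q \<cdot> f = 0 \<and>
     (\<forall>W. \<forall>u \<in> hom C Y W. u \<cdot> f = 0 \<longrightarrow> (\<exists>!v. v \<in> hom C Q W \<and> v \<cdot> q = u))"
  for C (structure)

definition zero_object :: "('o, 'm::zero, 'z) category_data_scheme \<Rightarrow> 'o \<Rightarrow> bool" where
  "zero_object C Z \<longleftrightarrow> (\<forall>X. hom C X Z = {0} \<and> hom C Z X = {0})"

definition simple :: "('o, 'm::zero, 'z) category_data_scheme \<Rightarrow> 'o \<Rightarrow> bool" where
  "simple C V \<longleftrightarrow> \<not> zero_object C V \<and>
     (\<forall>U m. monic C U V m \<longrightarrow> zero_object C U \<or> is_iso C U V m)"

text \<open>\<open>X\<close> is a direct sum of \<open>S 0, \<dots>, S (k - 1)\<close>; for \<open>k = 0\<close> this says that \<open>X\<close> is a zero object.\<close>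

definition direct_sum ::
  "('o, 'm::ab_group_add, 'z) category_data_scheme \<Rightarrow> 'o \<Rightarrow> nat \<Rightarrow> (nat \<Rightarrow> 'o) \<Rightarrow> bool" where
  "direct_sum C X k S \<longleftrightarrow> (\<exists>i p.
     (\<forall>s<k. i s \<in> hom C (S s) X \<and> p s \<in> hom C X (S s)) \<and>
     (\<forall>s<k. \<forall>t<k. p s \<cdot> i t = (if s = t then ident C (S s) else 0)) \<and>
     (\<Sum>s<k. i s \<cdot> p s) = ident C X)"
  for C (structure)

locale abelian_category = linear_category +
  assumes direct_sums: "\<exists>X. direct_sum C X k S"
    and kernels: "f \<in> hom C X Y \<Longrightarrow> \<exists>K k. is_kernel C X Y f K k"
    and cokernels: "f \<in> hom C X Y \<Longrightarrow> \<exists>Q q. is_cokernel C X Y f Q q"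
    and monic_normal: "monic C X Y f \<Longrightarrow> \<exists>Z g. g \<in> hom C Y Z \<and> is_kernel C Y Z g X f"
    and epic_normal: "epic C X Y f \<Longrightarrow> \<exists>Z g. g \<in> hom C Z X \<and> is_cokernel C Z X g Y f"

locale semisimple_category = abelian_category +
  assumes semisimple: "\<exists>k S. (\<forall>s<k. simple C (S s)) \<and> direct_sum C X k S"


section \<open>Monoidal categories with strict unit\<close>

text \<open>
  The unit constraints are identities; \<open>triangle\<close> below is the triangle axiom for such unit
  constraints.
\<close>

record ('o, 'm) monoidal_data = "('o, 'm) category_data" +
  unit_obj :: 'o  ("\<one>\<index>")
  tens_obj :: "'o \<Rightarrow> 'o \<Rightarrow> 'o"  (infixr "\<otimes>\<index>" 75)
  tens :: "'m \<Rightarrow> 'm \<Rightarrow> 'm"  (infixr "\<boxtimes>\<index>" 75)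
  assoc :: "'o \<Rightarrow> 'o \<Rightarrow> 'o \<Rightarrow> 'm"

definition assoc_inv :: "('o, 'm, 'z) monoidal_data_scheme \<Rightarrow> 'o \<Rightarrow> 'o \<Rightarrow> 'o \<Rightarrow> 'm" where
  "assoc_inv C X Y Z = minv C ((X \<otimes> Y) \<otimes> Z) (X \<otimes> (Y \<otimes> Z)) (assoc C X Y Z)"
  for C (structure)

locale linear_monoidal_category = linear_category C
  for C :: "('o, 'm::ab_group_add, 'z) monoidal_data_scheme" (structure) +
  assumes tens_in_hom: "\<lbrakk>f \<in> hom C X Y; f' \<in> hom C X' Y'\<rbrakk>
          \<Longrightarrow> f \<boxtimes> f' \<in> hom C (X \<otimes> X') (Y \<otimes> Y')"
    and tens_ident: "ident C X \<boxtimes> ident C Y = ident C (X \<otimes> Y)"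
    and tens_comp: "\<lbrakk>f \<in> hom C X Y; g \<in> hom C Y Z; f' \<in> hom C X' Y'; g' \<in> hom C Y' Z'\<rbrakk>
          \<Longrightarrow> (g \<cdot> f) \<boxtimes> (g' \<cdot> f') = (g \<boxtimes> g') \<cdot> (f \<boxtimes> f')"
    and tens_bilinear: "bilinear_on (scl C) (hom C X Y) (hom C X' Y') (\<boxtimes>)"
    and unit_obj_left: "\<one> \<otimes> X = X"
    and unit_obj_right: "X \<otimes> \<one> = X"
    and unit_left: "f \<in> hom C X Y \<Longrightarrow> ident C \<one> \<boxtimes> f = f"
    and unit_right: "f \<in> hom C X Y \<Longrightarrow> f \<boxtimes> ident C \<one> = f"
    and assoc_iso: "is_iso C ((X \<otimes> Y) \<otimes> Z) (X \<otimes> (Y \<otimes> Z)) (assoc C X Y Z)"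
    and assoc_natural: "\<lbrakk>f \<in> hom C X X'; g \<in> hom C Y Y'; h \<in> hom C Z Z'\<rbrakk>
          \<Longrightarrow> assoc C X' Y' Z' \<cdot> ((f \<boxtimes> g) \<boxtimes> h) = (f \<boxtimes> (g \<boxtimes> h)) \<cdot> assoc C X Y Z"
    and pentagon: "assoc C W X (Y \<otimes> Z) \<cdot> assoc C (W \<otimes> X) Y Z =
          (ident C W \<boxtimes> assoc C X Y Z) \<cdot> assoc C W (X \<otimes> Y) Z \<cdot> (assoc C W X Y \<boxtimes> ident C Z)"
    and triangle: "assoc C X \<one> Y = ident C (X \<otimes> Y)"

definition braiding ::
  "('o, 'm, 'z) monoidal_data_scheme \<Rightarrow> ('o \<Rightarrow> 'o \<Rightarrow> 'm) \<Rightarrow> bool" where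
  "braiding C c \<longleftrightarrow>
     (\<forall>X Y. is_iso C (X \<otimes> Y) (Y \<otimes> X) (c X Y)) \<and>
     (\<forall>X X' Y Y'. \<forall>f \<in> hom C X X'. \<forall>g \<in> hom C Y Y'. c X' Y' \<cdot> (f \<boxtimes> g) = (g \<boxtimes> f) \<cdot> c X Y) \<and>
     (\<forall>X Y Z. assoc C Y Z X \<cdot> c X (Y \<otimes> Z) \<cdot> assoc C X Y Z =
        (ident C Y \<boxtimes> c X Z) \<cdot> assoc C Y X Z \<cdot> (c X Y \<boxtimes> ident C Z)) \<and>
     (\<forall>X Y Z. assoc_inv C Z X Y \<cdot> c (X \<otimes> Y) Z \<cdot> assoc_inv C X Y Z =
        (c X Z \<boxtimes> ident C Y) \<cdot> assoc_inv C X Z Y \<cdot> (ident C X \<boxtimes> c Y Z))"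
  for C (structure)

text \<open>\<open>X'\<close> is a left dual of \<open>X\<close>; equivalently, \<open>X\<close> is a right dual of \<open>X'\<close>.\<close>

definition is_left_dual ::
  "('o, 'm, 'z) monoidal_data_scheme \<Rightarrow> 'o \<Rightarrow> 'o \<Rightarrow> 'm \<Rightarrow> 'm \<Rightarrow> bool" where
  "is_left_dual C X X' b d \<longleftrightarrow>
     b \<in> hom C \<one> (X \<otimes> X') \<and> d \<in> hom C (X' \<otimes> X) \<one> \<and>
     (ident C X \<boxtimes> d) \<cdot> assoc C X X' X \<cdot> (b \<boxtimes> ident C X) = ident C X \<and>
     (d \<boxtimes> ident C X') \<cdot> assoc_inv C X' X X' \<cdot> (ident C X' \<boxtimes> b) = ident C X'"
  for C (structure)


section \<open>Pivotal fusion categories\<close>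

text \<open>\<open>dual\<close>, \<open>coev\<close> (\<open>b\<close>), \<open>ev\<close> (\<open>d\<close>) are chosen left duals; \<open>piv\<close> is the pivotal structure \<open>j\<close>.\<close>

record ('o, 'm) pivotal_data = "('o, 'm) monoidal_data" +
  dual :: "'o \<Rightarrow> 'o"
  coev :: "'o \<Rightarrow> 'm"
  ev :: "'o \<Rightarrow> 'm"
  piv :: "'o \<Rightarrow> 'm"

locale fusion_category = semisimple_category C + linear_monoidal_category C
  for C :: "('o, 'm::ab_group_add, 'z) pivotal_data_scheme" (structure) +
  assumes left_dual: "is_left_dual C X (dual C X) (coev C X) (ev C X)"
    and right_dual: "\<exists>X' b d. is_left_dual C X' X b d"
    and finite_dim_hom: "\<exists>B. finite B \<and> module.span (scl C) B = hom C X Y"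
    and finitely_many_simples: "\<exists>I. finite I \<and> (\<forall>V. simple C V \<longrightarrow> (\<exists>W\<in>I. isomorphic C V W))"
    and simple_unit: "simple C \<one>"
    and simple_End: "simple C V \<Longrightarrow> bij_betw (\<lambda>c. scl C c (ident C V)) UNIV (hom C V V)"

text \<open>The dual \<open>Y\<^sup>* \<rightarrow> X\<^sup>*\<close> of \<open>f : X \<rightarrow> Y\<close>.\<close>

definition dual_map :: "('o, 'm, 'z) pivotal_data_scheme \<Rightarrow> 'o \<Rightarrow> 'o \<Rightarrow> 'm \<Rightarrow> 'm" where
  "dual_map C X Y f =
     (ev C Y \<boxtimes> ident C (dual C X)) \<cdot> ((ident C (dual C Y) \<boxtimes> f) \<boxtimes> ident C (dual C X)) \<cdot>
     assoc_inv C (dual C Y) X (dual C X) \<cdot> (ident C (dual C Y) \<boxtimes> coev C X)"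
  for C (structure)

definition ddual_map :: "('o, 'm, 'z) pivotal_data_scheme \<Rightarrow> 'o \<Rightarrow> 'o \<Rightarrow> 'm \<Rightarrow> 'm" where
  "ddual_map C X Y f = dual_map C (dual C Y) (dual C X) (dual_map C X Y f)"

text \<open>
  The evaluation \<open>(Y\<^sup>* \<otimes> X\<^sup>*) \<otimes> (X \<otimes> Y) \<rightarrow> \<one>\<close>, the canonical isomorphism
  \<open>Y\<^sup>* \<otimes> X\<^sup>* \<rightarrow> (X \<otimes> Y)\<^sup>*\<close> it induces, and the resulting monoidal
  structure \<open>X\<^sup>*\<^sup>* \<otimes> Y\<^sup>*\<^sup>* \<rightarrow> (Y\<^sup>* \<otimes> X\<^sup>*)\<^sup>* \<rightarrow> (X \<otimes> Y)\<^sup>*\<^sup>*\<close>, \<open>\<one> \<rightarrow> \<one>\<^sup>* \<rightarrow> \<one>\<^sup>*\<^sup>*\<close> of the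
  double dual functor.
\<close>

definition ev_tens :: "('o, 'm, 'z) pivotal_data_scheme \<Rightarrow> 'o \<Rightarrow> 'o \<Rightarrow> 'm" where
  "ev_tens C X Y =
     ev C Y \<cdot>
     (ident C (dual C Y) \<boxtimes> ((ev C X \<boxtimes> ident C Y) \<cdot> assoc_inv C (dual C X) X Y)) \<cdot>
     assoc C (dual C Y) (dual C X) (X \<otimes> Y)"
  for C (structure)

definition dual_tens :: "('o, 'm, 'z) pivotal_data_scheme \<Rightarrow> 'o \<Rightarrow> 'o \<Rightarrow> 'm" where
  "dual_tens C X Y =
     (let T = dual C Y \<otimes> dual C X; D = dual C (X \<otimes> Y) in
       (ev_tens C X Y \<boxtimes> ident C D) \<cdot> assoc_inv C T (X \<otimes> Y) D \<cdot> (ident C T \<boxtimes> coev C (X \<otimes> Y)))"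
  for C (structure)

definition ddual_tens :: "('o, 'm, 'z) pivotal_data_scheme \<Rightarrow> 'o \<Rightarrow> 'o \<Rightarrow> 'm" where
  "ddual_tens C X Y =
     (let T = dual C Y \<otimes> dual C X; D = dual C (X \<otimes> Y) in
       dual_map C D T (minv C T D (dual_tens C X Y)) \<cdot> dual_tens C (dual C Y) (dual C X))"
  for C (structure)

text \<open>Since the unit is strict, \<open>coev \<one>\<close> is a morphism \<open>\<one> \<rightarrow> \<one> \<otimes> \<one>\<^sup>* = \<one>\<^sup>*\<close>.\<close>

definition ddual_unit :: "('o, 'm, 'z) pivotal_data_scheme \<Rightarrow> 'm" where
  "ddual_unit C = dual_map C (dual C \<one>) \<one> (minv C \<one> (dual C \<one>) (coev C \<one>)) \<cdot> coev C \<one>"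
  for C (structure)

locale pivotal_fusion_category = fusion_category +
  assumes piv_iso: "is_iso C X (dual C (dual C X)) (piv C X)"
    and piv_natural: "f \<in> hom C X Y \<Longrightarrow> piv C Y \<cdot> f = ddual_map C X Y f \<cdot> piv C X"
    and piv_tens: "piv C (X \<otimes> Y) = ddual_tens C X Y \<cdot> (piv C X \<boxtimes> piv C Y)"
    and piv_unit: "piv C \<one> = ddual_unit C"

definition pdim :: "('o, 'm, 'z) pivotal_data_scheme \<Rightarrow> 'o \<Rightarrow> complex" where
  "pdim C V = (THE c. scl C c (ident C \<one>) =
     ev C (dual C V) \<cdot> (piv C V \<boxtimes> ident C (dual C V)) \<cdot> coev C V)"
  for C (structure)

definition Irr_reps :: "('o, 'm::zero, 'z) category_data_scheme \<Rightarrow> 'o set \<Rightarrow> bool" where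
  "Irr_reps C I \<longleftrightarrow>
     (\<forall>V\<in>I. simple C V) \<and> (\<forall>V. simple C V \<longrightarrow> (\<exists>!W. W \<in> I \<and> isomorphic C V W))"


section \<open>Frobenius-Schur indicators\<close>

fun tpow :: "('o, 'm, 'z) monoidal_data_scheme \<Rightarrow> 'o \<Rightarrow> nat \<Rightarrow> 'o" where
  "tpow C V 0 = \<one>\<^bsub>C\<^esub>"
| "tpow C V (Suc 0) = V"
| "tpow C V (Suc (Suc n)) = V \<otimes>\<^bsub>C\<^esub> tpow C V (Suc n)"

text \<open>The canonical isomorphism from \<open>tpow C V m \<otimes> V\<close> to \<open>tpow C V (m + 1)\<close>.\<close>

primrec tpow_assoc :: "('o, 'm, 'z) monoidal_data_scheme \<Rightarrow> 'o \<Rightarrow> nat \<Rightarrow> 'm" where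
  "tpow_assoc C V 0 = ident C V"
| "tpow_assoc C V (Suc m) =
     (ident C V \<boxtimes>\<^bsub>C\<^esub> tpow_assoc C V m) \<cdot>\<^bsub>C\<^esub> assoc C V (tpow C V m) V"

text \<open>\<open>D_map C V W : Hom(\<one>, V \<otimes> W) \<rightarrow> Hom(\<one>, W \<otimes> V\<^sup>*\<^sup>*)\<close>\<close>

definition D_map :: "('o, 'm, 'z) pivotal_data_scheme \<Rightarrow> 'o \<Rightarrow> 'o \<Rightarrow> 'm \<Rightarrow> 'm" where
  "D_map C V W f =
     (let f' = (ev C V \<boxtimes> ident C W) \<cdot> assoc_inv C (dual C V) V W \<cdot> (ident C (dual C V) \<boxtimes> f) in
       (f' \<boxtimes> ident C (dual C (dual C V))) \<cdot> coev C (dual C V))"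
  for C (structure)

definition E_map :: "('o, 'm, 'z) pivotal_data_scheme \<Rightarrow> 'o \<Rightarrow> nat \<Rightarrow> 'm \<Rightarrow> 'm" where
  "E_map C V n f =
     tpow_assoc C V (n - 1) \<cdot>
     (ident C (tpow C V (n - 1)) \<boxtimes> minv C V (dual C (dual C V)) (piv C V)) \<cdot>
     D_map C V (tpow C V (n - 1)) f"
  for C (structure)

text \<open>
  The trace of an endomorphism \<open>f\<close> of the finite-dimensional subspace \<open>S\<close>: the sum of its diagonal
  coefficients with respect to a basis.
\<close>

definition trace_on :: "(complex \<Rightarrow> 'm::ab_group_add \<Rightarrow> 'm) \<Rightarrow> 'm set \<Rightarrow> ('m \<Rightarrow> 'm) \<Rightarrow> complex" where
  "trace_on s S f =
     (let B = (SOME B. \<not> module.dependent s B \<and> module.span s B = S)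
      in \<Sum>b\<in>B. module.representation s B (f b) b)"

definition FS_indicator :: "('o, 'm::ab_group_add, 'z) pivotal_data_scheme \<Rightarrow> nat \<Rightarrow> 'o \<Rightarrow> complex" where
  "FS_indicator C n V = trace_on (scl C) (hom C \<one> (tpow C V n)) (E_map C V n)"
  for C (structure)

definition FS_indicator_cat ::
  "('o, 'm::ab_group_add, 'z) pivotal_data_scheme \<Rightarrow> 'o set \<Rightarrow> nat \<Rightarrow> complex" where
  "FS_indicator_cat C I n = (\<Sum>V\<in>I. FS_indicator C n V * pdim C V)"

end

(*
  Each summand nu_n(V) pdim(V) is already real. Let V' be the dual of V, p = pdim(V), q = pdim(V'),
  W = V^(n-1), c a braiding and E = E_V^(n). Pulling a strand through the braiding shows
  E f = t c_{W,V}^{-1} f and, with the reversed braiding, E f = t' c_{V,W} f, where the twists t, t'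
  on the simple object V are scalars with t t' p = q. A half twist of V^n conjugates c_{V,W} to
  c_{W,V}, so Tr(E) = t t' Tr(E^{-1}). Since E^n = 1, Tr(E^{-1}) is the complex conjugate of Tr(E);
  and q is the complex conjugate of p because the dimensions form a common eigenvector of the fusion
  matrices, among which that of V' is the transpose of that of V. Hence Tr(E) p is its own conjugate.

  Diagrams are computed in a strict category whose objects are the lists of objects of C.
*)

theory Submission
  imports Defs
begin

section \<open>Traces on finite-dimensional subspaces\<close>

text \<open>No spherical structure is assumed, so V and its dual may have different dimensions, and
  the twists obtained from the braiding and from its reverse need not be mutually inverse. The
  defect shows on a closed loop: the two curls carry a loop closed on one side of V to the loop
  closed on the other side, at the cost of two crossings that cancel. The factor pdim(V) in each
  summand is exactly what compensates this defect. That E has order dividing n rests on the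
  monoidality of j. Rotating the n tensor factors one at a time amounts to rotating V^n as a single
  object, and an invariant with no strand left over is fixed by such a rotation: it is a morphism
  out of the unit, so naturality of j slides it across the cap, and the value of j at the unit
  disposes of the loop that remains. Comparing eigenvalues of a matrix and its transpose needs a
  vector of nonzero Hermitian norm; the dimension vector qualifies because the unit object has
  dimension 1.\<close>

locale finite_dim_subspace = vector_space scale
  for scale :: "complex \<Rightarrow> 'm::ab_group_add \<Rightarrow> 'm"  (infixr "*s" 75) +
  fixes H :: "'m set"
  assumes finite_span: "\<exists>B. finite B \<and> span B = H"
begin

definition basis_of where
  "basis_of B \<longleftrightarrow> finite B \<and> independent B \<and> span B = H"

text \<open>Linearity is required on \<open>H\<close> only: outside the Hom-spaces composition and
  tensor product are arbitrary, so the maps of interest need not be linear on the ambient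
  space.\<close>

definition lin_on where
  "lin_on f \<longleftrightarrow> (\<forall>x\<in>H. f x \<in> H) \<and> (\<forall>x\<in>H. \<forall>y\<in>H. f (x + y) = f x + f y)
     \<and> (\<forall>c. \<forall>x\<in>H. f (c *s x) = c *s f x)"

lemma subspace_H: "subspace H"
  using finite_span subspace_span by blast

lemma lin_onD:
  assumes "lin_on f"
  shows "x \<in> H \<Longrightarrow> f x \<in> H" "x \<in> H \<Longrightarrow> y \<in> H \<Longrightarrow> f (x + y) = f x + f y"
    "x \<in> H \<Longrightarrow> f (c *s x) = c *s f x"
  using assms by (auto simp: lin_on_def)

lemma lin_on_sum:
  assumes "lin_on f" "\<And>a. a \<in> A \<Longrightarrow> v a \<in> H"
  shows "f (\<Sum>a\<in>A. c a *s v a) = (\<Sum>a\<in>A. c a *s f (v a))"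
proof -
  have 0: "f 0 = 0" using lin_onD(3)[OF assms(1), of 0 0] subspace_0[OF subspace_H] by simp
  show ?thesis using assms(2)
  proof (induction A rule: infinite_finite_induct)
    case (insert x F)
    then have "(\<Sum>a\<in>F. c a *s v a) \<in> H" "c x *s v x \<in> H"
      using subspace_H by (auto intro!: subspace_sum subspace_scale)
    then show ?case using insert by (simp add: lin_onD[OF assms(1)])
  qed (simp_all add: 0)
qed

lemma lin_on_comp: "lin_on f \<Longrightarrow> lin_on g \<Longrightarrow> lin_on (\<lambda>x. f (g x))"
  by (simp add: lin_on_def)

lemma lin_on_scale: "lin_on f \<Longrightarrow> lin_on (\<lambda>x. c *s f x)"
  using subspace_scale[OF subspace_H] by (simp add: lin_on_def scale_right_distrib mult.commute)

lemma lin_on_sumI: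
  assumes "\<And>a. a \<in> A \<Longrightarrow> lin_on (f a)"
  shows "lin_on (\<lambda>x. \<Sum>a\<in>A. f a x)"
  using assms subspace_sum[OF subspace_H, of A] unfolding lin_on_def
  by (simp add: sum.distrib scale_sum_right)

lemma lin_on_funpow: "lin_on f \<Longrightarrow> lin_on (f ^^ k)"
  by (induction k) (auto simp: lin_on_def)

lemma basis_of_exists: obtains B where "basis_of B"
proof -
  obtain S where S: "finite S" "span S = H" using finite_span by blast
  obtain B where B: "B \<subseteq> H" "independent B" "H \<subseteq> span B"
    using maximal_independent_subset[of H] by blast
  have "finite B" using independent_span_bound[of S B] S B by auto
  moreover have "span B = H" using B subspace_H span_minimal by blast
  ultimately show ?thesis using that B by (auto simp: basis_of_def)
qed

lemma independent_basis_of: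
  assumes "independent B" "span B = H"
  shows "basis_of B"
proof -
  obtain S where "finite S" "span S = H" using finite_span by blast
  then have "finite B" using independent_span_bound[of S B] span_superset[of B] assms by simp
  then show ?thesis using assms by (simp add: basis_of_def)
qed

lemma expand: "basis_of B \<Longrightarrow> x \<in> H \<Longrightarrow> (\<Sum>b\<in>B. representation B x b *s b) = x"
  by (rule sum_representation_eq) (auto simp: basis_of_def)

lemma basis_in: "basis_of B \<Longrightarrow> b \<in> B \<Longrightarrow> b \<in> H"
  using span_base by (auto simp: basis_of_def)

text \<open>The matrix of \<open>f\<close> for separate bases of source and target; this freedom is
  what later makes the trace independent of the basis.\<close>

lemma representation_lin_on:
  assumes A: "basis_of A" and B: "basis_of B" and f: "lin_on f" and x: "x \<in> H"
  shows "representation A (f x) a = (\<Sum>b\<in>B. representation B x b * representation A (f b) a)"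
proof -
  have "f x = (\<Sum>b\<in>B. representation B x b *s f b)"
    using lin_on_sum[where A = B and v = "\<lambda>b. b" and c = "representation B x", OF f basis_in[OF B]]
    by (simp only: expand[OF B x])
  moreover have "representation A (\<Sum>b\<in>B. representation B x b *s f b)
      = (\<lambda>a. \<Sum>b\<in>B. representation A (representation B x b *s f b) a)"
    using A basis_in[OF B] lin_onD(1)[OF f] subspace_scale[OF subspace_H]
    by (intro representation_sum) (auto simp: basis_of_def)
  moreover have "representation A (representation B x b *s f b) a
      = representation B x b * representation A (f b) a" if "b \<in> B" for b
    using A basis_in[OF B that] lin_onD(1)[OF f]
    by (subst representation_scale) (auto simp: basis_of_def)
  ultimately show ?thesis by simp
qed

definition tr where
  "tr B f = (\<Sum>b\<in>B. representation B (f b) b)"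

text \<open>Both traces are one double sum over matrix entries, taken in either order. As
  \<open>A\<close> and \<open>B\<close> may differ, the case where one map is the identity is
  independence of the basis.\<close>

lemma tr_comm:
  assumes A: "basis_of A" and B: "basis_of B" and f: "lin_on f" and g: "lin_on g"
  shows "tr A (\<lambda>x. f (g x)) = tr B (\<lambda>x. g (f x))"
proof -
  have "tr A (\<lambda>x. f (g x)) = (\<Sum>a\<in>A. \<Sum>b\<in>B. representation B (g a) b * representation A (f b) a)"
    unfolding tr_def
    by (intro sum.cong refl representation_lin_on A B f lin_onD(1)[OF g] basis_in[OF A])
  also have "\<dots> = (\<Sum>b\<in>B. \<Sum>a\<in>A. representation A (f b) a * representation B (g a) b)"
    by (subst sum.swap) (simp add: mult.commute)
  also have "\<dots> = tr B (\<lambda>x. g (f x))"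
    unfolding tr_def
    by (intro sum.cong refl representation_lin_on[symmetric] A B g lin_onD(1)[OF f] basis_in[OF B])
  finally show ?thesis .
qed

abbreviation trace where "trace \<equiv> trace_on scale H"

text \<open>\<open>trace_on\<close> uses a basis chosen by \<open>SOME\<close>. A basis exists, so
  the choice is one, and \<open>tr_comm\<close> with the identity moves from it to any
  other.\<close>

lemma trace_eq_tr:
  assumes "basis_of B" "lin_on f"
  shows "trace f = tr B f"
proof -
  let ?B = "SOME B. independent B \<and> span B = H"
  obtain B' where "basis_of B'" by (rule basis_of_exists)
  then have "independent ?B \<and> span ?B = H"
    by (intro someI[of "\<lambda>B. independent B \<and> span B = H"]) (auto simp: basis_of_def)
  then have "basis_of ?B" by (auto intro: independent_basis_of)
  moreover have "lin_on (\<lambda>x. x)" by (simp add: lin_on_def)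
  ultimately have "tr ?B f = tr B f" using tr_comm[of ?B B f "\<lambda>x. x"] assms by simp
  then show ?thesis by (simp add: trace_on_def tr_def Let_def)
qed

lemma trace_comm:
  assumes f: "lin_on f" and g: "lin_on g"
  shows "trace (\<lambda>x. f (g x)) = trace (\<lambda>x. g (f x))"
proof -
  obtain B where B: "basis_of B" by (rule basis_of_exists)
  show ?thesis
    unfolding trace_eq_tr[OF B lin_on_comp[OF f g]] trace_eq_tr[OF B lin_on_comp[OF g f]]
    by (rule tr_comm[OF B B f g])
qed

lemma trace_cong:
  assumes "lin_on f" "\<And>x. x \<in> H \<Longrightarrow> f x = g x"
  shows "trace f = trace g"
proof -
  obtain B where B: "basis_of B" by (rule basis_of_exists)
  have "lin_on g"
    using assms subspace_add[OF subspace_H] subspace_scale[OF subspace_H] by (auto simp: lin_on_def)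
  then show ?thesis
    using assms trace_eq_tr[OF B] basis_in[OF B] by (simp add: tr_def)
qed

lemma trace_lincomb:
  assumes "\<And>a. a \<in> A \<Longrightarrow> lin_on (f a)"
  shows "trace (\<lambda>x. \<Sum>a\<in>A. c a *s f a x) = (\<Sum>a\<in>A. c a * trace (f a))"
proof -
  obtain B where B: "basis_of B" by (rule basis_of_exists)
  have "representation B (\<Sum>a\<in>A. c a *s f a b) b = (\<Sum>a\<in>A. c a * representation B (f a b) b)"
    if "b \<in> B" for b
  proof -
    have fb: "a \<in> A \<Longrightarrow> f a b \<in> span B" for a
      using B basis_in[OF B that] lin_onD(1)[OF assms] by (auto simp: basis_of_def)
    then have "representation B (\<Sum>a\<in>A. c a *s f a b) = (\<lambda>v. \<Sum>a\<in>A. representation B (c a *s f a b) v)"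
      using B by (intro representation_sum) (auto simp: basis_of_def span_scale)
    then show ?thesis using B fb by (simp add: representation_scale basis_of_def)
  qed
  moreover have "lin_on (\<lambda>x. \<Sum>a\<in>A. c a *s f a x)"
    by (intro lin_on_sumI lin_on_scale assms)
  ultimately show ?thesis
    using trace_eq_tr[OF B] assms
    by (simp add: tr_def sum_distrib_left) (rule sum.swap)
qed

lemma trace_scale: "lin_on f \<Longrightarrow> trace (\<lambda>x. c *s f x) = c * trace f"
  using trace_lincomb[of "{()}" "\<lambda>_. f" "\<lambda>_. c"] by simp

section \<open>Operators of finite order\<close>

text \<open>In a basis that extends a basis \<open>B1\<close> of the image, the diagonal entries are
  1 on \<open>B1\<close> and 0 elsewhere, because every \<open>P b\<close> lies in the span of
  \<open>B1\<close>.\<close>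

lemma trace_idempotent_real:
  assumes P: "lin_on P" and idem: "\<And>x. x \<in> H \<Longrightarrow> P (P x) = P x"
  shows "trace P \<in> \<real>"
proof -
  obtain B1 where B1: "B1 \<subseteq> P ` H" "independent B1" "P ` H \<subseteq> span B1"
    using maximal_independent_subset[of "P ` H"] by blast
  have "B1 \<subseteq> H" using B1(1) lin_onD(1)[OF P] by blast
  then obtain B where B: "B1 \<subseteq> B" "B \<subseteq> H" "independent B" "H \<subseteq> span B"
    using maximal_independent_subset_extend[OF _ B1(2)] by blast
  have "basis_of B"
    using B subspace_H span_minimal by (intro independent_basis_of) blast+
  have "representation B (P b) b = (if b \<in> B1 then 1 else 0)" if "b \<in> B" for b
  proof (cases "b \<in> B1")
    case True
    then have "P b = b" using B1(1) idem by blast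
    then show ?thesis using True B that by (simp add: representation_basis)
  next
    case False
    have "P b \<in> span B1" using B B1 that by blast
    then have "representation B (P b) = representation B1 (P b)"
      using B by (intro representation_extend) auto
    then show ?thesis using False representation_ne_zero[of B1 "P b" b] by auto
  qed
  then have "tr B P \<in> \<real>" unfolding tr_def by (intro sum_in_Reals) auto
  then show ?thesis by (simp add: trace_eq_tr[OF \<open>basis_of B\<close> P])
qed

text \<open>The operator decomposes into its spectral projections, whose traces are real.\<close>

lemma trace_finite_order:
  assumes E: "lin_on E" and n: "n > 0" and order: "\<And>x. x \<in> H \<Longrightarrow> (E ^^ n) x = x"
  shows "trace (E ^^ (n - 1)) = cnj (trace E)"
proof -
  define w where "w = cis (2 * pi / real n)"
  have w0: "w \<noteq> 0" by (simp add: w_def)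
  have wk: "w ^ k = cis (2 * pi * real k / real n)" for k
    by (simp add: w_def DeMoivre mult_ac)
  have wn: "w ^ n = 1" using n by (simp add: wk)
  have w_inj: "inj_on (\<lambda>k. w ^ k) {..<n}"
    using bij_betw_roots_unity[OF n] by (simp add: wk bij_betw_def)
  have cnj_w: "cnj w * w = 1" by (simp add: w_def cis_cnj cis_mult)
  \<comment> \<open>The discrete Fourier transform of the powers of \<open>E\<close>: the projection
    onto the eigenspace for the eigenvalue \<open>w ^ k\<close>.\<close>
  define P where "P k x = (\<Sum>j<n. (1 / of_nat n / w ^ (j * k)) *s (E ^^ j) x)" for k x
  have P: "lin_on (P k)" for k
    unfolding P_def by (intro lin_on_sumI lin_on_scale lin_on_funpow E)
  \<comment> \<open>Orthogonality of the characters of the cyclic group of order \<open>n\<close>;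
    off the diagonal it is a geometric sum at a nontrivial root of unity.\<close>
  have orth: "(\<Sum>k<n. w ^ (m * k) * (1 / of_nat n / w ^ (j * k))) = (if j = m then 1 else 0)"
    if "j < n" "m < n" for j m
  proof (cases "j = m")
    case True
    then show ?thesis using n w0 by simp
  next
    case False
    let ?z = "w ^ m / w ^ j"
    have "?z \<noteq> 1" using w_inj that False w0 by (auto simp: inj_on_def)
    moreover have "(w ^ i) ^ n = 1" for i
      by (subst power_mult[symmetric], subst mult.commute, subst power_mult) (simp add: wn)
    then have "?z ^ n = 1" by (simp add: power_divide)
    ultimately have "(\<Sum>k<n. ?z ^ k) = 0" by (simp add: geometric_sum)
    moreover have "(\<Sum>k<n. w ^ (m * k) * (1 / of_nat n / w ^ (j * k))) = (\<Sum>k<n. ?z ^ k) / of_nat n"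
      by (simp add: power_divide power_mult sum_divide_distrib mult.commute[of _ "of_nat n"])
    ultimately show ?thesis using False by simp
  qed
  have decomp: "(E ^^ m) x = (\<Sum>k<n. w ^ (m * k) *s P k x)" if "m < n" for m x
  proof -
    have "(\<Sum>k<n. w ^ (m * k) *s P k x)
        = (\<Sum>j<n. (\<Sum>k<n. w ^ (m * k) * (1 / of_nat n / w ^ (j * k))) *s (E ^^ j) x)"
      unfolding P_def scale_sum_right scale_sum_left scale_scale by (rule sum.swap)
    also have "\<dots> = (\<Sum>j<n. (if j = m then 1 else 0) *s (E ^^ j) x)"
      by (rule sum.cong) (use orth that in auto)
    also have "\<dots> = (\<Sum>j<n. if j = m then (E ^^ j) x else 0)"
      by (rule sum.cong) auto
    also have "\<dots> = (E ^^ m) x" using that by simp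
    finally show ?thesis by simp
  qed
  \<comment> \<open>Applying \<open>E\<close> shifts the summands by one place. The one that leaves
    at the upper end equals the one missing at the lower end, since the \<open>n\<close>-th powers
    of \<open>E\<close> and \<open>w\<close> are trivial.\<close>
  have EP: "E (P k x) = w ^ k *s P k x" if x: "x \<in> H" for k x
  proof -
    let ?t = "\<lambda>j. (1 / of_nat n / w ^ (j * k)) *s (E ^^ Suc j) x"
    let ?u = "\<lambda>j. (w ^ k / of_nat n / w ^ (j * k)) *s (E ^^ j) x"
    have "E (P k x) = (\<Sum>j<n. ?t j)"
      unfolding P_def
      using lin_on_sum[where A = "{..<n}" and v = "\<lambda>j. (E ^^ j) x", OF E lin_onD(1)[OF lin_on_funpow[OF E] x]]
      by simp
    also have "\<dots> = (\<Sum>j<n. ?u (Suc j))"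
      using w0 by (intro sum.cong) (auto simp: power_add)
    also have "\<dots> + ?u 0 = (\<Sum>j<Suc n. ?u j)" by (simp only: sum.lessThan_Suc_shift add.commute)
    also have "\<dots> = (\<Sum>j<n. ?u j) + ?u n" by simp
    also have "?u n = ?u 0" using order[OF x] wn by (simp add: power_mult)
    finally have "E (P k x) = (\<Sum>j<n. ?u j)" by simp
    then show ?thesis by (simp add: P_def scale_sum_right)
  qed
  have EPm: "(E ^^ m) (P k x) = w ^ (m * k) *s P k x" if x: "x \<in> H" for m k x
    by (induction m) (use EP[OF x] lin_onD[OF P x] lin_onD(3)[OF E] lin_onD(1)[OF P x] in
      \<open>simp_all add: power_add mult.commute\<close>)
  have "P k (P k x) = P k x" if x: "x \<in> H" for k x
  proof -
    have "P k (P k x) = (\<Sum>j<n. (1 / of_nat n) *s P k x)"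
      unfolding P_def[of k "P k x"] using w0 by (intro sum.cong) (auto simp: EPm[OF x])
    also have "\<dots> = P k x" using n by (simp flip: scale_sum_left)
    finally show ?thesis .
  qed
  then have real: "trace (P k) \<in> \<real>" for k by (rule trace_idempotent_real[OF P])
  have tr: "trace (E ^^ m) = (\<Sum>k<n. w ^ (m * k) * trace (P k))" if "m < n" for m
  proof -
    have "E ^^ m = (\<lambda>x. \<Sum>k<n. w ^ (m * k) *s P k x)" using decomp[OF that] by blast
    then show ?thesis using trace_lincomb[of "{..<n}" P] P by simp
  qed
  have inv: "w ^ ((n - Suc 0) * k) = cnj (w ^ k)" for k
  proof -
    obtain n' where n': "n = Suc n'" using n by (cases n) auto
    have "w ^ ((n - Suc 0) * k) * w ^ k = (w ^ n) ^ k"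
      unfolding n' power_mult[symmetric] power_add[symmetric] by (simp add: add.commute)
    then have "w ^ ((n - Suc 0) * k) * w ^ k = cnj (w ^ k) * w ^ k"
      by (simp add: wn cnj_w flip: power_mult_distrib)
    then show ?thesis using w0 by simp
  qed
  show ?thesis
  \<comment> \<open>The expansion \<open>tr\<close> covers exponents below \<open>n\<close>, so it
    reaches \<open>E\<close> itself only for \<open>n > 1\<close>; for \<open>n = 1\<close> the
    operator is the identity on \<open>H\<close>.\<close>
  proof (cases "n = 1")
    case True
    then have "trace E = trace (E ^^ 0)" using order by (intro trace_cong[OF E]) simp
    then show ?thesis using tr[of 0] real[of 0] True by (simp add: Reals_cnj_iff)
  next
    case False
    then have "1 < n" using n by simp
    have "trace (E ^^ (n - 1)) = (\<Sum>k<n. w ^ ((n - 1) * k) * trace (P k))"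
      using tr[of "n - 1"] n by simp
    also have "\<dots> = cnj (\<Sum>k<n. w ^ k * trace (P k))"
      using real by (simp add: inv Reals_cnj_iff)
    also have "(\<Sum>k<n. w ^ k * trace (P k)) = trace E"
      using tr[of 1] \<open>1 < n\<close> by simp
    finally show ?thesis .
  qed
qed

section \<open>Comparison of dimensions\<close>

text \<open>Independence of an indexed family also forbids repetitions: equal members at two indices
  would satisfy the relation with coefficients 1 and -1. Hence the image is a basis with as many
  elements as \<open>K\<close>.\<close>

lemma dim_eq_card_family:
  assumes K: "finite K" and e: "\<And>k. k \<in> K \<Longrightarrow> e k \<in> H"
    and gen: "\<And>x. x \<in> H \<Longrightarrow> \<exists>c. x = (\<Sum>k\<in>K. c k *s e k)"
    and indep: "\<And>c k. (\<Sum>k\<in>K. c k *s e k) = 0 \<Longrightarrow> k \<in> K \<Longrightarrow> c k = 0"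
  shows "dim H = card K"
proof -
  have inj: "inj_on e K"
  proof (rule inj_onI, rule ccontr)
    fix k l assume kl: "k \<in> K" "l \<in> K" "e k = e l" "k \<noteq> l"
    let ?c = "\<lambda>i. if i = k then 1 else if i = l then -1 else (0::complex)"
    have "(\<Sum>i\<in>K. ?c i *s e i) = (\<Sum>i\<in>{k, l}. ?c i *s e i)"
      by (rule sum.mono_neutral_right) (use K kl in auto)
    also have "\<dots> = 0" using kl by simp
    finally show False using indep[of ?c k] kl by simp
  qed
  have "independent (e ` K)"
  proof (rule independent_if_scalars_zero)
    fix f x assume 0: "(\<Sum>x\<in>e ` K. f x *s x) = 0" and x: "x \<in> e ` K"
    then obtain k where k: "k \<in> K" "x = e k" by auto
    show "f x = 0" using indep[of "\<lambda>k. f (e k)" k] 0 k by (simp add: sum.reindex[OF inj])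
  qed (use K in simp)
  moreover have "H \<subseteq> span (e ` K)"
  proof
    fix x assume "x \<in> H"
    then obtain c where "x = (\<Sum>k\<in>K. c k *s e k)" using gen by blast
    then show "x \<in> span (e ` K)"
      by (simp only:) (intro span_sum span_scale span_base imageI)
  qed
  ultimately have "card (e ` K) = dim H" using e by (intro basis_card_eq_dim) auto
  then show ?thesis by (simp add: card_image[OF inj])
qed

text \<open>\<open>F\<close> carries a basis of \<open>H\<close> to an indexed family in
  \<open>H'\<close>; the inverse \<open>G\<close> shows that this family generates and is
  independent.\<close>

lemma dim_eq_of_bij:
  assumes H': "finite_dim_subspace scale H'"
    and F: "\<And>x. x \<in> H \<Longrightarrow> F x \<in> H'" and G: "\<And>x. x \<in> H' \<Longrightarrow> G x \<in> H"
    and GF: "\<And>x. x \<in> H \<Longrightarrow> G (F x) = x" and FG: "\<And>x. x \<in> H' \<Longrightarrow> F (G x) = x"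
    and F_add: "\<And>x y. x \<in> H \<Longrightarrow> y \<in> H \<Longrightarrow> F (x + y) = F x + F y"
    and F_scale: "\<And>c x. x \<in> H \<Longrightarrow> F (c *s x) = c *s F x"
  shows "dim H = dim H'"
proof -
  interpret H': finite_dim_subspace scale H' by (rule H')
  obtain B where B: "basis_of B" by (rule basis_of_exists)
  have F0: "F 0 = 0" using F_scale[of 0 0] subspace_0[OF subspace_H] by simp
  have Fsum: "F (\<Sum>b\<in>A. c b *s b) = (\<Sum>b\<in>A. c b *s F b)" if "finite A" "A \<subseteq> B" for A c
    using that
  proof (induction A)
    case (insert b A)
    then have "b \<in> H" "(\<Sum>b\<in>A. c b *s b) \<in> H"
      using basis_in[OF B] by (auto intro!: subspace_sum[OF subspace_H] subspace_scale[OF subspace_H])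
    then show ?case using insert by (simp add: F_add F_scale subspace_scale[OF subspace_H])
  qed (simp add: F0)
  have fin: "finite B" using B by (simp add: basis_of_def)
  have "dim H' = card B"
  proof (rule H'.dim_eq_card_family[of B F])
    show "finite B" by (rule fin)
    show "F b \<in> H'" if "b \<in> B" for b using F basis_in[OF B that] by simp
    show "\<exists>c. x = (\<Sum>b\<in>B. c b *s F b)" if "x \<in> H'" for x
      using Fsum[OF fin order_refl, of "representation B (G x)"] expand[OF B G[OF that]] FG[OF that]
      by auto
    fix c k assume 0: "(\<Sum>b\<in>B. c b *s F b) = 0" and k: "k \<in> B"
    have s: "(\<Sum>b\<in>B. c b *s b) \<in> H"
      using basis_in[OF B] by (auto intro!: subspace_sum[OF subspace_H] subspace_scale[OF subspace_H])
    have "F (\<Sum>b\<in>B. c b *s b) = F 0" using 0 Fsum[OF fin order_refl, of c] F0 by simp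
    then have "(\<Sum>b\<in>B. c b *s b) = 0" using GF[OF s] GF[OF subspace_0[OF subspace_H]] by simp
    then show "c k = 0" using B k independentD[of B B c k] by (auto simp: basis_of_def)
  qed
  moreover have "dim H = card B"
    using B basis_in[OF B] by (intro basis_card_eq_dim[symmetric]) (auto simp: basis_of_def)
  ultimately show ?thesis by simp
qed

end

section \<open>Strict monoidal categories\<close>

text \<open>Objects are lists and their tensor product is concatenation, which is associative on the
  nose, so diagrams carry no associators. The simplification rules distribute identity strands over
  composites and nest composites to the right; a move of diagrams is then an equation between
  adjacent factors of a chain.\<close>

locale strict_monoidal =
  fixes valid :: "'a \<Rightarrow> bool"
    and src tgt :: "'a \<Rightarrow> 'o list"
    and cmp :: "'a \<Rightarrow> 'a \<Rightarrow> 'a"  (infixr "\<bullet>" 60)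
    and tns :: "'a \<Rightarrow> 'a \<Rightarrow> 'a"  (infixr "\<odot>" 70)
    and I :: "'o list \<Rightarrow> 'a"
  assumes src_cmp [simp]: "src (g \<bullet> f) = src f"
    and tgt_cmp [simp]: "tgt (g \<bullet> f) = tgt g"
    and src_tns [simp]: "src (f \<odot> g) = src f @ src g"
    and tgt_tns [simp]: "tgt (f \<odot> g) = tgt f @ tgt g"
    and src_I [simp]: "src (I l) = l"
    and tgt_I [simp]: "tgt (I l) = l"
    and valid_I [simp]: "valid (I l)"
    and valid_cmp [simp]: "\<lbrakk>valid g; valid f; src g = tgt f\<rbrakk> \<Longrightarrow> valid (g \<bullet> f)"
    and valid_tns [simp]: "\<lbrakk>valid f; valid g\<rbrakk> \<Longrightarrow> valid (f \<odot> g)"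
    and cmp_assoc [simp]: "\<lbrakk>valid h; valid g; valid f; src h = tgt g; src g = tgt f\<rbrakk>
          \<Longrightarrow> (h \<bullet> g) \<bullet> f = h \<bullet> (g \<bullet> f)"
    and cmp_I [simp]: "\<lbrakk>valid f; src f = l\<rbrakk> \<Longrightarrow> f \<bullet> I l = f"
    and I_cmp [simp]: "\<lbrakk>valid f; tgt f = l\<rbrakk> \<Longrightarrow> I l \<bullet> f = f"
    and tns_assoc [simp]: "\<lbrakk>valid f; valid g; valid h\<rbrakk> \<Longrightarrow> (f \<odot> g) \<odot> h = f \<odot> (g \<odot> h)"
    and tns_I [simp]: "I l \<odot> I m = I (l @ m)"
    and I_Nil_tns [simp]: "valid f \<Longrightarrow> I [] \<odot> f = f"
    and tns_I_Nil [simp]: "valid f \<Longrightarrow> f \<odot> I [] = f"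
    and interchange: "\<lbrakk>valid f; valid g; valid f'; valid g'; src g = tgt f; src g' = tgt f'\<rbrakk>
          \<Longrightarrow> (g \<bullet> f) \<odot> (g' \<bullet> f') = (g \<odot> g') \<bullet> (f \<odot> f')"
begin

lemma tns_I_assoc [simp]: "valid f \<Longrightarrow> I l \<odot> (I m \<odot> f) = I (l @ m) \<odot> f"
  by (metis tns_I tns_assoc valid_I)

lemma whisker_left [simp]:
  "\<lbrakk>valid g; valid f; src g = tgt f\<rbrakk> \<Longrightarrow> I l \<odot> (g \<bullet> f) = (I l \<odot> g) \<bullet> (I l \<odot> f)"
  using interchange[of "I l" "I l" f g] by simp

lemma whisker_right [simp]:
  "\<lbrakk>valid g; valid f; src g = tgt f\<rbrakk> \<Longrightarrow> (g \<bullet> f) \<odot> I l = (g \<odot> I l) \<bullet> (f \<odot> I l)"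
  using interchange[of f g "I l" "I l"] by simp

lemma tns_eq1: "\<lbrakk>valid f; valid g\<rbrakk> \<Longrightarrow> f \<odot> g = (f \<odot> I (tgt g)) \<bullet> (I (src f) \<odot> g)"
  using interchange[of "I (src f)" f g "I (tgt g)"] by simp

lemma tns_eq2: "\<lbrakk>valid f; valid g\<rbrakk> \<Longrightarrow> f \<odot> g = (I (tgt f) \<odot> g) \<bullet> (f \<odot> I (src g))"
  using interchange[of f "I (tgt f)" "I (src g)" g] by simp

text \<open>Both orders equal \<open>f \<odot> I m \<odot> g\<close>; \<open>m\<close> is the bundle
  of strands between the two boxes.\<close>

lemma exchange:
  "\<lbrakk>valid f; valid g\<rbrakk> \<Longrightarrow>
   (f \<odot> I (m @ tgt g)) \<bullet> (I (src f @ m) \<odot> g) = (I (tgt f @ m) \<odot> g) \<bullet> (f \<odot> I (m @ src g))"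
  using tns_eq1[of f "I m \<odot> g"] tns_eq2[of f "I m \<odot> g"] by simp

text \<open>Since composites are nested to the right, an equation for two adjacent factors does not
  match inside a longer chain; this applies it at the head.\<close>

lemma rewrite_head:
  "\<lbrakk>a \<bullet> b = c; valid a; valid b; valid z; src a = tgt b; src b = tgt z\<rbrakk>
   \<Longrightarrow> a \<bullet> (b \<bullet> z) = c \<bullet> z"
  using cmp_assoc[of a b z] by simp

section \<open>Dual pairs and mates\<close>

definition dpair where
  "dpair a b \<eta> \<epsilon> \<longleftrightarrow>
     valid \<eta> \<and> src \<eta> = [] \<and> tgt \<eta> = a @ b \<and> valid \<epsilon> \<and> src \<epsilon> = b @ a \<and> tgt \<epsilon> = [] \<and>
     (I a \<odot> \<epsilon>) \<bullet> (\<eta> \<odot> I a) = I a \<and> (\<epsilon> \<odot> I b) \<bullet> (I b \<odot> \<eta>) = I b"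

lemma dpairD:
  assumes "dpair a b \<eta> \<epsilon>"
  shows "valid \<eta>" "src \<eta> = []" "tgt \<eta> = a @ b" "valid \<epsilon>" "src \<epsilon> = b @ a" "tgt \<epsilon> = []"
    and "(I a \<odot> \<epsilon>) \<bullet> (\<eta> \<odot> I a) = I a" "(\<epsilon> \<odot> I b) \<bullet> (I b \<odot> \<eta>) = I b"
  using assms by (auto simp: dpair_def)

lemma exchange_whisker:
  assumes [simp]: "valid f" "valid g"
  shows "(I l \<odot> f \<odot> I (m @ tgt g @ r)) \<bullet> (I (l @ src f @ m) \<odot> g \<odot> I r)
       = (I (l @ tgt f @ m) \<odot> g \<odot> I r) \<bullet> (I l \<odot> f \<odot> I (m @ src g @ r))"
proof -
  have "I l \<odot> ((f \<odot> I (m @ tgt g)) \<bullet> (I (src f @ m) \<odot> g)) \<odot> I r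
      = I l \<odot> ((I (tgt f @ m) \<odot> g) \<bullet> (f \<odot> I (m @ src g))) \<odot> I r"
    by (simp only: exchange[OF assms])
  then show ?thesis by simp
qed

lemma zigzag_left:
  assumes "dpair a b \<eta> \<epsilon>"
  shows "(I (l @ a) \<odot> \<epsilon> \<odot> I r) \<bullet> (I l \<odot> \<eta> \<odot> I (a @ r)) = I (l @ a @ r)"
proof -
  note [simp] = dpairD(1-6)[OF assms]
  have "I l \<odot> ((I a \<odot> \<epsilon>) \<bullet> (\<eta> \<odot> I a)) \<odot> I r = I l \<odot> I a \<odot> I r"
    by (simp only: dpairD(7)[OF assms])
  then show ?thesis by simp
qed

lemma zigzag_right:
  assumes "dpair a b \<eta> \<epsilon>"
  shows "(I l \<odot> \<epsilon> \<odot> I (b @ r)) \<bullet> (I (l @ b) \<odot> \<eta> \<odot> I r) = I (l @ b @ r)"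
proof -
  note [simp] = dpairD(1-6)[OF assms]
  have "I l \<odot> ((\<epsilon> \<odot> I b) \<bullet> (I b \<odot> \<eta>)) \<odot> I r = I l \<odot> I b \<odot> I r"
    by (simp only: dpairD(8)[OF assms])
  then show ?thesis by simp
qed

text \<open>Place the two cups side by side and join them by \<epsilon>: straightening the zigzag of
  the first pair leaves \<eta>', straightening that of the second leaves \<eta>.\<close>

lemma dpair_coev_unique:
  assumes 1: "dpair a b \<eta> \<epsilon>" and 2: "dpair a b \<eta>' \<epsilon>"
  shows "\<eta> = \<eta>'"
proof -
  note [simp] = dpairD(1-6)[OF 1] dpairD(1-6)[OF 2]
  have "\<eta>' = ((I a \<odot> \<epsilon> \<odot> I b) \<bullet> (I (a @ b) \<odot> \<eta>)) \<bullet> \<eta>'"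
    using zigzag_right[OF 1, of a "[]"] by simp
  also have "\<dots> = (I a \<odot> \<epsilon> \<odot> I b) \<bullet> ((I (a @ b) \<odot> \<eta>) \<bullet> \<eta>')" by simp
  also have "(I (a @ b) \<odot> \<eta>) \<bullet> \<eta>' = (\<eta>' \<odot> I (a @ b)) \<bullet> \<eta>"
    using exchange[of \<eta>' \<eta> "[]"] by simp
  also have "(I a \<odot> \<epsilon> \<odot> I b) \<bullet> ((\<eta>' \<odot> I (a @ b)) \<bullet> \<eta>)
      = ((I a \<odot> \<epsilon> \<odot> I b) \<bullet> (\<eta>' \<odot> I (a @ b))) \<bullet> \<eta>" by simp
  also have "\<dots> = \<eta>"
    using zigzag_left[OF 2, of "[]" b] by simp
  finally show ?thesis by simp
qed

lemma dpair_ev_unique: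
  assumes 1: "dpair a b \<eta> \<epsilon>" and 2: "dpair a b \<eta> \<epsilon>'"
  shows "\<epsilon> = \<epsilon>'"
proof -
  note [simp] = dpairD(1-6)[OF 1] dpairD(1-6)[OF 2]
  have "\<epsilon>' = \<epsilon>' \<bullet> ((\<epsilon> \<odot> I (b @ a)) \<bullet> (I b \<odot> \<eta> \<odot> I a))"
    using zigzag_right[OF 1, of "[]" a] by simp
  also have "\<dots> = (\<epsilon>' \<bullet> (\<epsilon> \<odot> I (b @ a))) \<bullet> (I b \<odot> \<eta> \<odot> I a)" by simp
  also have "\<epsilon>' \<bullet> (\<epsilon> \<odot> I (b @ a)) = \<epsilon> \<bullet> (I (b @ a) \<odot> \<epsilon>')"
    using exchange[of \<epsilon> \<epsilon>' "[]"] by simp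
  also have "(\<epsilon> \<bullet> (I (b @ a) \<odot> \<epsilon>')) \<bullet> (I b \<odot> \<eta> \<odot> I a) = \<epsilon>"
    using zigzag_left[OF 2, of b "[]"] by simp
  finally show ?thesis by simp
qed

text \<open>A cup is nondegenerate: bending the strand \<open>a\<close> back by \<epsilon> recovers
  \<open>h\<close> from \<open>(h \<odot> I a) \<bullet> \<eta>\<close>.\<close>

lemma dpair_coev_cancel:
  assumes 1: "dpair b a \<eta> \<epsilon>" and [simp]: "valid h" "src h = b" "tgt h = b"
    and fix_coev: "(h \<odot> I a) \<bullet> \<eta> = \<eta>"
  shows "h = I b"
proof -
  note [simp] = dpairD(1-6)[OF 1]
  have "h = h \<bullet> ((I b \<odot> \<epsilon>) \<bullet> (\<eta> \<odot> I b))" by (simp only: dpairD(7)[OF 1]) simp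
  also have "\<dots> = (h \<bullet> (I b \<odot> \<epsilon>)) \<bullet> (\<eta> \<odot> I b)" by simp
  also have "h \<bullet> (I b \<odot> \<epsilon>) = (I b \<odot> \<epsilon>) \<bullet> (h \<odot> I (a @ b))"
    using exchange[of h \<epsilon> "[]"] by simp
  also have "((I b \<odot> \<epsilon>) \<bullet> (h \<odot> I (a @ b))) \<bullet> (\<eta> \<odot> I b) = (I b \<odot> \<epsilon>) \<bullet> (((h \<odot> I a) \<bullet> \<eta>) \<odot> I b)"
    by simp
  also have "\<dots> = I b" using dpairD(7)[OF 1] by (simp only: fix_coev)
  finally show ?thesis .
qed

text \<open>The dual morphism \<open>b' -> b\<close> of \<open>f : a -> a'\<close> for arbitrary
  choices of dual pairs; for \<open>f\<close> an identity it compares two duals of one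
  object.\<close>

definition mate where
  "mate b b' \<epsilon>' f \<eta> = (\<epsilon>' \<odot> I b) \<bullet> (I b' \<odot> f \<odot> I b) \<bullet> (I b' \<odot> \<eta>)"

text \<open>A box slides around a cap or a cup and comes out as its mate; each of the two equations
  is one exchange followed by one zigzag.\<close>

lemma
  assumes 1: "dpair a b \<eta> \<epsilon>" and 2: "dpair a' b' \<eta>' \<epsilon>'"
    and f: "valid f" "src f = a" "tgt f = a'"
  shows mate_valid: "valid (mate b b' \<epsilon>' f \<eta>)"
    and src_mate: "src (mate b b' \<epsilon>' f \<eta>) = b'"
    and tgt_mate: "tgt (mate b b' \<epsilon>' f \<eta>) = b"
    and mate_ev: "\<epsilon> \<bullet> (mate b b' \<epsilon>' f \<eta> \<odot> I a) = \<epsilon>' \<bullet> (I b' \<odot> f)"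
    and mate_coev: "(I a' \<odot> mate b b' \<epsilon>' f \<eta>) \<bullet> \<eta>' = (f \<odot> I b) \<bullet> \<eta>"
proof -
  note [simp] = dpairD(1-6)[OF 1] dpairD(1-6)[OF 2] f
  note [simp] = mate_def
  show "valid (mate b b' \<epsilon>' f \<eta>)" "src (mate b b' \<epsilon>' f \<eta>) = b'" "tgt (mate b b' \<epsilon>' f \<eta>) = b"
    by simp_all
  let ?g = "\<epsilon>' \<bullet> (I b' \<odot> f)"
  have "\<epsilon> \<bullet> (mate b b' \<epsilon>' f \<eta> \<odot> I a)
      = (\<epsilon> \<bullet> (?g \<odot> I (b @ a))) \<bullet> (I b' \<odot> \<eta> \<odot> I a)" by simp
  also have "\<epsilon> \<bullet> (?g \<odot> I (b @ a)) = ?g \<bullet> (I (b' @ a) \<odot> \<epsilon>)"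
    using exchange[of ?g \<epsilon> "[]"] by (simp del: whisker_right)
  also have "(?g \<bullet> (I (b' @ a) \<odot> \<epsilon>)) \<bullet> (I b' \<odot> \<eta> \<odot> I a) = ?g"
    using zigzag_left[OF 1, of b' "[]"] by simp
  finally show "\<epsilon> \<bullet> (mate b b' \<epsilon>' f \<eta> \<odot> I a) = \<epsilon>' \<bullet> (I b' \<odot> f)" .
  let ?h = "(f \<odot> I b) \<bullet> \<eta>"
  have "(I a' \<odot> mate b b' \<epsilon>' f \<eta>) \<bullet> \<eta>'
      = (I a' \<odot> \<epsilon>' \<odot> I b) \<bullet> ((I (a' @ b') \<odot> ?h) \<bullet> \<eta>')" by simp
  also have "(I (a' @ b') \<odot> ?h) \<bullet> \<eta>' = (\<eta>' \<odot> I (a' @ b)) \<bullet> ?h"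
    using exchange[of \<eta>' ?h "[]"] by (simp del: whisker_left)
  also have "(I a' \<odot> \<epsilon>' \<odot> I b) \<bullet> ((\<eta>' \<odot> I (a' @ b)) \<bullet> ?h)
      = ((I a' \<odot> \<epsilon>' \<odot> I b) \<bullet> (\<eta>' \<odot> I (a' @ b))) \<bullet> ?h" by simp
  also have "\<dots> = ?h"
    using zigzag_left[OF 2, of "[]" b] by simp
  finally show "(I a' \<odot> mate b b' \<epsilon>' f \<eta>) \<bullet> \<eta>' = (f \<odot> I b) \<bullet> \<eta>" .
qed

lemma mate_inverse:
  assumes 1: "dpair a b \<eta> \<epsilon>" and 2: "dpair a b' \<eta>' \<epsilon>'"
  shows "mate b' b \<epsilon> (I a) \<eta>' \<bullet> mate b b' \<epsilon>' (I a) \<eta> = I b'"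
proof -
  note [simp] = dpairD(1-6)[OF 1] dpairD(1-6)[OF 2]
  let ?p = "mate b b' \<epsilon>' (I a) \<eta>"
  note [simp] = mate_valid[OF 1 2] src_mate[OF 1 2] tgt_mate[OF 1 2]
  have "mate b' b \<epsilon> (I a) \<eta>' \<bullet> ?p = (\<epsilon> \<odot> I b') \<bullet> ((I b \<odot> \<eta>') \<bullet> ?p)"
    by (simp add: mate_def[of b' b])
  also have "(I b \<odot> \<eta>') \<bullet> ?p = (?p \<odot> I (a @ b')) \<bullet> (I b' \<odot> \<eta>')"
    using exchange[of ?p \<eta>' "[]"] by simp
  also have "(\<epsilon> \<odot> I b') \<bullet> ((?p \<odot> I (a @ b')) \<bullet> (I b' \<odot> \<eta>'))
      = ((\<epsilon> \<bullet> (?p \<odot> I a)) \<odot> I b') \<bullet> (I b' \<odot> \<eta>')" by simp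
  also have "\<dots> = I b'"
    using mate_ev[OF 1 2, of "I a"] dpairD(8)[OF 2] by simp
  finally show ?thesis .
qed

text \<open>Cups and caps are nested, hence the reversed order of the duals. Once
  \<open>\<eta>2\<close> and \<epsilon> have been exchanged, the two zigzags straighten one after
  the other.\<close>

lemma dpair_tns:
  assumes 1: "dpair a b \<eta> \<epsilon>" and 2: "dpair a2 b2 \<eta>2 \<epsilon>2"
  shows "dpair (a @ a2) (b2 @ b) ((I a \<odot> \<eta>2 \<odot> I b) \<bullet> \<eta>) (\<epsilon>2 \<bullet> (I b2 \<odot> \<epsilon> \<odot> I a2))"
proof -
  note [simp] = dpairD(1-6)[OF 1] dpairD(1-6)[OF 2]
  have "(I (a @ a2) \<odot> (\<epsilon>2 \<bullet> (I b2 \<odot> \<epsilon> \<odot> I a2))) \<bullet> (((I a \<odot> \<eta>2 \<odot> I b) \<bullet> \<eta>) \<odot> I (a @ a2))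
     = (I (a @ a2) \<odot> \<epsilon>2) \<bullet> (((I (a @ a2 @ b2) \<odot> \<epsilon> \<odot> I a2) \<bullet> (I a \<odot> \<eta>2 \<odot> I (b @ a @ a2)))
        \<bullet> (\<eta> \<odot> I (a @ a2)))" by simp
  also have "(I (a @ a2 @ b2) \<odot> \<epsilon> \<odot> I a2) \<bullet> (I a \<odot> \<eta>2 \<odot> I (b @ a @ a2))
     = (I a \<odot> \<eta>2 \<odot> I a2) \<bullet> (I a \<odot> \<epsilon> \<odot> I a2)"
    using exchange_whisker[of \<eta>2 \<epsilon> a "[]" a2] by simp
  also have "((I a \<odot> \<eta>2 \<odot> I a2) \<bullet> (I a \<odot> \<epsilon> \<odot> I a2)) \<bullet> (\<eta> \<odot> I (a @ a2)) = I a \<odot> \<eta>2 \<odot> I a2"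
    using zigzag_left[OF 1, of "[]" a2] by simp
  also have "(I (a @ a2) \<odot> \<epsilon>2) \<bullet> (I a \<odot> \<eta>2 \<odot> I a2) = I (a @ a2)"
    using zigzag_left[OF 2, of a "[]"] by simp
  finally have z1: "(I (a @ a2) \<odot> (\<epsilon>2 \<bullet> (I b2 \<odot> \<epsilon> \<odot> I a2))) \<bullet> (((I a \<odot> \<eta>2 \<odot> I b) \<bullet> \<eta>) \<odot> I (a @ a2))
     = I (a @ a2)" .
  have "((\<epsilon>2 \<bullet> (I b2 \<odot> \<epsilon> \<odot> I a2)) \<odot> I (b2 @ b)) \<bullet> (I (b2 @ b) \<odot> ((I a \<odot> \<eta>2 \<odot> I b) \<bullet> \<eta>))
     = (\<epsilon>2 \<odot> I (b2 @ b)) \<bullet> (((I b2 \<odot> \<epsilon> \<odot> I (a2 @ b2 @ b)) \<bullet> (I (b2 @ b @ a) \<odot> \<eta>2 \<odot> I b))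
        \<bullet> (I (b2 @ b) \<odot> \<eta>))" by simp
  also have "(I b2 \<odot> \<epsilon> \<odot> I (a2 @ b2 @ b)) \<bullet> (I (b2 @ b @ a) \<odot> \<eta>2 \<odot> I b)
     = (I b2 \<odot> \<eta>2 \<odot> I b) \<bullet> (I b2 \<odot> \<epsilon> \<odot> I b)"
    using exchange_whisker[of \<epsilon> \<eta>2 b2 "[]" b] by simp
  also have "((I b2 \<odot> \<eta>2 \<odot> I b) \<bullet> (I b2 \<odot> \<epsilon> \<odot> I b)) \<bullet> (I (b2 @ b) \<odot> \<eta>) = I b2 \<odot> \<eta>2 \<odot> I b"
    using zigzag_right[OF 1, of b2 "[]"] by simp
  also have "(\<epsilon>2 \<odot> I (b2 @ b)) \<bullet> (I b2 \<odot> \<eta>2 \<odot> I b) = I (b2 @ b)"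
    using zigzag_right[OF 2, of "[]" b] by simp
  finally show ?thesis using z1 unfolding dpair_def by simp
qed

section \<open>Transport along isomorphisms\<close>

definition inverses where
  "inverses a a' u ui \<longleftrightarrow> valid u \<and> src u = a \<and> tgt u = a' \<and> valid ui \<and> src ui = a' \<and> tgt ui = a
     \<and> ui \<bullet> u = I a \<and> u \<bullet> ui = I a'"

lemma inversesD:
  assumes "inverses a a' u ui"
  shows "valid u" "src u = a" "tgt u = a'" "valid ui" "src ui = a'" "tgt ui = a"
    and "ui \<bullet> u = I a" "u \<bullet> ui = I a'"
  using assms by (auto simp: inverses_def)

lemma inverses_sym: "inverses a a' u ui \<Longrightarrow> inverses a' a ui u"
  by (auto simp: inverses_def)

lemma inverses_I: "inverses a a (I a) (I a)"
  by (simp add: inverses_def)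

lemma inverses_tns:
  "\<lbrakk>inverses a a' u ui; inverses b b' v vi\<rbrakk> \<Longrightarrow> inverses (a @ b) (a' @ b') (u \<odot> v) (ui \<odot> vi)"
  by (auto simp: inverses_def interchange[symmetric])

lemma inverses_cmp:
  assumes 1: "inverses a a' u ui" and 2: "inverses a' a'' v vi"
  shows "inverses a a'' (v \<bullet> u) (ui \<bullet> vi)"
proof -
  note [simp] = inversesD[OF 1] inversesD[OF 2]
  have "ui \<bullet> vi \<bullet> v \<bullet> u = I a" "v \<bullet> u \<bullet> ui \<bullet> vi = I a''"
    using rewrite_head[OF inversesD(7)[OF 2], of u] rewrite_head[OF inversesD(8)[OF 1], of vi]
    by simp_all
  then show ?thesis unfolding inverses_def by simp
qed

lemma inverses_mate:
  assumes 1: "dpair a b \<eta> \<epsilon>" and 2: "dpair a b' \<eta>' \<epsilon>'"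
  shows "inverses b' b (mate b b' \<epsilon>' (I a) \<eta>) (mate b' b \<epsilon> (I a) \<eta>')"
  using mate_valid[OF 1 2, of "I a"] src_mate[OF 1 2, of "I a"] tgt_mate[OF 1 2, of "I a"]
    mate_valid[OF 2 1, of "I a"] src_mate[OF 2 1, of "I a"] tgt_mate[OF 2 1, of "I a"]
    mate_inverse[OF 1 2] mate_inverse[OF 2 1]
  by (simp add: inverses_def)

lemma inverses_unique:
  assumes 1: "inverses a a' u v" and 2: "inverses a a' u w"
  shows "v = w"
proof -
  note [simp] = inversesD(1-6)[OF 1] inversesD(1-6)[OF 2]
  have "v = (w \<bullet> u) \<bullet> v" using inversesD(7)[OF 2] by simp
  also have "\<dots> = w \<bullet> (u \<bullet> v)" by simp
  also have "\<dots> = w" by (simp add: inversesD(8)[OF 1])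
  finally show ?thesis .
qed

lemma dpair_transport:
  assumes 1: "dpair a b \<eta> \<epsilon>" and u: "inverses a a' u ui" and v: "inverses b b' v vi"
  shows "dpair a' b' ((u \<odot> v) \<bullet> \<eta>) (\<epsilon> \<bullet> (vi \<odot> ui))"
proof -
  note [simp] = dpairD(1-6)[OF 1] inversesD[OF u] inversesD[OF v]
  have "(I a' \<odot> (\<epsilon> \<bullet> (vi \<odot> ui))) \<bullet> (((u \<odot> v) \<bullet> \<eta>) \<odot> I a')
     = (I a' \<odot> \<epsilon>) \<bullet> (((I a' \<odot> vi \<odot> ui) \<bullet> (u \<odot> v \<odot> I a')) \<bullet> (\<eta> \<odot> I a'))" by simp
  also have "(I a' \<odot> vi \<odot> ui) \<bullet> (u \<odot> v \<odot> I a') = (u \<odot> I (b @ a)) \<bullet> (I (a @ b) \<odot> ui)"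
    using tns_eq1[of u "I b \<odot> ui"] by (simp add: interchange[symmetric] del: whisker_left whisker_right)
  also have "(I a' \<odot> \<epsilon>) \<bullet> (((u \<odot> I (b @ a)) \<bullet> (I (a @ b) \<odot> ui)) \<bullet> (\<eta> \<odot> I a'))
     = ((I a' \<odot> \<epsilon>) \<bullet> (u \<odot> I (b @ a))) \<bullet> ((I (a @ b) \<odot> ui) \<bullet> (\<eta> \<odot> I a'))" by simp
  also have "(I a' \<odot> \<epsilon>) \<bullet> (u \<odot> I (b @ a)) = u \<bullet> (I a \<odot> \<epsilon>)"
    using exchange[of u \<epsilon> "[]"] by simp
  also have "(I (a @ b) \<odot> ui) \<bullet> (\<eta> \<odot> I a') = (\<eta> \<odot> I a) \<bullet> ui"
    using exchange[of \<eta> ui "[]"] by simp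
  also have "(u \<bullet> (I a \<odot> \<epsilon>)) \<bullet> ((\<eta> \<odot> I a) \<bullet> ui) = u \<bullet> (((I a \<odot> \<epsilon>) \<bullet> (\<eta> \<odot> I a)) \<bullet> ui)" by simp
  also have "\<dots> = I a'" using dpairD(7)[OF 1] by simp
  finally have z1: "(I a' \<odot> (\<epsilon> \<bullet> (vi \<odot> ui))) \<bullet> (((u \<odot> v) \<bullet> \<eta>) \<odot> I a') = I a'" .
  have "((\<epsilon> \<bullet> (vi \<odot> ui)) \<odot> I b') \<bullet> (I b' \<odot> ((u \<odot> v) \<bullet> \<eta>))
     = (\<epsilon> \<odot> I b') \<bullet> (((vi \<odot> ui \<odot> I b') \<bullet> (I b' \<odot> u \<odot> v)) \<bullet> (I b' \<odot> \<eta>))" by simp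
  also have "(vi \<odot> ui \<odot> I b') \<bullet> (I b' \<odot> u \<odot> v) = (I (b @ a) \<odot> v) \<bullet> (vi \<odot> I (a @ b))"
    using tns_eq2[of vi "I a \<odot> v"] by (simp add: interchange[symmetric] del: whisker_left whisker_right)
  also have "(\<epsilon> \<odot> I b') \<bullet> (((I (b @ a) \<odot> v) \<bullet> (vi \<odot> I (a @ b))) \<bullet> (I b' \<odot> \<eta>))
     = ((\<epsilon> \<odot> I b') \<bullet> (I (b @ a) \<odot> v)) \<bullet> ((vi \<odot> I (a @ b)) \<bullet> (I b' \<odot> \<eta>))" by simp
  also have "(\<epsilon> \<odot> I b') \<bullet> (I (b @ a) \<odot> v) = v \<bullet> (\<epsilon> \<odot> I b)"
    using exchange[of \<epsilon> v "[]"] by simp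
  also have "(vi \<odot> I (a @ b)) \<bullet> (I b' \<odot> \<eta>) = (I b \<odot> \<eta>) \<bullet> vi"
    using exchange[of vi \<eta> "[]"] by simp
  also have "(v \<bullet> (\<epsilon> \<odot> I b)) \<bullet> ((I b \<odot> \<eta>) \<bullet> vi) = v \<bullet> (((\<epsilon> \<odot> I b) \<bullet> (I b \<odot> \<eta>)) \<bullet> vi)" by simp
  also have "\<dots> = I b'" using dpairD(8)[OF 1] by simp
  finally show ?thesis using z1 unfolding dpair_def by simp
qed

section \<open>Rotation of invariants\<close>

text \<open>The strand \<open>a\<close> in front is bent round to the end. Both the cap and the cup
  have \<open>b\<close> to the left of \<open>a\<close>, so \<open>b\<close> serves as a dual of
  \<open>a\<close> on both sides; this is what a pivotal structure provides.\<close>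

definition rot where
  "rot a b \<epsilon> \<eta> m f = (\<epsilon> \<odot> I (m @ a)) \<bullet> (I b \<odot> f \<odot> I a) \<bullet> \<eta>"

text \<open>The nested caps and cups unfold to the very diagram on the right: \<open>a\<close> is
  bent first, then \<open>a2\<close>.\<close>

lemma rot_tns:
  assumes "valid \<epsilon>" "src \<epsilon> = b @ a" "tgt \<epsilon> = []" "valid \<eta>" "src \<eta> = []" "tgt \<eta> = b @ a"
    and "valid \<epsilon>2" "src \<epsilon>2 = b2 @ a2" "tgt \<epsilon>2 = []" "valid \<eta>2" "src \<eta>2 = []" "tgt \<eta>2 = b2 @ a2"
    and "valid f" "src f = []" "tgt f = a @ a2 @ m"
  shows "rot (a @ a2) (b2 @ b) (\<epsilon>2 \<bullet> (I b2 \<odot> \<epsilon> \<odot> I a2)) ((I b2 \<odot> \<eta> \<odot> I a2) \<bullet> \<eta>2) m f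
       = rot a2 b2 \<epsilon>2 \<eta>2 (m @ a) (rot a b \<epsilon> \<eta> (a2 @ m) f)"
  using assms by (simp add: rot_def)

lemma valid_rot:
  assumes "valid \<epsilon>" "src \<epsilon> = b @ a" "tgt \<epsilon> = []" "valid \<eta>" "src \<eta> = []" "tgt \<eta> = b @ a"
    and "valid f" "src f = []" "tgt f = a @ m"
  shows "valid (rot a b \<epsilon> \<eta> m f)" "src (rot a b \<epsilon> \<eta> m f) = []" "tgt (rot a b \<epsilon> \<eta> m f) = m @ a"
  using assms by (simp_all add: rot_def)

lemma rot_natural:
  assumes [simp]: "valid \<epsilon>" "src \<epsilon> = b @ a" "tgt \<epsilon> = []" "valid \<eta>" "src \<eta> = []" "tgt \<eta> = b @ a"
    "valid f" "src f = []" "tgt f = a @ m" "valid g" "src g = m" "tgt g = m'"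
  shows "rot a b \<epsilon> \<eta> m' ((I a \<odot> g) \<bullet> f) = (g \<odot> I a) \<bullet> rot a b \<epsilon> \<eta> m f"
proof -
  have "rot a b \<epsilon> \<eta> m' ((I a \<odot> g) \<bullet> f)
      = ((\<epsilon> \<odot> I (m' @ a)) \<bullet> (I (b @ a) \<odot> g \<odot> I a)) \<bullet> (I b \<odot> f \<odot> I a) \<bullet> \<eta>"
    by (simp add: rot_def)
  also have "(\<epsilon> \<odot> I (m' @ a)) \<bullet> (I (b @ a) \<odot> g \<odot> I a) = (g \<odot> I a) \<bullet> (\<epsilon> \<odot> I (m @ a))"
    using exchange_whisker[of \<epsilon> g "[]" "[]" a] by simp
  also have "((g \<odot> I a) \<bullet> (\<epsilon> \<odot> I (m @ a))) \<bullet> (I b \<odot> f \<odot> I a) \<bullet> \<eta> = (g \<odot> I a) \<bullet> rot a b \<epsilon> \<eta> m f"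
    by (simp add: rot_def)
  finally show ?thesis .
qed

lemma rot_transport:
  assumes [simp]: "valid \<epsilon>" "src \<epsilon> = b @ a" "tgt \<epsilon> = []" "valid \<eta>" "src \<eta> = []" "tgt \<eta> = b @ a"
    "valid f" "src f = []" "tgt f = a @ m"
    and u: "inverses a a' u ui" and v: "inverses b b' v vi"
  shows "rot a' b' (\<epsilon> \<bullet> (vi \<odot> ui)) ((v \<odot> u) \<bullet> \<eta>) m ((u \<odot> I m) \<bullet> f) = (I m \<odot> u) \<bullet> rot a b \<epsilon> \<eta> m f"
proof -
  note [simp] = inversesD[OF u] inversesD[OF v]
  have "rot a' b' (\<epsilon> \<bullet> (vi \<odot> ui)) ((v \<odot> u) \<bullet> \<eta>) m ((u \<odot> I m) \<bullet> f)
      = (\<epsilon> \<odot> I (m @ a')) \<bullet> ((vi \<odot> (ui \<odot> I (m @ a'))) \<bullet> (I b' \<odot> ((u \<odot> I m) \<bullet> f) \<odot> I a') \<bullet> (v \<odot> u)) \<bullet> \<eta>"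
    by (simp add: rot_def)
  also have "(I b' \<odot> ((u \<odot> I m) \<bullet> f) \<odot> I a') \<bullet> (v \<odot> u) = v \<odot> ((u \<odot> I m) \<bullet> f) \<odot> u"
    using interchange[of v "I b'" u "((u \<odot> I m) \<bullet> f) \<odot> I a'"] tns_eq1[of "(u \<odot> I m) \<bullet> f" u]
    by (simp del: whisker_left whisker_right)
  also have "(vi \<odot> (ui \<odot> I (m @ a'))) \<bullet> (v \<odot> ((u \<odot> I m) \<bullet> f) \<odot> u)
      = I b \<odot> ((ui \<odot> I m) \<bullet> (u \<odot> I m) \<bullet> f) \<odot> u"
    using interchange[of v vi "((u \<odot> I m) \<bullet> f) \<odot> u" "ui \<odot> I (m @ a')"]
      interchange[of "(u \<odot> I m) \<bullet> f" "ui \<odot> I m" u "I a'"]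
    by (simp del: whisker_left whisker_right)
  also have "(ui \<odot> I m) \<bullet> (u \<odot> I m) \<bullet> f = f"
    using rewrite_head[of "ui \<odot> I m" "u \<odot> I m" "I (a @ m)" f]
    by (simp add: interchange[symmetric] del: whisker_left whisker_right)
  also have "I b \<odot> f \<odot> u = (I (b @ a @ m) \<odot> u) \<bullet> (I b \<odot> f \<odot> I a)"
    using arg_cong[OF tns_eq2[of f u], of "\<lambda>x. I b \<odot> x"] by simp
  also have "(\<epsilon> \<odot> I (m @ a')) \<bullet> ((I (b @ a @ m) \<odot> u) \<bullet> (I b \<odot> f \<odot> I a)) \<bullet> \<eta>
      = ((\<epsilon> \<odot> I (m @ a')) \<bullet> (I (b @ a @ m) \<odot> u)) \<bullet> (I b \<odot> f \<odot> I a) \<bullet> \<eta>" by simp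
  also have "(\<epsilon> \<odot> I (m @ a')) \<bullet> (I (b @ a @ m) \<odot> u) = (I m \<odot> u) \<bullet> (\<epsilon> \<odot> I (m @ a))"
    using exchange[of \<epsilon> u m] by simp
  also have "((I m \<odot> u) \<bullet> (\<epsilon> \<odot> I (m @ a))) \<bullet> (I b \<odot> f \<odot> I a) \<bullet> \<eta> = (I m \<odot> u) \<bullet> rot a b \<epsilon> \<eta> m f"
    by (simp add: rot_def)
  finally show ?thesis .
qed

text \<open>With no strand left over, \<open>nat\<close> replaces the cap by the one on the other
  side of \<open>f\<close>, and the zigzag of \<eta> and \<epsilon>' straightens.\<close>

lemma rot_id:
  assumes 1: "dpair b a \<eta> \<epsilon>'"
    and [simp]: "valid \<epsilon>" "src \<epsilon> = b @ a" "tgt \<epsilon> = []" "valid f" "src f = []" "tgt f = a"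
    and nat: "\<epsilon> \<bullet> (I b \<odot> f) = \<epsilon>' \<bullet> (f \<odot> I b)"
  shows "rot a b \<epsilon> \<eta> [] f = f"
proof -
  note [simp] = dpairD(1-6)[OF 1]
  have "rot a b \<epsilon> \<eta> [] f = ((\<epsilon> \<bullet> (I b \<odot> f)) \<odot> I a) \<bullet> \<eta>" by (simp add: rot_def)
  also have "\<dots> = (\<epsilon>' \<odot> I a) \<bullet> (f \<odot> I (b @ a)) \<bullet> \<eta>" by (simp add: nat)
  also have "(f \<odot> I (b @ a)) \<bullet> \<eta> = (I a \<odot> \<eta>) \<bullet> f"
    using exchange[of f \<eta> "[]"] by simp
  also have "(\<epsilon>' \<odot> I a) \<bullet> (I a \<odot> \<eta>) \<bullet> f = f"
    using rewrite_head[OF dpairD(8)[OF 1], of f] by simp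
  finally show ?thesis .
qed

end

section \<open>Strict braided categories\<close>

locale strict_braided = strict_monoidal valid src tgt cmp tns I
  for valid :: "'a \<Rightarrow> bool" and src tgt :: "'a \<Rightarrow> 'o list"
    and cmp :: "'a \<Rightarrow> 'a \<Rightarrow> 'a"  (infixr "\<bullet>" 60)
    and tns :: "'a \<Rightarrow> 'a \<Rightarrow> 'a"  (infixr "\<odot>" 70)
    and I :: "'o list \<Rightarrow> 'a" +
  fixes c ci :: "'o list \<Rightarrow> 'o list \<Rightarrow> 'a"
  assumes braid_inverses: "inverses (l @ m) (m @ l) (c l m) (ci l m)"
    and braid_natural: "\<lbrakk>valid f; valid g\<rbrakk>
          \<Longrightarrow> c (tgt f) (tgt g) \<bullet> (f \<odot> g) = (g \<odot> f) \<bullet> c (src f) (src g)"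
    and hexagon1: "c l (m @ k) = (I m \<odot> c l k) \<bullet> (c l m \<odot> I k)"
    and hexagon2: "c (l @ m) k = (c l k \<odot> I m) \<bullet> (I l \<odot> c m k)"
begin

lemmas braid_simps [simp] = inversesD[OF braid_inverses]

text \<open>The hexagon with empty lists makes this crossing idempotent, and an invertible
  idempotent is an identity.\<close>

lemma braid_Nil_right [simp]: "c l [] = I l"
proof -
  have "c l [] \<bullet> c l [] = c l []" using hexagon1[of l "[]" "[]"] by simp
  then have "ci l [] \<bullet> c l [] \<bullet> c l [] = ci l [] \<bullet> c l []" by simp
  then show ?thesis using rewrite_head[OF braid_simps(7)[of l "[]"], of "c l []"] by simp
qed

lemma braid_Nil_left [simp]: "c [] l = I l"
proof -
  have "c [] l \<bullet> c [] l = c [] l" using hexagon2[of "[]" "[]" l] by simp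
  then have "ci [] l \<bullet> c [] l \<bullet> c [] l = ci [] l \<bullet> c [] l" by simp
  then show ?thesis using rewrite_head[OF braid_simps(7)[of "[]" l], of "c [] l"] by simp
qed

text \<open>Inverting the crossings interchanges the two hexagons. Every result on a braiding
  thereby has a second version, and both formulas for the rotation come from one lemma.\<close>

lemma reverse: "strict_braided valid src tgt (\<bullet>) (\<odot>) I (\<lambda>l m. ci m l) (\<lambda>l m. c m l)"
proof (unfold_locales, goal_cases)
  case (1 l m)
  show ?case by (rule inverses_sym[OF braid_inverses])
next
  case (2 f g)
  note [simp] = 2
  have "ci (tgt g) (tgt f) \<bullet> (f \<odot> g)
      = ci (tgt g) (tgt f) \<bullet> ((f \<odot> g) \<bullet> c (src g) (src f)) \<bullet> ci (src g) (src f)" by simp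
  also have "(f \<odot> g) \<bullet> c (src g) (src f) = c (tgt g) (tgt f) \<bullet> (g \<odot> f)"
    using braid_natural[of g f] by simp
  also have "ci (tgt g) (tgt f) \<bullet> (c (tgt g) (tgt f) \<bullet> (g \<odot> f)) \<bullet> ci (src g) (src f)
      = (g \<odot> f) \<bullet> ci (src g) (src f)"
    using rewrite_head[OF braid_simps(7)[of "tgt g" "tgt f"], of "(g \<odot> f) \<bullet> ci (src g) (src f)"] by simp
  finally show ?case .
next
  case (3 l m k)
  have "inverses (m @ k @ l) (l @ m @ k) (c (m @ k) l) (ci (m @ k) l)"
    using braid_inverses[of "m @ k" l] by simp
  moreover have "inverses (m @ k @ l) (l @ m @ k) (c (m @ k) l) ((I m \<odot> ci k l) \<bullet> (ci m l \<odot> I k))"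
    unfolding hexagon2
    by (rule inverses_cmp[of _ "m @ l @ k"])
       (use inverses_tns[of m m "I m" "I m", OF _ braid_inverses[of k l]]
          inverses_tns[OF braid_inverses[of m l], of k k "I k" "I k"] in \<open>auto simp: inverses_def\<close>)
  ultimately show ?case by (rule inverses_unique)
next
  case (4 l m k)
  have "inverses (k @ l @ m) (l @ m @ k) (c k (l @ m)) (ci k (l @ m))"
    using braid_inverses[of k "l @ m"] by simp
  moreover have "inverses (k @ l @ m) (l @ m @ k) (c k (l @ m)) ((ci k l \<odot> I m) \<bullet> (I l \<odot> ci k m))"
    unfolding hexagon1
    by (rule inverses_cmp[of _ "l @ k @ m"])
       (use inverses_tns[of l l "I l" "I l", OF _ braid_inverses[of k m]]
          inverses_tns[OF braid_inverses[of k l], of m m "I m" "I m"] in \<open>auto simp: inverses_def\<close>)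
  ultimately show ?case by (rule inverses_unique)
qed

text \<open>A curl of the strand \<open>a\<close>. For the left cap and the pivotal cup it is the
  Drinfeld isomorphism to the double dual followed by the inverse of the pivotal isomorphism, that
  is, a twist.\<close>

definition drinfeld where
  "drinfeld a b \<eta> \<epsilon> = ((\<epsilon> \<bullet> c a b) \<odot> I a) \<bullet> (I a \<odot> \<eta>)"

text \<open>Instead of going round \<open>f\<close>, the strand is pulled across it through the
  braiding; what remains is a curl of \<open>a\<close> and its crossing with
  \<open>m\<close>.\<close>

lemma rot_braid:
  assumes [simp]: "valid \<epsilon>" "src \<epsilon> = b @ a" "tgt \<epsilon> = []" "valid \<eta>" "src \<eta> = []" "tgt \<eta> = b @ a"
    "valid f" "src f = []" "tgt f = a @ m"
  shows "rot a b \<epsilon> \<eta> m f = ci m a \<bullet> (drinfeld a b \<eta> \<epsilon> \<odot> I m) \<bullet> f"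
proof -
  \<comment> \<open>Naturality carries the strand \<open>b\<close> from one side of \<open>f\<close>
    to the other, across \<open>a @ m\<close>.\<close>
  have 1: "I b \<odot> f = (c a b \<odot> I m) \<bullet> (I a \<odot> c m b) \<bullet> (f \<odot> I b)"
    using braid_natural[of f "I b"] by (simp add: hexagon2)
  \<comment> \<open>The cup slides past \<open>m\<close> in the same way, which trades the crossing
    of \<open>m\<close> with \<open>b\<close> for an inverse crossing of \<open>m\<close> with
    \<open>a\<close>.\<close>
  have "(I b \<odot> c m a) \<bullet> (c m b \<odot> I a) \<bullet> (I m \<odot> \<eta>) = \<eta> \<odot> I m"
    using braid_natural[of "I m" \<eta>] by (simp add: hexagon1)
  then have "(I b \<odot> ci m a) \<bullet> (I b \<odot> c m a) \<bullet> (c m b \<odot> I a) \<bullet> (I m \<odot> \<eta>) = (I b \<odot> ci m a) \<bullet> (\<eta> \<odot> I m)"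
    by simp
  moreover have "(I b \<odot> ci m a) \<bullet> (I b \<odot> c m a) = I (b @ m @ a)"
    using whisker_left[of "ci m a" "c m a" b] by (simp del: whisker_left)
  ultimately have 2: "(c m b \<odot> I a) \<bullet> (I m \<odot> \<eta>) = (I b \<odot> ci m a) \<bullet> (\<eta> \<odot> I m)"
    using rewrite_head[of "I b \<odot> ci m a" "I b \<odot> c m a" "I (b @ m @ a)" "(c m b \<odot> I a) \<bullet> (I m \<odot> \<eta>)"] by simp
  have "rot a b \<epsilon> \<eta> m f = (\<epsilon> \<odot> I (m @ a)) \<bullet> ((I b \<odot> f) \<odot> I a) \<bullet> \<eta>" by (simp add: rot_def)
  also have "\<dots> = (\<epsilon> \<odot> I (m @ a)) \<bullet> (c a b \<odot> I (m @ a)) \<bullet> (I a \<odot> c m b \<odot> I a) \<bullet> (f \<odot> I (b @ a)) \<bullet> \<eta>"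
    unfolding 1 by simp
  also have "(f \<odot> I (b @ a)) \<bullet> \<eta> = (I (a @ m) \<odot> \<eta>) \<bullet> f"
    using exchange[of f \<eta> "[]"] by simp
  also have "(I a \<odot> c m b \<odot> I a) \<bullet> (I (a @ m) \<odot> \<eta>) \<bullet> f = (I a \<odot> ((c m b \<odot> I a) \<bullet> (I m \<odot> \<eta>))) \<bullet> f"
    by simp
  also have "\<dots> = (I (a @ b) \<odot> ci m a) \<bullet> (I a \<odot> \<eta> \<odot> I m) \<bullet> f" by (simp add: 2)
  also have "(\<epsilon> \<odot> I (m @ a)) \<bullet> (c a b \<odot> I (m @ a)) \<bullet> (I (a @ b) \<odot> ci m a) \<bullet> (I a \<odot> \<eta> \<odot> I m) \<bullet> f
     = (((\<epsilon> \<bullet> c a b) \<odot> I (m @ a)) \<bullet> (I (a @ b) \<odot> ci m a)) \<bullet> (I a \<odot> \<eta> \<odot> I m) \<bullet> f" by simp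
  also have "((\<epsilon> \<bullet> c a b) \<odot> I (m @ a)) \<bullet> (I (a @ b) \<odot> ci m a) = ci m a \<bullet> ((\<epsilon> \<bullet> c a b) \<odot> I (a @ m))"
    using exchange[of "\<epsilon> \<bullet> c a b" "ci m a" "[]"] by (simp del: whisker_right)
  finally show ?thesis by (simp add: drinfeld_def)
qed

text \<open>Straightening the cup against \<epsilon>' leaves the bare crossing. With
  \<open>drinfeld_coev\<close> this compares the closures of a strand on its two sides.\<close>

lemma drinfeld_ev:
  assumes 1: "dpair b a \<eta>' \<epsilon>'" and [simp]: "valid \<epsilon>" "src \<epsilon> = b @ a" "tgt \<epsilon> = []"
  shows "\<epsilon>' \<bullet> (drinfeld a b \<eta>' \<epsilon> \<odot> I b) = \<epsilon> \<bullet> c a b"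
proof -
  note [simp] = dpairD(1-6)[OF 1]
  have "\<epsilon>' \<bullet> (drinfeld a b \<eta>' \<epsilon> \<odot> I b)
      = (\<epsilon>' \<bullet> ((\<epsilon> \<bullet> c a b) \<odot> I (a @ b))) \<bullet> (I a \<odot> \<eta>' \<odot> I b)" by (simp add: drinfeld_def)
  also have "\<epsilon>' \<bullet> ((\<epsilon> \<bullet> c a b) \<odot> I (a @ b)) = (\<epsilon> \<bullet> c a b) \<bullet> (I (a @ b) \<odot> \<epsilon>')"
    using exchange[of "\<epsilon> \<bullet> c a b" \<epsilon>' "[]"] by (simp del: whisker_right)
  also have "((\<epsilon> \<bullet> c a b) \<bullet> (I (a @ b) \<odot> \<epsilon>')) \<bullet> (I a \<odot> \<eta>' \<odot> I b) = \<epsilon> \<bullet> c a b"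
    using zigzag_left[OF 1, of a "[]"] by simp
  finally show ?thesis .
qed

text \<open>The curl can be redrawn with its loop on the other side, so that the crossing sits on
  the cup instead of the cap.\<close>

lemma drinfeld_coev:
  assumes 1: "dpair a b \<eta> \<epsilon>" and [simp]: "valid \<eta>'" "src \<eta>' = []" "tgt \<eta>' = b @ a"
  shows "(drinfeld a b \<eta>' \<epsilon> \<odot> I b) \<bullet> \<eta> = c b a \<bullet> \<eta>'"
proof -
  note [simp] = dpairD(1-6)[OF 1]
  \<comment> \<open>An auxiliary crossing of \<open>a\<close> with itself appears when the cup is
    moved here, and disappears when the cap is moved in \<open>3\<close>.\<close>
  have "(I b \<odot> c a a) \<bullet> (c a b \<odot> I a) \<bullet> (I a \<odot> \<eta>') = \<eta>' \<odot> I a"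
    using braid_natural[of "I a" \<eta>'] by (simp add: hexagon1)
  then have "(I b \<odot> ci a a) \<bullet> (I b \<odot> c a a) \<bullet> (c a b \<odot> I a) \<bullet> (I a \<odot> \<eta>') = (I b \<odot> ci a a) \<bullet> (\<eta>' \<odot> I a)"
    by simp
  moreover have "(I b \<odot> ci a a) \<bullet> (I b \<odot> c a a) = I (b @ a @ a)"
    using whisker_left[of "ci a a" "c a a" b] by (simp del: whisker_left)
  ultimately have 2: "(c a b \<odot> I a) \<bullet> (I a \<odot> \<eta>') = (I b \<odot> ci a a) \<bullet> (\<eta>' \<odot> I a)"
    using rewrite_head[of "I b \<odot> ci a a" "I b \<odot> c a a" "I (b @ a @ a)" "(c a b \<odot> I a) \<bullet> (I a \<odot> \<eta>')"] by simp
  have "\<epsilon> \<odot> I a = (I a \<odot> \<epsilon>) \<bullet> (c b a \<odot> I a) \<bullet> (I b \<odot> c a a)"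
    using braid_natural[of \<epsilon> "I a"] by (simp add: hexagon2)
  then have "(\<epsilon> \<odot> I a) \<bullet> (I b \<odot> ci a a) = (I a \<odot> \<epsilon>) \<bullet> (c b a \<odot> I a) \<bullet> (I b \<odot> c a a) \<bullet> (I b \<odot> ci a a)"
    by simp
  moreover have "(I b \<odot> c a a) \<bullet> (I b \<odot> ci a a) = I (b @ a @ a)"
    using whisker_left[of "c a a" "ci a a" b] by (simp del: whisker_left)
  ultimately have 3: "(\<epsilon> \<odot> I a) \<bullet> (I b \<odot> ci a a) = (I a \<odot> \<epsilon>) \<bullet> (c b a \<odot> I a)" by simp
  have "drinfeld a b \<eta>' \<epsilon> = (\<epsilon> \<odot> I a) \<bullet> (c a b \<odot> I a) \<bullet> (I a \<odot> \<eta>')" by (simp add: drinfeld_def)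
  also have "\<dots> = ((\<epsilon> \<odot> I a) \<bullet> (I b \<odot> ci a a)) \<bullet> (\<eta>' \<odot> I a)" by (simp add: 2)
  also have "\<dots> = (I a \<odot> \<epsilon>) \<bullet> ((c b a \<bullet> \<eta>') \<odot> I a)" by (simp add: 3)
  finally have "drinfeld a b \<eta>' \<epsilon> = (I a \<odot> \<epsilon>) \<bullet> ((c b a \<bullet> \<eta>') \<odot> I a)" .
  then have "(drinfeld a b \<eta>' \<epsilon> \<odot> I b) \<bullet> \<eta> = (I a \<odot> \<epsilon> \<odot> I b) \<bullet> (((c b a \<bullet> \<eta>') \<odot> I (a @ b)) \<bullet> \<eta>)" by simp
  also have "((c b a \<bullet> \<eta>') \<odot> I (a @ b)) \<bullet> \<eta> = (I (a @ b) \<odot> \<eta>) \<bullet> (c b a \<bullet> \<eta>')"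
    using exchange[of "c b a \<bullet> \<eta>'" \<eta> "[]"] by (simp del: whisker_right)
  also have "(I a \<odot> \<epsilon> \<odot> I b) \<bullet> ((I (a @ b) \<odot> \<eta>) \<bullet> (c b a \<bullet> \<eta>')) = c b a \<bullet> \<eta>'"
    using rewrite_head[OF zigzag_right[OF 1, of a "[]"], of "c b a \<bullet> \<eta>'"] by simp
  finally show ?thesis .
qed

text \<open>The half twist of \<open>k\<close> strands: the braid that reverses their order with
  every pair crossing once. All labels are \<open>x\<close>, so it is an endomorphism.\<close>

primrec half_twist where
  "half_twist x 0 = I []"
| "half_twist x (Suc k) = c [x] (replicate k x) \<bullet> (I [x] \<odot> half_twist x k)"

primrec half_twist_inv where
  "half_twist_inv x 0 = I []"
| "half_twist_inv x (Suc k) = (I [x] \<odot> half_twist_inv x k) \<bullet> ci [x] (replicate k x)"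

lemma half_twist_inverses:
  "inverses (replicate k x) (replicate k x) (half_twist x k) (half_twist_inv x k)"
proof (induction k)
  case 0
  show ?case by (simp add: inverses_def)
next
  case (Suc k)
  have "inverses ([x] @ replicate k x) ([x] @ replicate k x) (I [x] \<odot> half_twist x k) (I [x] \<odot> half_twist_inv x k)"
    by (rule inverses_tns[OF _ Suc]) (simp add: inverses_def)
  from inverses_cmp[OF this braid_inverses] show ?case by (simp add: replicate_append_same)
qed

text \<open>The definition peels off the first strand, this the last. The induction step rearranges
  the crossings of the two extreme strands: \<open>a\<close> is naturality, \<open>b\<close> and
  \<open>d\<close> are hexagons.\<close>

lemma half_twist_Suc': "half_twist x (Suc k) = c (replicate k x) [x] \<bullet> (half_twist x k \<odot> I [x])"
proof (induction k)
  case 0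
  show ?case by simp
next
  case (Suc k)
  let ?U = "replicate k x" and ?H = "half_twist x k"
  note [simp] = inversesD[OF half_twist_inverses] replicate_append_same replicate_app_Cons_same
  have a: "c [x] (x # ?U) \<bullet> (I [x] \<odot> c ?U [x]) = (c ?U [x] \<odot> I [x]) \<bullet> c [x] (x # ?U)"
    using braid_natural[of "I [x]" "c ?U [x]"] by simp
  have b: "c [x] (x # ?U) = (I ?U \<odot> c [x] [x]) \<bullet> (c [x] ?U \<odot> I [x])"
    using hexagon1[of "[x]" ?U "[x]"] by simp
  have d: "c (x # ?U) [x] = (c ?U [x] \<odot> I [x]) \<bullet> (I ?U \<odot> c [x] [x])"
    using hexagon2[of ?U "[x]" "[x]"] by simp
  have "half_twist x (Suc (Suc k)) = c [x] (x # ?U) \<bullet> (I [x] \<odot> (c ?U [x] \<bullet> (?H \<odot> I [x])))"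
    using Suc by simp
  also have "\<dots> = (c [x] (x # ?U) \<bullet> (I [x] \<odot> c ?U [x])) \<bullet> (I [x] \<odot> ?H \<odot> I [x])" by simp
  also have "\<dots> = ((c ?U [x] \<odot> I [x]) \<bullet> (I ?U \<odot> c [x] [x])) \<bullet> ((c [x] ?U \<bullet> (I [x] \<odot> ?H)) \<odot> I [x])"
    unfolding a unfolding b by simp
  also have "\<dots> = c (x # ?U) [x] \<bullet> (half_twist x (Suc k) \<odot> I [x])"
    unfolding d by simp
  finally show ?case by simp
qed

text \<open>With the half twist on the left read by its last strand and that on the right by its
  first, this is naturality of the crossing of \<open>x\<close> with the half twist of the other
  strands.\<close>

lemma half_twist_conj:
  "half_twist x (Suc k) \<bullet> c [x] (replicate k x) = c (replicate k x) [x] \<bullet> half_twist x (Suc k)"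
proof -
  let ?U = "replicate k x" and ?H = "half_twist x k"
  note [simp] = inversesD[OF half_twist_inverses] replicate_append_same replicate_app_Cons_same
  have "half_twist x (Suc k) \<bullet> c [x] ?U = c ?U [x] \<bullet> (?H \<odot> I [x]) \<bullet> c [x] ?U"
    by (simp only: half_twist_Suc') simp
  also have "(?H \<odot> I [x]) \<bullet> c [x] ?U = half_twist x (Suc k)"
    using braid_natural[of "I [x]" ?H] by simp
  finally show ?thesis .
qed

end

section \<open>Strictification\<close>

text \<open>A vector of \<open>'m\<close> may lie in several Hom-spaces, so its ends are recorded
  with it. The type \<open>'x\<close> is either the type of objects or that of lists of objects, and
  composition is shared by both.\<close>

datatype ('x, 'm) arr = Arr (asrc: 'x) (atgt: 'x) (amor: 'm)

context linear_category
begin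

definition acmp :: "('x, 'm) arr \<Rightarrow> ('x, 'm) arr \<Rightarrow> ('x, 'm) arr"  (infixr "\<bullet>" 60) where
  "g \<bullet> f = Arr (asrc f) (atgt g) (amor g \<cdot> amor f)"

definition aval :: "('o, 'm) arr \<Rightarrow> bool" where
  "aval f \<longleftrightarrow> amor f \<in> hom C (asrc f) (atgt f)"

definition aid :: "'o \<Rightarrow> ('o, 'm) arr" where
  "aid X = Arr X X (ident C X)"

lemma acmp_sel [simp]: "asrc (g \<bullet> f) = asrc f" "atgt (g \<bullet> f) = atgt g" "amor (g \<bullet> f) = amor g \<cdot> amor f"
  by (simp_all add: acmp_def)

lemma aid_sel [simp]: "asrc (aid X) = X" "atgt (aid X) = X" "amor (aid X) = ident C X"
  by (simp_all add: aid_def)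

lemma aval_Arr [simp]: "aval (Arr X Y f) \<longleftrightarrow> f \<in> hom C X Y"
  by (simp add: aval_def)

lemma aval_aid [simp]: "aval (aid X)"
  by (simp add: aid_def ident_in_hom)

lemma aval_acmp [simp]: "\<lbrakk>aval g; aval f; asrc g = atgt f\<rbrakk> \<Longrightarrow> aval (g \<bullet> f)"
  using comp_in_hom by (simp add: aval_def)

lemma acmp_assoc [simp]:
  "\<lbrakk>aval h; aval g; aval f; asrc h = atgt g; asrc g = atgt f\<rbrakk> \<Longrightarrow> (h \<bullet> g) \<bullet> f = h \<bullet> (g \<bullet> f)"
  using comp_assoc by (fastforce simp: aval_def acmp_def)

lemma acmp_aid [simp]: "\<lbrakk>aval f; asrc f = X\<rbrakk> \<Longrightarrow> f \<bullet> aid X = f"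
  using comp_ident by (cases f) (simp add: acmp_def)

lemma aid_acmp [simp]: "\<lbrakk>aval f; atgt f = X\<rbrakk> \<Longrightarrow> aid X \<bullet> f = f"
  using ident_comp by (cases f) (simp add: acmp_def)

lemma acmp_head:
  "\<lbrakk>a \<bullet> b = c; aval a; aval b; aval z; asrc a = atgt b; asrc b = atgt z\<rbrakk> \<Longrightarrow> a \<bullet> (b \<bullet> z) = c \<bullet> z"
  using acmp_assoc[of a b z] by simp

definition ainv :: "('o, 'm) arr \<Rightarrow> ('o, 'm) arr \<Rightarrow> bool" where
  "ainv f g \<longleftrightarrow> aval f \<and> aval g \<and> asrc g = atgt f \<and> atgt g = asrc f
     \<and> g \<bullet> f = aid (asrc f) \<and> f \<bullet> g = aid (atgt f)"

lemma ainv_iff: "ainv (Arr X Y f) (Arr Y X g) \<longleftrightarrow> inverse_pair C X Y f g"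
  by (auto simp: ainv_def inverse_pair_def acmp_def aid_def)

lemma ainvD:
  assumes "ainv f g"
  shows "aval f" "aval g" "asrc g = atgt f" "atgt g = asrc f"
    and "g \<bullet> f = aid (asrc f)" "f \<bullet> g = aid (atgt f)"
  using assms by (auto simp: ainv_def)

lemma ainv_sym: "ainv f g \<Longrightarrow> ainv g f"
  by (simp add: ainv_def)

lemma ainv_aid: "ainv (aid X) (aid X)"
  by (simp add: ainv_def)

lemma ainv_acmp:
  assumes 1: "ainv f f'" and 2: "ainv g g'" and m: "asrc g = atgt f"
  shows "ainv (g \<bullet> f) (f' \<bullet> g')"
proof -
  note [simp] = ainvD(1-4)[OF 1] ainvD(1-4)[OF 2] m
  have "g' \<bullet> g \<bullet> f = f" using acmp_head[OF ainvD(5)[OF 2], of f] by simp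
  moreover have "f \<bullet> f' \<bullet> g' = g'" using acmp_head[OF ainvD(6)[OF 1], of g'] by simp
  ultimately show ?thesis unfolding ainv_def using ainvD(5)[OF 1] ainvD(6)[OF 2] by simp
qed

lemma ainv_unique:
  assumes 1: "ainv f g" and 2: "ainv f h"
  shows "g = h"
proof -
  note [simp] = ainvD(1-4)[OF 1] ainvD(1-4)[OF 2]
  have "g = (h \<bullet> f) \<bullet> g" using ainvD(5)[OF 2] by simp
  also have "\<dots> = h \<bullet> (f \<bullet> g)" by simp
  also have "\<dots> = h" by (simp add: ainvD(6)[OF 1])
  finally show ?thesis .
qed

lemma inverse_pair_unique: "inverse_pair C X Y f g \<Longrightarrow> inverse_pair C X Y f h \<Longrightarrow> g = h"
  using ainv_unique[of "Arr X Y f" "Arr Y X g" "Arr Y X h"] by (simp add: ainv_iff)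

lemma minv_eq: "inverse_pair C X Y f g \<Longrightarrow> minv C X Y f = g"
  unfolding minv_def by (rule the_equality) (auto intro: inverse_pair_unique)

lemma inverse_pair_minv: "is_iso C X Y f \<Longrightarrow> inverse_pair C X Y f (minv C X Y f)"
  unfolding is_iso_def using minv_eq by auto

lemma ainv_move_left:
  assumes "ainv f g" "aval x" "aval y" "atgt x = asrc f" "f \<bullet> x = y"
  shows "x = g \<bullet> y"
  using acmp_head[OF ainvD(5)[OF assms(1)], of x] ainvD(1-4)[OF assms(1)] assms(2-) by auto

end

section \<open>Associators with a strict unit\<close>

context linear_monoidal_category
begin

definition atens :: "('o, 'm) arr \<Rightarrow> ('o, 'm) arr \<Rightarrow> ('o, 'm) arr"  (infixr "\<star>" 70) where
  "f \<star> g = Arr (asrc f \<otimes> asrc g) (atgt f \<otimes> atgt g) (amor f \<boxtimes> amor g)"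

lemma atens_sel [simp]: "asrc (f \<star> g) = asrc f \<otimes> asrc g" "atgt (f \<star> g) = atgt f \<otimes> atgt g"
    "amor (f \<star> g) = amor f \<boxtimes> amor g"
  by (simp_all add: atens_def)

lemma aval_atens [simp]: "\<lbrakk>aval f; aval g\<rbrakk> \<Longrightarrow> aval (f \<star> g)"
  using tens_in_hom by (simp add: aval_def)

lemma aid_atens [simp]: "aid X \<star> aid Y = aid (X \<otimes> Y)"
  by (simp add: aid_def atens_def tens_ident)

lemma ainterchange:
  "\<lbrakk>aval f; aval g; aval f'; aval g'; asrc g = atgt f; asrc g' = atgt f'\<rbrakk>
    \<Longrightarrow> (g \<bullet> f) \<star> (g' \<bullet> f') = (g \<star> g') \<bullet> (f \<star> f')"
  using tens_comp by (fastforce simp: aval_def acmp_def atens_def)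

lemma awhisker [simp]:
  "\<lbrakk>aval f; aval g; asrc g = atgt f\<rbrakk> \<Longrightarrow> aid X \<star> (g \<bullet> f) = (aid X \<star> g) \<bullet> (aid X \<star> f)"
  "\<lbrakk>aval f; aval g; asrc g = atgt f\<rbrakk> \<Longrightarrow> (g \<bullet> f) \<star> aid X = (g \<star> aid X) \<bullet> (f \<star> aid X)"
  using ainterchange[of "aid X" "aid X" f g] ainterchange[of f g "aid X" "aid X"] by simp_all

lemmas unit_obj_simps [simp] = unit_obj_left unit_obj_right

lemma aid_unit_atens [simp]: "aval f \<Longrightarrow> aid \<one> \<star> f = f" "aval f \<Longrightarrow> f \<star> aid \<one> = f"
  using unit_left unit_right by (cases f; simp add: atens_def)+

lemma ainv_atens: "ainv f f' \<Longrightarrow> ainv g g' \<Longrightarrow> ainv (f \<star> g) (f' \<star> g')"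
  by (simp add: ainv_def flip: ainterchange)

definition aassoc where "aassoc X Y Z = Arr ((X \<otimes> Y) \<otimes> Z) (X \<otimes> Y \<otimes> Z) (assoc C X Y Z)"
definition aassoc_inv where "aassoc_inv X Y Z = Arr (X \<otimes> Y \<otimes> Z) ((X \<otimes> Y) \<otimes> Z) (assoc_inv C X Y Z)"

lemma ainv_aassoc: "ainv (aassoc X Y Z) (aassoc_inv X Y Z)"
  unfolding aassoc_def aassoc_inv_def assoc_inv_def ainv_iff
  by (rule inverse_pair_minv[OF assoc_iso])

lemma aassoc_simps [simp]:
  "aval (aassoc X Y Z)" "asrc (aassoc X Y Z) = (X \<otimes> Y) \<otimes> Z" "atgt (aassoc X Y Z) = X \<otimes> Y \<otimes> Z"
  "amor (aassoc X Y Z) = assoc C X Y Z"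
  "aval (aassoc_inv X Y Z)" "asrc (aassoc_inv X Y Z) = X \<otimes> Y \<otimes> Z" "atgt (aassoc_inv X Y Z) = (X \<otimes> Y) \<otimes> Z"
  "amor (aassoc_inv X Y Z) = assoc_inv C X Y Z"
  using ainvD(1,2)[OF ainv_aassoc] by (simp_all add: aassoc_def aassoc_inv_def)

lemma aassoc_natural:
  assumes "aval f" "aval g" "aval h"
  shows "aassoc (atgt f) (atgt g) (atgt h) \<bullet> ((f \<star> g) \<star> h) = (f \<star> g \<star> h) \<bullet> aassoc (asrc f) (asrc g) (asrc h)"
  using assms assoc_natural by (simp add: acmp_def aval_def)

lemma apentagon:
  "aassoc W X (Y \<otimes> Z) \<bullet> aassoc (W \<otimes> X) Y Z
    = (aid W \<star> aassoc X Y Z) \<bullet> aassoc W (X \<otimes> Y) Z \<bullet> (aassoc W X Y \<star> aid Z)"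
proof -
  have "(aid W \<star> aassoc X Y Z) \<bullet> aassoc W (X \<otimes> Y) Z \<bullet> (aassoc W X Y \<star> aid Z)
     = ((aid W \<star> aassoc X Y Z) \<bullet> aassoc W (X \<otimes> Y) Z) \<bullet> (aassoc W X Y \<star> aid Z)" by simp
  also have "\<dots> = aassoc W X (Y \<otimes> Z) \<bullet> aassoc (W \<otimes> X) Y Z"
    using pentagon[of W X Y Z] by (simp add: acmp_def)
  finally show ?thesis by simp
qed

lemma aassoc_unit_mid [simp]: "aassoc X \<one> Y = aid (X \<otimes> Y)"
  by (simp add: aassoc_def aid_def triangle)

lemma ainv_idem:
  assumes "ainv f g" "f \<bullet> f = f" "atgt f = asrc f"
  shows "f = aid (asrc f)"
  using ainv_move_left[OF assms(1) _ _ _ assms(2)] ainvD[OF assms(1)] assms(3) by simp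

text \<open>The triangle axiom covers only a unit in the middle. The pentagon with two leading units
  makes this associator idempotent, hence an identity; two trailing units settle the other
  side.\<close>

lemma aassoc_unit_left [simp]: "aassoc \<one> Y Z = aid (Y \<otimes> Z)"
proof -
  have "aassoc \<one> Y Z \<bullet> aassoc \<one> Y Z = aassoc \<one> Y Z"
    using apentagon[of \<one> \<one> Y Z] by simp
  from ainv_idem[OF ainv_aassoc this] show ?thesis by simp
qed

lemma aassoc_unit_right [simp]: "aassoc X Y \<one> = aid (X \<otimes> Y)"
proof -
  have "aassoc X Y \<one> \<bullet> aassoc X Y \<one> = aassoc X Y \<one>"
    using apentagon[of X Y \<one> \<one>] by simp
  from ainv_idem[OF ainv_aassoc this] show ?thesis by simp
qed

lemma aassoc_inv_eq_aid: "aassoc X Y Z = aid W \<Longrightarrow> aassoc_inv X Y Z = aid W"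
  using ainv_aassoc[of X Y Z] ainv_aid ainv_unique by metis

lemma aassoc_inv_unit [simp]:
  "aassoc_inv X \<one> Y = aid (X \<otimes> Y)" "aassoc_inv \<one> Y Z = aid (Y \<otimes> Z)" "aassoc_inv X Y \<one> = aid (X \<otimes> Y)"
  by (rule aassoc_inv_eq_aid; simp)+

section \<open>Coherence for right-bracketed tensor products\<close>

primrec tens_list :: "'o list \<Rightarrow> 'o" where
  "tens_list [] = \<one>"
| "tens_list (x # l) = x \<otimes> tens_list l"

text \<open>The canonical isomorphism
  \<open>tens_list l \<otimes> tens_list m -> tens_list (l @ m)\<close>. The strict unit makes it an
  identity when \<open>l\<close> is empty or a singleton, and when \<open>m\<close> is
  empty.\<close>

primrec phi :: "'o list \<Rightarrow> 'o list \<Rightarrow> ('o, 'm) arr" where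
  "phi [] m = aid (tens_list m)"
| "phi (x # l) m = (aid x \<star> phi l m) \<bullet> aassoc x (tens_list l) (tens_list m)"

primrec phi_inv :: "'o list \<Rightarrow> 'o list \<Rightarrow> ('o, 'm) arr" where
  "phi_inv [] m = aid (tens_list m)"
| "phi_inv (x # l) m = aassoc_inv x (tens_list l) (tens_list m) \<bullet> (aid x \<star> phi_inv l m)"

lemma phi_ends [simp]: "asrc (phi l m) = tens_list l \<otimes> tens_list m" "atgt (phi l m) = tens_list (l @ m)"
  by (induction l) simp_all

lemma ainv_phi: "ainv (phi l m) (phi_inv l m)"
proof (induction l)
  case (Cons x l)
  have "ainv (aid x \<star> phi l m) (aid x \<star> phi_inv l m)"
    by (rule ainv_atens[OF ainv_aid Cons])
  then show ?case by (simp add: ainv_acmp[OF ainv_aassoc])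
qed (simp add: ainv_aid)

lemma phi_simps [simp]:
  "aval (phi l m)" "aval (phi_inv l m)"
  "asrc (phi_inv l m) = tens_list (l @ m)" "atgt (phi_inv l m) = tens_list l \<otimes> tens_list m"
  "phi_inv l m \<bullet> phi l m = aid (tens_list l \<otimes> tens_list m)"
  "phi l m \<bullet> phi_inv l m = aid (tens_list (l @ m))"
  using ainvD[OF ainv_phi[of l m]] by simp_all

lemma phi_cancel [simp]:
  "\<lbrakk>aval z; atgt z = tens_list l \<otimes> tens_list m\<rbrakk> \<Longrightarrow> phi_inv l m \<bullet> phi l m \<bullet> z = z"
  "\<lbrakk>aval z; atgt z = tens_list (l @ m)\<rbrakk> \<Longrightarrow> phi l m \<bullet> phi_inv l m \<bullet> z = z"
  using acmp_head[OF phi_simps(5)[of l m], of z] acmp_head[OF phi_simps(6)[of l m], of z] by simp_all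

lemma phi_Nil_right [simp]: "phi l [] = aid (tens_list l)"
  by (induction l) simp_all

lemma phi_inv_Nil_right [simp]: "phi_inv l [] = aid (tens_list l)"
  by (induction l) simp_all

text \<open>The instance of coherence on which strictness of the list category rests. Each induction
  step consumes one pentagon and two naturality squares of the associator.\<close>

lemma phi_coherence:
  "phi (l @ m) k \<bullet> (phi l m \<star> aid (tens_list k))
    = phi l (m @ k) \<bullet> (aid (tens_list l) \<star> phi m k) \<bullet> aassoc (tens_list l) (tens_list m) (tens_list k)"
proof (induction l)
  case Nil
  show ?case by simp
next
  case (Cons x l)
  let ?L = "tens_list l" and ?M = "tens_list m" and ?K = "tens_list k"
  have "phi ((x # l) @ m) k \<bullet> (phi (x # l) m \<star> aid ?K)
      = (aid x \<star> phi (l @ m) k) \<bullet> (aassoc x (tens_list (l @ m)) ?K \<bullet> ((aid x \<star> phi l m) \<star> aid ?K))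
        \<bullet> (aassoc x ?L ?M \<star> aid ?K)" by simp
  also have "aassoc x (tens_list (l @ m)) ?K \<bullet> ((aid x \<star> phi l m) \<star> aid ?K)
      = (aid x \<star> phi l m \<star> aid ?K) \<bullet> aassoc x (?L \<otimes> ?M) ?K"
    using aassoc_natural[of "aid x" "phi l m" "aid ?K"] by simp
  also have "(aid x \<star> phi (l @ m) k) \<bullet> ((aid x \<star> phi l m \<star> aid ?K) \<bullet> aassoc x (?L \<otimes> ?M) ?K)
        \<bullet> (aassoc x ?L ?M \<star> aid ?K)
      = (aid x \<star> (phi (l @ m) k \<bullet> (phi l m \<star> aid ?K))) \<bullet> aassoc x (?L \<otimes> ?M) ?K \<bullet> (aassoc x ?L ?M \<star> aid ?K)"
    by simp
  also have "\<dots> = (aid x \<star> (phi l (m @ k) \<bullet> (aid ?L \<star> phi m k)))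
      \<bullet> ((aid x \<star> aassoc ?L ?M ?K) \<bullet> aassoc x (?L \<otimes> ?M) ?K \<bullet> (aassoc x ?L ?M \<star> aid ?K))"
    unfolding Cons by simp
  also have "\<dots> = (aid x \<star> phi l (m @ k)) \<bullet> ((aid x \<star> aid ?L \<star> phi m k) \<bullet> aassoc x ?L (?M \<otimes> ?K))
      \<bullet> aassoc (x \<otimes> ?L) ?M ?K"
    unfolding apentagon[symmetric] by (simp del: aid_atens)
  also have "(aid x \<star> aid ?L \<star> phi m k) \<bullet> aassoc x ?L (?M \<otimes> ?K)
      = aassoc x ?L (tens_list (m @ k)) \<bullet> (aid (x \<otimes> ?L) \<star> phi m k)"
    using aassoc_natural[of "aid x" "aid ?L" "phi m k"] by simp
  finally show ?case by simp
qed

lemma phi_inv_coherence: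
  "(phi_inv l m \<star> aid (tens_list k)) \<bullet> phi_inv (l @ m) k
    = aassoc_inv (tens_list l) (tens_list m) (tens_list k) \<bullet> (aid (tens_list l) \<star> phi_inv m k) \<bullet> phi_inv l (m @ k)"
proof (rule ainv_unique)
  show "ainv (phi (l @ m) k \<bullet> (phi l m \<star> aid (tens_list k)))
     ((phi_inv l m \<star> aid (tens_list k)) \<bullet> phi_inv (l @ m) k)"
    by (intro ainv_acmp ainv_atens ainv_phi ainv_aid) simp
  have "ainv (phi l (m @ k) \<bullet> (aid (tens_list l) \<star> phi m k) \<bullet> aassoc (tens_list l) (tens_list m) (tens_list k))
     ((aassoc_inv (tens_list l) (tens_list m) (tens_list k) \<bullet> (aid (tens_list l) \<star> phi_inv m k)) \<bullet> phi_inv l (m @ k))"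
    by (intro ainv_acmp ainv_atens ainv_phi ainv_aid ainv_aassoc) simp_all
  then show "ainv (phi (l @ m) k \<bullet> (phi l m \<star> aid (tens_list k)))
     (aassoc_inv (tens_list l) (tens_list m) (tens_list k) \<bullet> (aid (tens_list l) \<star> phi_inv m k) \<bullet> phi_inv l (m @ k))"
    unfolding phi_coherence by simp
qed

section \<open>The strict category of lists\<close>

definition low :: "('o list, 'm) arr \<Rightarrow> ('o, 'm) arr" where
  "low f = Arr (tens_list (asrc f)) (tens_list (atgt f)) (amor f)"

lemma low_sel [simp]: "asrc (low f) = tens_list (asrc f)" "atgt (low f) = tens_list (atgt f)"
    "amor (low f) = amor f"
  by (simp_all add: low_def)

lemma arr_eqI: "\<lbrakk>low f = low g; asrc f = asrc g; atgt f = atgt g\<rbrakk> \<Longrightarrow> f = g"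
  by (cases f; cases g) (simp add: low_def)

lemma low_acmp [simp]: "low (g \<bullet> f) = low g \<bullet> low f"
  by (simp add: low_def acmp_def)

definition sval :: "('o list, 'm) arr \<Rightarrow> bool" where
  "sval f \<longleftrightarrow> aval (low f)"

definition sid :: "'o list \<Rightarrow> ('o list, 'm) arr" where
  "sid l = Arr l l (ident C (tens_list l))"

lemma low_sid [simp]: "low (sid l) = aid (tens_list l)"
  by (simp add: low_def sid_def aid_def)

text \<open>The tensor product of \<open>C\<close> conjugated by \<open>phi\<close>, so that its
  ends become concatenations.\<close>

definition stens :: "('o list, 'm) arr \<Rightarrow> ('o list, 'm) arr \<Rightarrow> ('o list, 'm) arr"  (infixr "\<odot>" 70) where
  "f \<odot> g = Arr (asrc f @ asrc g) (atgt f @ atgt g)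
     (amor (phi (atgt f) (atgt g) \<bullet> (low f \<star> low g) \<bullet> phi_inv (asrc f) (asrc g)))"

lemma stens_sel [simp]: "asrc (f \<odot> g) = asrc f @ asrc g" "atgt (f \<odot> g) = atgt f @ atgt g"
  by (simp_all add: stens_def)

lemma low_stens: "low (f \<odot> g) = phi (atgt f) (atgt g) \<bullet> (low f \<star> low g) \<bullet> phi_inv (asrc f) (asrc g)"
  by (simp add: stens_def low_def acmp_def)

lemma sid_sel [simp]: "asrc (sid l) = l" "atgt (sid l) = l"
  by (simp_all add: sid_def)

sublocale S: strict_monoidal sval asrc atgt acmp stens sid
proof (unfold_locales, goal_cases)
  \<comment> \<open>Associativity: the coherence of \<open>phi\<close> leaves an associator on one
    side of the triple product and its inverse on the other, and they cancel by naturality.\<close>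
  case (13 f g h)
  note [simp] = 13[unfolded sval_def]
  let ?s = "\<lambda>f. tens_list (asrc f)"
  show ?case
  proof (rule arr_eqI)
    have "low ((f \<odot> g) \<odot> h)
      = (phi (atgt f @ atgt g) (atgt h) \<bullet> (phi (atgt f) (atgt g) \<star> aid (tens_list (atgt h))))
        \<bullet> ((low f \<star> low g) \<star> low h)
        \<bullet> ((phi_inv (asrc f) (asrc g) \<star> aid (?s h)) \<bullet> phi_inv (asrc f @ asrc g) (asrc h))"
      using ainterchange[of "(low f \<star> low g) \<bullet> phi_inv (asrc f) (asrc g)" "phi (atgt f) (atgt g)" "low h" "aid (tens_list (atgt h))"]
        ainterchange[of "phi_inv (asrc f) (asrc g)" "low f \<star> low g" "aid (?s h)" "low h"]
      by (simp add: low_stens del: awhisker)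
    also have "\<dots> = phi (atgt f) (atgt g @ atgt h) \<bullet> (aid (tens_list (atgt f)) \<star> phi (atgt g) (atgt h))
        \<bullet> ((aassoc (tens_list (atgt f)) (tens_list (atgt g)) (tens_list (atgt h)) \<bullet> ((low f \<star> low g) \<star> low h))
        \<bullet> aassoc_inv (?s f) (?s g) (?s h)) \<bullet> (aid (?s f) \<star> phi_inv (asrc g) (asrc h)) \<bullet> phi_inv (asrc f) (asrc g @ asrc h)"
      unfolding phi_coherence phi_inv_coherence by simp
    also have "(aassoc (tens_list (atgt f)) (tens_list (atgt g)) (tens_list (atgt h)) \<bullet> ((low f \<star> low g) \<star> low h))
        \<bullet> aassoc_inv (?s f) (?s g) (?s h) = low f \<star> low g \<star> low h"
      using aassoc_natural[of "low f" "low g" "low h"] ainvD(6)[OF ainv_aassoc[of "?s f" "?s g" "?s h"]] by simp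
    also have "phi (atgt f) (atgt g @ atgt h) \<bullet> (aid (tens_list (atgt f)) \<star> phi (atgt g) (atgt h))
        \<bullet> (low f \<star> low g \<star> low h) \<bullet> (aid (?s f) \<star> phi_inv (asrc g) (asrc h)) \<bullet> phi_inv (asrc f) (asrc g @ asrc h)
      = low (f \<odot> g \<odot> h)"
      using ainterchange[of "low f" "aid (tens_list (atgt f))" "(low g \<star> low h) \<bullet> phi_inv (asrc g) (asrc h)" "phi (atgt g) (atgt h)"]
        ainterchange[of "aid (?s f)" "low f" "phi_inv (asrc g) (asrc h)" "low g \<star> low h"]
      by (simp add: low_stens del: awhisker)
    finally show "low ((f \<odot> g) \<odot> h) = low (f \<odot> g \<odot> h)" .
  qed simp_all
next
  case (17 f g f' g')
  note [simp] = 17[unfolded sval_def]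
  show ?case
    by (rule arr_eqI) (simp_all add: low_stens ainterchange)
qed (auto simp: sval_def low_stens intro!: arr_eqI)

lemma aassoc_inv_natural:
  assumes "aval f" "aval g" "aval h"
  shows "aassoc_inv (atgt f) (atgt g) (atgt h) \<bullet> (f \<star> g \<star> h) = ((f \<star> g) \<star> h) \<bullet> aassoc_inv (asrc f) (asrc g) (asrc h)"
proof -
  note [simp] = assms
  have "(f \<star> g \<star> h) = (aassoc (atgt f) (atgt g) (atgt h) \<bullet> ((f \<star> g) \<star> h)) \<bullet> aassoc_inv (asrc f) (asrc g) (asrc h)"
    unfolding aassoc_natural[OF assms] using ainvD(6)[OF ainv_aassoc] by simp
  also have "\<dots> = aassoc (atgt f) (atgt g) (atgt h) \<bullet> (((f \<star> g) \<star> h) \<bullet> aassoc_inv (asrc f) (asrc g) (asrc h))"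
    by simp
  finally show ?thesis
    by (intro ainv_move_left[OF ainv_aassoc, symmetric]) simp_all
qed

lemma sval_Arr [simp]: "sval (Arr l m f) \<longleftrightarrow> f \<in> hom C (tens_list l) (tens_list m)"
  by (simp add: sval_def low_def)

lemma low_Arr: "low (Arr l m f) = Arr (tens_list l) (tens_list m) f"
  by (simp add: low_def)

lemma aval_low [simp]: "sval f \<Longrightarrow> aval (low f)"
  by (simp add: sval_def)

text \<open>For lists this short \<open>phi\<close> is an identity or a single associator, so the
  strict zigzag equations are those of \<open>C\<close>.\<close>

lemma dpair_left_dual:
  assumes "is_left_dual C X X' b d"
  shows "S.dpair [X] [X'] (Arr [] [X, X'] b) (Arr [X', X] [] d)"
proof -
  let ?b = "Arr \<one> (X \<otimes> X') b" and ?d = "Arr (X' \<otimes> X) \<one> d"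
  have h [simp]: "b \<in> hom C \<one> (X \<otimes> X')" "d \<in> hom C (X' \<otimes> X) \<one>"
    using assms by (auto simp: is_left_dual_def)
  have "((aid X \<star> ?d) \<bullet> aassoc X X' X) \<bullet> (?b \<star> aid X) = aid X"
    "((?d \<star> aid X') \<bullet> aassoc_inv X' X X') \<bullet> (aid X' \<star> ?b) = aid X'"
    using assms by (simp_all add: is_left_dual_def acmp_def aid_def atens_def)
  then have "(aid X \<star> ?d) \<bullet> aassoc X X' X \<bullet> (?b \<star> aid X) = aid X"
    "(?d \<star> aid X') \<bullet> aassoc_inv X' X X' \<bullet> (aid X' \<star> ?b) = aid X'" by simp_all
  then show ?thesis
    by (auto simp: S.dpair_def low_stens low_Arr intro!: arr_eqI)
qed

definition sbraid :: "('o \<Rightarrow> 'o \<Rightarrow> 'm) \<Rightarrow> 'o list \<Rightarrow> 'o list \<Rightarrow> ('o list, 'm) arr" where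
  "sbraid c l m = (let L = tens_list l; M = tens_list m in
     Arr (l @ m) (m @ l) (amor (phi m l \<bullet> Arr (L \<otimes> M) (M \<otimes> L) (c L M) \<bullet> phi_inv l m)))"

definition sbraid_inv :: "('o \<Rightarrow> 'o \<Rightarrow> 'm) \<Rightarrow> 'o list \<Rightarrow> 'o list \<Rightarrow> ('o list, 'm) arr" where
  "sbraid_inv c l m = (let L = tens_list l; M = tens_list m in
     Arr (m @ l) (l @ m)
       (amor (phi l m \<bullet> Arr (M \<otimes> L) (L \<otimes> M) (minv C (L \<otimes> M) (M \<otimes> L) (c L M)) \<bullet> phi_inv m l)))"

text \<open>The hexagons of \<open>C\<close> contain associators; after conjugation by
  \<open>phi\<close> these are absorbed by the coherence of \<open>phi\<close>.\<close>

lemma strict_braided: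
  assumes "braiding C c"
  shows "strict_braided sval asrc atgt acmp stens sid (sbraid c) (sbraid_inv c)"
proof -
  define B where "B X Y = Arr (X \<otimes> Y) (Y \<otimes> X) (c X Y)" for X Y
  define Bi where "Bi X Y = Arr (Y \<otimes> X) (X \<otimes> Y) (minv C (X \<otimes> Y) (Y \<otimes> X) (c X Y))" for X Y
  have inv: "ainv (B X Y) (Bi X Y)" for X Y
    using assms unfolding braiding_def B_def Bi_def ainv_iff by (intro inverse_pair_minv) blast
  have [simp]: "aval (B X Y)" "asrc (B X Y) = X \<otimes> Y" "atgt (B X Y) = Y \<otimes> X"
    "aval (Bi X Y)" "asrc (Bi X Y) = Y \<otimes> X" "atgt (Bi X Y) = X \<otimes> Y" for X Y
    using ainvD(1,2)[OF inv[of X Y]] by (simp_all add: B_def Bi_def)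
  have [simp]: "asrc (sbraid c l m) = l @ m" "atgt (sbraid c l m) = m @ l"
    "asrc (sbraid_inv c l m) = m @ l" "atgt (sbraid_inv c l m) = l @ m" for l m
    by (simp_all add: sbraid_def sbraid_inv_def Let_def)
  have low: "low (sbraid c l m) = phi m l \<bullet> B (tens_list l) (tens_list m) \<bullet> phi_inv l m"
    "low (sbraid_inv c l m) = phi l m \<bullet> Bi (tens_list l) (tens_list m) \<bullet> phi_inv m l" for l m
    by (simp_all add: sbraid_def sbraid_inv_def Let_def B_def Bi_def low_def acmp_def)
  have nat: "B (atgt f) (atgt g) \<bullet> (f \<star> g) = (g \<star> f) \<bullet> B (asrc f) (asrc g)"
    if "aval f" "aval g" for f g
    using assms that unfolding braiding_def aval_def by (auto simp: acmp_def B_def)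
  have hex1: "aassoc Y Z X \<bullet> B X (Y \<otimes> Z) \<bullet> aassoc X Y Z
      = (aid Y \<star> B X Z) \<bullet> aassoc Y X Z \<bullet> (B X Y \<star> aid Z)" for X Y Z
  proof -
    have "(aassoc Y Z X \<bullet> B X (Y \<otimes> Z)) \<bullet> aassoc X Y Z
      = ((aid Y \<star> B X Z) \<bullet> aassoc Y X Z) \<bullet> (B X Y \<star> aid Z)"
      using assms unfolding braiding_def by (simp add: acmp_def atens_def B_def)
    then show ?thesis by simp
  qed
  have hex2: "aassoc_inv Z X Y \<bullet> B (X \<otimes> Y) Z \<bullet> aassoc_inv X Y Z
      = (B X Z \<star> aid Y) \<bullet> aassoc_inv X Z Y \<bullet> (aid X \<star> B Y Z)" for X Y Z
  proof -
    have "(aassoc_inv Z X Y \<bullet> B (X \<otimes> Y) Z) \<bullet> aassoc_inv X Y Z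
      = ((B X Z \<star> aid Y) \<bullet> aassoc_inv X Z Y) \<bullet> (aid X \<star> B Y Z)"
      using assms unfolding braiding_def by (simp add: acmp_def atens_def B_def)
    then show ?thesis by simp
  qed
  show ?thesis
  proof (unfold_locales, goal_cases)
    case (1 l m)
    have "ainv (low (sbraid c l m)) (low (sbraid_inv c l m))"
      using ainv_acmp[OF ainv_acmp[OF ainv_sym[OF ainv_phi[of l m]] inv] ainv_phi[of m l]]
      by (simp add: low)
    then show ?case
      by (auto simp: S.inverses_def sval_def intro!: arr_eqI dest: ainvD)
  next
    case (2 f g)
    note [simp] = 2
    have "low (sbraid c (atgt f) (atgt g) \<bullet> (f \<odot> g))
       = phi (atgt g) (atgt f) \<bullet> (B (atgt (low f)) (atgt (low g)) \<bullet> (low f \<star> low g)) \<bullet> phi_inv (asrc f) (asrc g)"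
      by (simp add: low low_stens)
    also have "\<dots> = low ((g \<odot> f) \<bullet> sbraid c (asrc f) (asrc g))"
      unfolding nat[OF aval_low aval_low, OF 2] by (simp add: low low_stens)
    finally show ?case by (intro arr_eqI) simp_all
  next
    case (3 l m k)
    let ?L = "tens_list l" and ?M = "tens_list m" and ?K = "tens_list k"
    \<comment> \<open>The hexagon speaks of the crossing with \<open>?M \<otimes> ?K\<close>;
      naturality relates it to the crossing with the bracketed product of
      \<open>m @ k\<close>.\<close>
    have b: "B ?L (tens_list (m @ k)) = (phi m k \<star> aid ?L) \<bullet> B ?L (?M \<otimes> ?K) \<bullet> (aid ?L \<star> phi_inv m k)"
    proof -
      have w: "(aid ?L \<star> phi m k) \<bullet> (aid ?L \<star> phi_inv m k) = aid (?L \<otimes> tens_list (m @ k))"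
        using awhisker(1)[of "phi_inv m k" "phi m k" ?L] by (simp del: awhisker)
      have "B ?L (tens_list (m @ k)) = B ?L (tens_list (m @ k)) \<bullet> ((aid ?L \<star> phi m k) \<bullet> (aid ?L \<star> phi_inv m k))"
        unfolding w by simp
      also have "\<dots> = (B ?L (tens_list (m @ k)) \<bullet> (aid ?L \<star> phi m k)) \<bullet> (aid ?L \<star> phi_inv m k)"
        by simp
      also have "B ?L (tens_list (m @ k)) \<bullet> (aid ?L \<star> phi m k) = (phi m k \<star> aid ?L) \<bullet> B ?L (?M \<otimes> ?K)"
        using nat[of "aid ?L" "phi m k"] by simp
      finally show ?thesis by simp
    qed
    have i: "(aid ?L \<star> phi_inv m k) \<bullet> phi_inv l (m @ k)
        = aassoc ?L ?M ?K \<bullet> (phi_inv l m \<star> aid ?K) \<bullet> phi_inv (l @ m) k"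
      unfolding phi_inv_coherence using acmp_head[OF ainvD(6)[OF ainv_aassoc]] by simp
    \<comment> \<open>Between the two crossings \<open>phi\<close> and its inverse meet and leave
      exactly the associator that stands there in the hexagon.\<close>
    have ii: "(aid ?M \<star> phi_inv l k) \<bullet> phi_inv m (l @ k) \<bullet> phi (m @ l) k \<bullet> (phi m l \<star> aid ?K) = aassoc ?M ?L ?K"
      unfolding phi_coherence
      by (simp del: awhisker add: acmp_head[OF awhisker(1)[symmetric]])
    have "low (sbraid c l (m @ k)) = (phi (m @ k) l \<bullet> (phi m k \<star> aid ?L)) \<bullet> B ?L (?M \<otimes> ?K)
        \<bullet> (aid ?L \<star> phi_inv m k) \<bullet> phi_inv l (m @ k)"
      unfolding low b by simp
    also have "\<dots> = phi m (k @ l) \<bullet> (aid ?M \<star> phi k l) \<bullet> (aassoc ?M ?K ?L \<bullet> B ?L (?M \<otimes> ?K) \<bullet> aassoc ?L ?M ?K)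
        \<bullet> (phi_inv l m \<star> aid ?K) \<bullet> phi_inv (l @ m) k"
      unfolding i phi_coherence by simp
    also have "\<dots> = phi m (k @ l) \<bullet> (aid ?M \<star> phi k l) \<bullet> (aid ?M \<star> B ?L ?K)
        \<bullet> ((aid ?M \<star> phi_inv l k) \<bullet> phi_inv m (l @ k) \<bullet> phi (m @ l) k \<bullet> (phi m l \<star> aid ?K))
        \<bullet> (B ?L ?M \<star> aid ?K) \<bullet> (phi_inv l m \<star> aid ?K) \<bullet> phi_inv (l @ m) k"
      unfolding hex1 ii by simp
    also have "\<dots> = low ((sid m \<odot> sbraid c l k) \<bullet> (sbraid c l m \<odot> sid k))"
      by (simp add: low low_stens)
    finally show ?case by (intro arr_eqI) simp_all
  next
    case (4 l m k)
    let ?L = "tens_list l" and ?M = "tens_list m" and ?K = "tens_list k"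
    have b: "B (tens_list (l @ m)) ?K = (aid ?K \<star> phi l m) \<bullet> B (?L \<otimes> ?M) ?K \<bullet> (phi_inv l m \<star> aid ?K)"
    proof -
      have w: "(phi l m \<star> aid ?K) \<bullet> (phi_inv l m \<star> aid ?K) = aid (tens_list (l @ m) \<otimes> ?K)"
        using awhisker(2)[of "phi_inv l m" "phi l m" ?K] by (simp del: awhisker)
      have "B (tens_list (l @ m)) ?K = B (tens_list (l @ m)) ?K \<bullet> ((phi l m \<star> aid ?K) \<bullet> (phi_inv l m \<star> aid ?K))"
        unfolding w by simp
      also have "\<dots> = (B (tens_list (l @ m)) ?K \<bullet> (phi l m \<star> aid ?K)) \<bullet> (phi_inv l m \<star> aid ?K)"
        by simp
      also have "B (tens_list (l @ m)) ?K \<bullet> (phi l m \<star> aid ?K) = (aid ?K \<star> phi l m) \<bullet> B (?L \<otimes> ?M) ?K"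
        using nat[of "phi l m" "aid ?K"] by simp
      finally show ?thesis by simp
    qed
    have i: "phi k (l @ m) \<bullet> (aid ?K \<star> phi l m) = phi (k @ l) m \<bullet> (phi k l \<star> aid ?M) \<bullet> aassoc_inv ?K ?L ?M"
    proof -
      have "phi (k @ l) m \<bullet> (phi k l \<star> aid ?M) \<bullet> aassoc_inv ?K ?L ?M
        = (phi (k @ l) m \<bullet> (phi k l \<star> aid ?M)) \<bullet> aassoc_inv ?K ?L ?M" by simp
      also have "\<dots> = phi k (l @ m) \<bullet> (aid ?K \<star> phi l m)"
        unfolding phi_coherence using ainvD(6)[OF ainv_aassoc] by simp
      finally show ?thesis by simp
    qed
    have ii: "(phi_inv l k \<star> aid ?M) \<bullet> phi_inv (l @ k) m \<bullet> phi l (k @ m) \<bullet> (aid ?L \<star> phi k m) = aassoc_inv ?L ?K ?M"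
    proof -
      have "(phi_inv l k \<star> aid ?M) \<bullet> phi_inv (l @ k) m \<bullet> phi l (k @ m) \<bullet> (aid ?L \<star> phi k m)
        = ((phi_inv l k \<star> aid ?M) \<bullet> phi_inv (l @ k) m) \<bullet> phi l (k @ m) \<bullet> (aid ?L \<star> phi k m)" by simp
      also have "\<dots> = aassoc_inv ?L ?K ?M"
        unfolding phi_inv_coherence
        by (simp del: awhisker add: awhisker(1)[symmetric])
      finally show ?thesis .
    qed
    have "low (sbraid c (l @ m) k) = (phi k (l @ m) \<bullet> (aid ?K \<star> phi l m)) \<bullet> B (?L \<otimes> ?M) ?K
        \<bullet> (phi_inv l m \<star> aid ?K) \<bullet> phi_inv (l @ m) k"
      unfolding low b by simp
    also have "\<dots> = phi (k @ l) m \<bullet> (phi k l \<star> aid ?M) \<bullet> (aassoc_inv ?K ?L ?M \<bullet> B (?L \<otimes> ?M) ?K \<bullet> aassoc_inv ?L ?M ?K)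
        \<bullet> (aid ?L \<star> phi_inv m k) \<bullet> phi_inv l (m @ k)"
      unfolding i phi_inv_coherence by simp
    also have "\<dots> = phi (k @ l) m \<bullet> (phi k l \<star> aid ?M) \<bullet> (B ?L ?K \<star> aid ?M)
        \<bullet> ((phi_inv l k \<star> aid ?M) \<bullet> phi_inv (l @ k) m \<bullet> phi l (k @ m) \<bullet> (aid ?L \<star> phi k m))
        \<bullet> (aid ?L \<star> B ?M ?K) \<bullet> (aid ?L \<star> phi_inv m k) \<bullet> phi_inv l (m @ k)"
      unfolding hex2 ii by simp
    also have "\<dots> = low ((sbraid c l k \<odot> sid m) \<bullet> (sid l \<odot> sbraid c m k))"
      by (simp add: low low_stens)
    finally show ?case by (intro arr_eqI) simp_all
  qed
qed

end

section \<open>Duals and pivotal structures\<close>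

context linear_category
begin

definition smul :: "complex \<Rightarrow> ('x, 'm) arr \<Rightarrow> ('x, 'm) arr" where
  "smul k f = Arr (asrc f) (atgt f) (scl C k (amor f))"

lemma smul_sel [simp]: "asrc (smul k f) = asrc f" "atgt (smul k f) = atgt f" "amor (smul k f) = scl C k (amor f)"
  by (simp_all add: smul_def)

lemma hom_scale: "f \<in> hom C X Y \<Longrightarrow> scl C k f \<in> hom C X Y"
  using hom_subspace vector_space unfolding module_iff_vector_space
  by (metis module.subspace_scale module_iff_vector_space)

lemma aval_smul [simp]: "aval f \<Longrightarrow> aval (smul k f)"
  by (simp add: aval_def hom_scale)

lemma asmul_acmp:
  assumes "aval f" "aval g" "asrc g = atgt f"
  shows "smul k g \<bullet> f = smul k (g \<bullet> f)" "g \<bullet> smul k f = smul k (g \<bullet> f)"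
  using assms comp_bilinear[of "asrc g" "atgt g" "asrc f"]
  by (auto simp: aval_def smul_def acmp_def bilinear_on_def)

end

context linear_monoidal_category
begin

lemma asmul_atens:
  assumes "aval f" "aval g"
  shows "smul k f \<star> g = smul k (f \<star> g)" "f \<star> smul k g = smul k (f \<star> g)"
  using assms tens_bilinear[of "asrc f" "atgt f" "asrc g" "atgt g"]
  by (auto simp: aval_def smul_def atens_def bilinear_on_def)

lemma low_smul [simp]: "low (smul k f) = smul k (low f)"
  by (simp add: low_def smul_def)

lemma sval_smul [simp]: "sval f \<Longrightarrow> sval (smul k f)"
  by (simp add: sval_def)

lemma smul_acmp [simp]:
  assumes "sval f" "sval g" "asrc g = atgt f"
  shows "smul k g \<bullet> f = smul k (g \<bullet> f)" "g \<bullet> smul k f = smul k (g \<bullet> f)"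
  using assms by (auto intro!: arr_eqI simp: asmul_acmp sval_def)

lemma smul_stens [simp]:
  assumes "sval f" "sval g"
  shows "smul k f \<odot> g = smul k (f \<odot> g)" "f \<odot> smul k g = smul k (f \<odot> g)"
  using assms by (auto intro!: arr_eqI simp: asmul_acmp asmul_atens sval_def low_stens)

lemma smul_smul [simp]: "smul k (smul k' f) = smul (k * k') f"
  using vector_space.vector_space_assms(3)[OF vector_space] by (simp add: smul_def)

end

context fusion_category
begin

lemma scl_ident_inj: "simple C V \<Longrightarrow> scl C k (ident C V) = scl C k' (ident C V) \<longleftrightarrow> k = k'"
  using simple_End[of V] by (auto simp: bij_betw_def inj_on_def)

lemma End_simple:
  assumes "simple C V" "sval f" "asrc f = [V]" "atgt f = [V]"
  obtains k where "f = smul k (sid [V])"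
proof -
  have "amor f \<in> hom C V V" using assms by (simp add: sval_def aval_def)
  then obtain k where "amor f = scl C k (ident C V)"
    using simple_End[OF assms(1)] by (auto simp: bij_betw_def)
  then have "f = smul k (sid [V])" using assms by (cases f) (simp add: smul_def sid_def)
  then show ?thesis using that by blast
qed

definition scal :: "('o list, 'm) arr \<Rightarrow> complex" where
  "scal f = (THE k. scl C k (ident C \<one>) = amor f)"

lemma scal_smul [simp]: "scal (smul k (sid [])) = k"
  by (simp add: scal_def sid_def scl_ident_inj[OF simple_unit])

lemma scal_eq:
  assumes "sval f" "asrc f = []" "atgt f = []"
  shows "f = smul (scal f) (sid [])"
proof -
  have "amor f \<in> hom C \<one> \<one>" using assms by (simp add: sval_def aval_def)
  then obtain k where "amor f = scl C k (ident C \<one>)"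
    using simple_End[OF simple_unit] by (auto simp: bij_betw_def)
  then have "f = smul k (sid [])" using assms by (cases f) (simp add: smul_def sid_def)
  then show ?thesis by simp
qed

definition bl where "bl X = Arr [] [X, dual C X] (coev C X)"
definition dl where "dl X = Arr [dual C X, X] [] (ev C X)"

lemma dpair_l: "S.dpair [X] [dual C X] (bl X) (dl X)"
  unfolding bl_def dl_def by (rule dpair_left_dual[OF left_dual])

lemma bl_dl_simps [simp]:
  "sval (bl X)" "asrc (bl X) = []" "atgt (bl X) = [X, dual C X]"
  "sval (dl X)" "asrc (dl X) = [dual C X, X]" "atgt (dl X) = []"
  using S.dpairD(1-6)[OF dpair_l] by simp_all

text \<open>\<open>dual_map\<close> applies the associator before \<open>f\<close>; naturality moves
  it behind \<open>f\<close>, where the strict tensor product has it.\<close>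

lemma dual_map_mate:
  assumes f: "f \<in> hom C X Y"
  shows "Arr [dual C Y] [dual C X] (dual_map C X Y f)
    = S.mate [dual C X] [dual C Y] (dl Y) (Arr [X] [Y] f) (bl X)"
proof (rule arr_eqI)
  let ?d = "low (dl Y)" and ?b = "low (bl X)" and ?f = "Arr X Y f"
  let ?X = "dual C X" and ?Y = "dual C Y"
  have s [simp]: "aval ?d" "aval ?b" by simp_all
  have "low (Arr [?Y] [?X] (dual_map C X Y f))
     = (((?d \<star> aid ?X) \<bullet> ((aid ?Y \<star> ?f) \<star> aid ?X)) \<bullet> aassoc_inv ?Y X ?X) \<bullet> (aid ?Y \<star> ?b)"
    by (simp add: dual_map_def low_def acmp_def atens_def aid_def bl_def dl_def)
  also have "\<dots> = (?d \<star> aid ?X) \<bullet> (((aid ?Y \<star> ?f) \<star> aid ?X) \<bullet> aassoc_inv ?Y X ?X) \<bullet> (aid ?Y \<star> ?b)"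
    using f by simp
  also have "((aid ?Y \<star> ?f) \<star> aid ?X) \<bullet> aassoc_inv ?Y X ?X = aassoc_inv ?Y Y ?X \<bullet> (aid ?Y \<star> ?f \<star> aid ?X)"
    using aassoc_inv_natural[of "aid ?Y" ?f "aid ?X"] f by simp
  also have "(?d \<star> aid ?X) \<bullet> (aassoc_inv ?Y Y ?X \<bullet> (aid ?Y \<star> ?f \<star> aid ?X)) \<bullet> (aid ?Y \<star> ?b)
     = low (S.mate [?X] [?Y] (dl Y) (Arr [X] [Y] f) (bl X))"
    using f by (simp add: S.mate_def low_stens low_Arr)
  finally show "low (Arr [?Y] [?X] (dual_map C X Y f)) = low (S.mate [?X] [?Y] (dl Y) (Arr [X] [Y] f) (bl X))" .
qed (simp_all add: S.mate_def)

end

context pivotal_fusion_category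
begin

section \<open>Pivotal cups, caps and traces\<close>

definition pv where "pv X = Arr [X] [dual C (dual C X)] (piv C X)"
definition pv_inv where "pv_inv X = Arr [dual C (dual C X)] [X] (minv C X (dual C (dual C X)) (piv C X))"

lemma inverses_Arr:
  assumes "inverse_pair C (tens_list l) (tens_list m) f g"
  shows "S.inverses l m (Arr l m f) (Arr m l g)"
  using assms by (auto simp: S.inverses_def inverse_pair_def sid_def acmp_def)

lemma inverses_pv: "S.inverses [X] [dual C (dual C X)] (pv X) (pv_inv X)"
  unfolding pv_def pv_inv_def using inverse_pair_minv[OF piv_iso] by (intro inverses_Arr) simp

lemmas pv_simps [simp] = S.inversesD[OF inverses_pv]

text \<open>Cup and cap on the opposite side, obtained from those of the dual object through the
  pivotal isomorphism. Together with \<open>bl\<close> and \<open>dl\<close> they make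
  \<open>dual C X\<close> a left and a right dual of \<open>X\<close>.\<close>

definition br where "br X = (sid [dual C X] \<odot> pv_inv X) \<bullet> bl (dual C X)"
definition dr where "dr X = dl (dual C X) \<bullet> (pv X \<odot> sid [dual C X])"

lemma dpair_r: "S.dpair [dual C X] [X] (br X) (dr X)"
  unfolding br_def dr_def
  using S.dpair_transport[OF dpair_l S.inverses_I S.inverses_sym[OF inverses_pv]] by simp

lemma br_dr_simps [simp]:
  "sval (br X)" "asrc (br X) = []" "atgt (br X) = [dual C X, X]"
  "sval (dr X)" "asrc (dr X) = [X, dual C X]" "atgt (dr X) = []"
  using S.dpairD(1-6)[OF dpair_r] by simp_all

abbreviation smate where "smate X Y f \<equiv> S.mate [dual C X] [dual C Y] (dl Y) f (bl X)"

lemma smate_simps [simp]: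
  assumes "sval f" "asrc f = [X]" "atgt f = [Y]"
  shows "sval (smate X Y f)" "asrc (smate X Y f) = [dual C Y]" "atgt (smate X Y f) = [dual C X]"
  using assms S.mate_valid[OF dpair_l dpair_l] S.src_mate[OF dpair_l dpair_l] S.tgt_mate[OF dpair_l dpair_l]
  by simp_all

lemma pv_natural:
  assumes f: "sval f" "asrc f = [X]" "atgt f = [Y]"
  shows "pv Y \<bullet> f = smate (dual C Y) (dual C X) (smate X Y f) \<bullet> pv X"
proof -
  obtain g where g: "f = Arr [X] [Y] g" "g \<in> hom C X Y" using f by (cases f) auto
  let ?h = "Arr [dual C Y] [dual C X] (dual_map C X Y g)"
  have h: "?h = smate X Y f" unfolding g(1) by (rule dual_map_mate[OF g(2)])
  then have "dual_map C X Y g \<in> hom C (dual C Y) (dual C X)"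
    using smate_simps(1)[OF f] unfolding h[symmetric] by simp
  note dual_map_mate[OF this]
  then have "smate (dual C Y) (dual C X) (smate X Y f)
      = Arr [dual C (dual C X)] [dual C (dual C Y)] (ddual_map C X Y g)"
    by (simp add: ddual_map_def h)
  then show ?thesis using piv_natural[OF g(2)] by (simp add: pv_def g(1) acmp_def)
qed

text \<open>Naturality of \<open>piv\<close> in diagrams: the mate formed with the left cups and
  caps also serves for the cap on the other side, so left and right dual morphisms agree.\<close>

lemma dr_natural:
  assumes [simp]: "sval f" "asrc f = [X]" "atgt f = [Y]"
  shows "dr Y \<bullet> (f \<odot> sid [dual C Y]) = dr X \<bullet> (sid [X] \<odot> smate X Y f)"
proof -
  let ?m = "smate X Y f"
  have "dr Y \<bullet> (f \<odot> sid [dual C Y]) = dl (dual C Y) \<bullet> ((pv Y \<bullet> f) \<odot> sid [dual C Y])"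
    by (simp add: dr_def)
  also have "\<dots> = (dl (dual C Y) \<bullet> (smate (dual C Y) (dual C X) ?m \<odot> sid [dual C Y])) \<bullet> (pv X \<odot> sid [dual C Y])"
    unfolding pv_natural[OF assms] by simp
  also have "dl (dual C Y) \<bullet> (smate (dual C Y) (dual C X) ?m \<odot> sid [dual C Y])
      = dl (dual C X) \<bullet> (sid [dual C (dual C X)] \<odot> ?m)"
    using S.mate_ev[OF dpair_l dpair_l, of ?m "dual C Y" "dual C X"] by simp
  also have "(dl (dual C X) \<bullet> (sid [dual C (dual C X)] \<odot> ?m)) \<bullet> (pv X \<odot> sid [dual C Y])
      = dl (dual C X) \<bullet> ((sid [dual C (dual C X)] \<odot> ?m) \<bullet> (pv X \<odot> sid [dual C Y]))" by simp
  also have "(sid [dual C (dual C X)] \<odot> ?m) \<bullet> (pv X \<odot> sid [dual C Y])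
      = (pv X \<odot> sid [dual C X]) \<bullet> (sid [X] \<odot> ?m)"
    using S.exchange[of "pv X" ?m "[]"] by simp
  finally show ?thesis by (simp add: dr_def)
qed

lemma pdim_eq: "pdim C X = scal (dr X \<bullet> bl X)"
proof -
  have "amor (dr X \<bullet> bl X) = amor (low (dr X \<bullet> bl X))" by simp
  also have "low (dr X \<bullet> bl X) = (low (dl (dual C X)) \<bullet> (low (pv X) \<star> aid (dual C X))) \<bullet> low (bl X)"
    by (simp add: dr_def low_stens)
  finally show ?thesis
    by (simp add: pdim_def scal_def pv_def dl_def bl_def)
qed

lemma dr_bl: "dr X \<bullet> bl X = smul (pdim C X) (sid [])"
  unfolding pdim_eq by (rule scal_eq) simp_all

text \<open>\<open>f\<close> travels once round the loop: across the cap by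
  \<open>dr_natural\<close>, past \<open>g\<close> as its mate, and back through the cup by
  \<open>mate_coev\<close>.\<close>

lemma trace_cyclic:
  assumes [simp]: "sval f" "asrc f = [X]" "atgt f = [Y]" "sval g" "asrc g = [Y]" "atgt g = [X]"
  shows "dr Y \<bullet> ((f \<bullet> g) \<odot> sid [dual C Y]) \<bullet> bl Y = dr X \<bullet> ((g \<bullet> f) \<odot> sid [dual C X]) \<bullet> bl X"
proof -
  let ?m = "smate X Y f"
  have "dr Y \<bullet> ((f \<bullet> g) \<odot> sid [dual C Y]) \<bullet> bl Y
      = (dr Y \<bullet> (f \<odot> sid [dual C Y])) \<bullet> (g \<odot> sid [dual C Y]) \<bullet> bl Y" by simp
  also have "\<dots> = dr X \<bullet> ((sid [X] \<odot> ?m) \<bullet> (g \<odot> sid [dual C Y])) \<bullet> bl Y"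
    unfolding dr_natural[OF assms(1-3)] by simp
  also have "(sid [X] \<odot> ?m) \<bullet> (g \<odot> sid [dual C Y]) = (g \<odot> sid [dual C X]) \<bullet> (sid [Y] \<odot> ?m)"
    using S.exchange[of g ?m "[]"] by simp
  also have "dr X \<bullet> ((g \<odot> sid [dual C X]) \<bullet> (sid [Y] \<odot> ?m)) \<bullet> bl Y
      = dr X \<bullet> (g \<odot> sid [dual C X]) \<bullet> ((sid [Y] \<odot> ?m) \<bullet> bl Y)" by simp
  also have "(sid [Y] \<odot> ?m) \<bullet> bl Y = (f \<odot> sid [dual C X]) \<bullet> bl X"
    using S.mate_coev[OF dpair_l dpair_l, of f X Y] by simp
  finally show ?thesis by simp
qed

text \<open>The value of \<open>piv\<close> at the unit trivialises this loop. The unit object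
  occurs both as the list \<open>[\<one>]\<close> and as the empty list; \<open>u\<close> and
  \<open>v\<close> translate between the two.\<close>

lemma dr_unit: "dr \<one> \<bullet> bl \<one> = sid []"
proof -
  let ?U = "dual C \<one>"
  define \<beta> where "\<beta> = Arr [] [?U] (coev C \<one>)"
  define \<kappa> where "\<kappa> = Arr [?U] [] (ev C \<one>)"
  define u where "u = Arr [] [\<one>] (ident C \<one>)"
  define v where "v = Arr [\<one>] [] (ident C \<one>)"
  have hb: "coev C \<one> \<in> hom C \<one> ?U" "ev C \<one> \<in> hom C ?U \<one>"
    using left_dual[of \<one>] by (simp_all add: is_left_dual_def)
  have [simp]: "asrc \<beta> = []" "atgt \<beta> = [?U]" "asrc \<kappa> = [?U]" "atgt \<kappa> = []" "asrc u = []" "atgt u = [\<one>]"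
    "asrc v = [\<one>]" "atgt v = []" "sval \<beta>" "sval \<kappa>" "sval u" "sval v"
    using hb ident_in_hom[of \<one>] by (simp_all add: \<beta>_def \<kappa>_def u_def v_def)
  have uv: "u \<bullet> v = sid [\<one>]" "v \<bullet> u = sid []"
    using comp_ident[OF ident_in_hom] by (simp_all add: u_def v_def sid_def acmp_def)
  have low_uv [simp]: "low u = aid \<one>" "low v = aid \<one>"
    by (simp_all add: u_def v_def low_def aid_def)
  have bl: "bl \<one> = u \<odot> \<beta>" by (rule arr_eqI) (simp_all add: low_stens, simp add: bl_def \<beta>_def low_def)
  have dl: "dl \<one> = \<kappa> \<odot> v" by (rule arr_eqI) (simp_all add: low_stens, simp add: dl_def \<kappa>_def low_def)
  \<comment> \<open>Transported to the empty list, the duality of the unit says that \<beta> and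
    \<kappa> are mutually inverse; this evaluates the \<open>minv\<close> in
    \<open>ddual_unit\<close>.\<close>
  have "S.inverses [\<one>] [] v u" by (simp add: S.inverses_def uv)
  from S.dpair_transport[OF dpair_l[of \<one>] this S.inverses_I]
  have "S.dpair [] [?U] ((v \<odot> sid [?U]) \<bullet> bl \<one>) (dl \<one> \<bullet> (sid [?U] \<odot> u))" by simp
  moreover have "(v \<odot> sid [?U]) \<bullet> bl \<one> = \<beta>" "dl \<one> \<bullet> (sid [?U] \<odot> u) = \<kappa>"
    unfolding bl dl by (simp_all add: S.interchange[symmetric] uv del: S.whisker_left S.whisker_right)
  ultimately have p: "S.dpair [] [?U] \<beta> \<kappa>" by simp
  have kb: "\<kappa> \<bullet> \<beta> = sid []" using S.dpairD(7)[OF p] by simp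
  have bk: "\<beta> \<bullet> \<kappa> = sid [?U]"
    using S.dpairD(8)[OF p] S.tns_eq1[of \<kappa> \<beta>] S.tns_eq2[of \<kappa> \<beta>] by simp
  have "inverse_pair C \<one> ?U (coev C \<one>) (ev C \<one>)"
    using kb bk hb by (simp add: inverse_pair_def \<beta>_def \<kappa>_def acmp_def sid_def)
  then have m: "minv C \<one> ?U (coev C \<one>) = ev C \<one>" by (rule minv_eq)
  let ?k = "u \<bullet> \<kappa>"
  have k: "?k = Arr [?U] [\<one>] (ev C \<one>)"
    using hb by (simp add: u_def \<kappa>_def acmp_def ident_comp)
  have "pv \<one> = smate ?U \<one> ?k \<bullet> \<beta> \<bullet> v"
  proof -
    have e: "smate ?U \<one> ?k = Arr [?U] [dual C ?U] (dual_map C ?U \<one> (ev C \<one>))"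
      unfolding k by (rule dual_map_mate[OF hb(2), symmetric])
    have "Arr [\<one>] [?U] (coev C \<one>) = \<beta> \<bullet> v"
      using hb by (simp add: v_def \<beta>_def acmp_def comp_ident)
    then show ?thesis
      unfolding pv_def piv_unit ddual_unit_def m e by (simp add: acmp_def \<beta>_def v_def)
  qed
  then have "dr \<one> \<bullet> bl \<one> = (dl ?U \<bullet> (smate ?U \<one> ?k \<odot> sid [?U])) \<bullet> ((\<beta> \<bullet> v) \<odot> sid [?U]) \<bullet> bl \<one>"
    by (simp add: dr_def)
  also have "dl ?U \<bullet> (smate ?U \<one> ?k \<odot> sid [?U]) = dl \<one> \<bullet> (sid [?U] \<odot> ?k)"
    using S.mate_ev[OF dpair_l dpair_l, of ?k ?U \<one>] by simp
  also have "(dl \<one> \<bullet> (sid [?U] \<odot> ?k)) \<bullet> ((\<beta> \<bullet> v) \<odot> sid [?U]) \<bullet> bl \<one> = (\<kappa> \<bullet> \<beta> \<bullet> v \<bullet> u) \<odot> (v \<bullet> u \<bullet> \<kappa> \<bullet> \<beta>)"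
    unfolding dl bl by (simp add: S.interchange[symmetric] del: S.whisker_left S.whisker_right)
  also have "\<dots> = sid []"
    by (simp add: uv kb S.rewrite_head[OF uv(2)])
  finally show ?thesis .
qed

end

section \<open>Rotation of invariants\<close>

context pivotal_fusion_category
begin

text \<open>An identity of \<open>C\<close> read as an isomorphism from a list to the single strand
  labelled by its tensor product.\<close>

definition iota where "iota l = Arr l [tens_list l] (ident C (tens_list l))"
definition iota_inv where "iota_inv l = Arr [tens_list l] l (ident C (tens_list l))"

lemma inverses_iota: "S.inverses l [tens_list l] (iota l) (iota_inv l)"
  unfolding iota_def iota_inv_def
  by (rule inverses_Arr) (simp add: inverse_pair_def ident_in_hom comp_ident[OF ident_in_hom])

lemmas iota_simps [simp] = S.inversesD[OF inverses_iota]

lemma low_iota [simp]: "low (iota l) = aid (tens_list l)" "low (iota_inv l) = aid (tens_list l)"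
  by (simp_all add: iota_def iota_inv_def low_def aid_def)

section \<open>Duals of tensor products\<close>

definition dl2 where "dl2 X Y = dl Y \<bullet> (sid [dual C Y] \<odot> dl X \<odot> sid [Y])"
definition bl2 where "bl2 X Y = (sid [X] \<odot> bl Y \<odot> sid [dual C X]) \<bullet> bl X"
definition dr2 where "dr2 X Y = dr X \<bullet> (sid [X] \<odot> dr Y \<odot> sid [dual C X])"
definition br2 where "br2 X Y = (sid [dual C Y] \<odot> br X \<odot> sid [Y]) \<bullet> br Y"

lemma dpair_l2: "S.dpair [X, Y] [dual C Y, dual C X] (bl2 X Y) (dl2 X Y)"
  using S.dpair_tns[OF dpair_l[of X] dpair_l[of Y]] by (simp add: bl2_def dl2_def)

lemma dpair_r2: "S.dpair [dual C Y, dual C X] [X, Y] (br2 X Y) (dr2 X Y)"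
  using S.dpair_tns[OF dpair_r[of Y] dpair_r[of X]] by (simp add: br2_def dr2_def)

lemmas pair2_simps [simp] = S.dpairD(1-6)[OF dpair_l2] S.dpairD(1-6)[OF dpair_r2]

lemma ev_tens_eq:
  "Arr [dual C Y \<otimes> dual C X, X \<otimes> Y] [] (ev_tens C X Y)
    = dl2 X Y \<bullet> (iota_inv [dual C Y, dual C X] \<odot> iota_inv [X, Y])"
proof (rule arr_eqI)
  have "low (Arr [dual C Y \<otimes> dual C X, X \<otimes> Y] [] (ev_tens C X Y))
     = (low (dl Y) \<bullet> (aid (dual C Y) \<star> ((low (dl X) \<star> aid Y) \<bullet> aassoc_inv (dual C X) X Y)))
        \<bullet> aassoc (dual C Y) (dual C X) (X \<otimes> Y)"
    by (simp add: ev_tens_def low_def acmp_def atens_def aid_def aassoc_def aassoc_inv_def dl_def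
        del: awhisker)
  also have "\<dots> = low (dl2 X Y \<bullet> (iota_inv [dual C Y, dual C X] \<odot> iota_inv [X, Y]))"
    by (simp add: dl2_def low_stens)
  finally show "low (Arr [dual C Y \<otimes> dual C X, X \<otimes> Y] [] (ev_tens C X Y))
     = low (dl2 X Y \<bullet> (iota_inv [dual C Y, dual C X] \<odot> iota_inv [X, Y]))" .
qed simp_all

lemma dpair_tens:
  "S.dpair [X \<otimes> Y] [dual C Y \<otimes> dual C X]
     ((iota [X, Y] \<odot> iota [dual C Y, dual C X]) \<bullet> bl2 X Y)
     (dl2 X Y \<bullet> (iota_inv [dual C Y, dual C X] \<odot> iota_inv [X, Y]))"
  using S.dpair_transport[OF dpair_l2 inverses_iota inverses_iota, of X Y] by simp

text \<open>The canonical isomorphism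
  \<open>dual C Y \<otimes> dual C X -> dual C (X \<otimes> Y)\<close> as the mate of an identity
  for two dual pairs of \<open>X \<otimes> Y\<close>; exchanging the pairs gives its
  inverse.\<close>

definition dten where
  "dten X Y = S.mate [dual C (X \<otimes> Y)] [dual C Y \<otimes> dual C X]
     (dl2 X Y \<bullet> (iota_inv [dual C Y, dual C X] \<odot> iota_inv [X, Y])) (sid [X \<otimes> Y]) (bl (X \<otimes> Y))"

definition dten_inv where
  "dten_inv X Y = S.mate [dual C Y \<otimes> dual C X] [dual C (X \<otimes> Y)] (dl (X \<otimes> Y)) (sid [X \<otimes> Y])
     ((iota [X, Y] \<odot> iota [dual C Y, dual C X]) \<bullet> bl2 X Y)"

lemma inverses_dten: "S.inverses [dual C Y \<otimes> dual C X] [dual C (X \<otimes> Y)] (dten X Y) (dten_inv X Y)"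
  unfolding dten_def dten_inv_def by (rule S.inverses_mate[OF dpair_l dpair_tens])

lemmas dten_simps [simp] = S.inversesD[OF inverses_dten]

lemma dten_ev: "dl (X \<otimes> Y) \<bullet> (dten X Y \<odot> sid [X \<otimes> Y])
    = dl2 X Y \<bullet> (iota_inv [dual C Y, dual C X] \<odot> iota_inv [X, Y])"
  unfolding dten_def using S.mate_ev[OF dpair_l dpair_tens[of X Y], of "sid [X \<otimes> Y]"] by simp

lemma dual_tens_eq: "Arr [dual C Y \<otimes> dual C X] [dual C (X \<otimes> Y)] (dual_tens C X Y) = dten X Y"
proof (rule arr_eqI)
  let ?T = "dual C Y \<otimes> dual C X" and ?P = "X \<otimes> Y" and ?D = "dual C (X \<otimes> Y)"
  let ?e = "Arr [?T, ?P] [] (ev_tens C X Y)"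
  have e [simp]: "sval ?e" unfolding ev_tens_eq by simp
  then have e' [simp]: "aval (low ?e)" by (rule aval_low)
  have "low (Arr [?T] [?D] (dual_tens C X Y))
     = ((low ?e \<star> aid ?D) \<bullet> aassoc_inv ?T ?P ?D) \<bullet> (aid ?T \<star> low (bl ?P))"
    by (simp add: dual_tens_def low_def acmp_def atens_def aid_def aassoc_inv_def bl_def Let_def)
  also have "\<dots> = low (dten X Y)"
    unfolding dten_def ev_tens_eq[symmetric] using e'
    by (simp add: S.mate_def low_stens del: sval_Arr)
  finally show "low (Arr [?T] [?D] (dual_tens C X Y)) = low (dten X Y)" .
qed simp_all

lemma pv_tens:
  "pv (X \<otimes> Y) = smate (dual C (X \<otimes> Y)) (dual C Y \<otimes> dual C X) (dten_inv X Y)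
     \<bullet> dten (dual C Y) (dual C X) \<bullet> iota [dual C (dual C X), dual C (dual C Y)] \<bullet> (pv X \<odot> pv Y) \<bullet> iota_inv [X, Y]"
proof -
  let ?T = "dual C Y \<otimes> dual C X" and ?P = "X \<otimes> Y" and ?D = "dual C (X \<otimes> Y)"
  let ?XX = "dual C (dual C X)" and ?YY = "dual C (dual C Y)"
  have "S.inverses [?T] [?D] (Arr [?T] [?D] (dual_tens C X Y)) (dten_inv X Y)"
    unfolding dual_tens_eq by (rule inverses_dten)
  moreover obtain g where g: "dten_inv X Y = Arr [?D] [?T] g"
    using dten_simps(5,6)[of X Y] by (metis arr.collapse)
  ultimately have "inverse_pair C ?T ?D (dual_tens C X Y) g"
    by (auto simp: S.inverses_def inverse_pair_def sid_def acmp_def)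
  then have m: "minv C ?T ?D (dual_tens C X Y) = g" by (rule minv_eq)
  have "g \<in> hom C ?D ?T" using dten_simps(4)[of X Y] unfolding g by simp
  then have 1: "Arr [dual C ?T] [dual C ?D] (dual_map C ?D ?T (minv C ?T ?D (dual_tens C X Y)))
      = smate ?D ?T (dten_inv X Y)"
    unfolding g m by (rule dual_map_mate)
  have 2: "Arr [?P] [?XX \<otimes> ?YY] (piv C X \<boxtimes> piv C Y) = iota [?XX, ?YY] \<bullet> (pv X \<odot> pv Y) \<bullet> iota_inv [X, Y]"
    by (rule arr_eqI) (simp_all add: low_stens, simp add: low_def pv_def atens_def)
  have "pv ?P = (smate ?D ?T (dten_inv X Y) \<bullet> dten (dual C Y) (dual C X))
     \<bullet> (iota [?XX, ?YY] \<bullet> (pv X \<odot> pv Y) \<bullet> iota_inv [X, Y])"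
    unfolding 1[symmetric] dual_tens_eq[symmetric] 2[symmetric]
    by (simp add: acmp_def pv_def piv_tens ddual_tens_def Let_def)
  then show ?thesis by simp
qed

definition dten2 where "dten2 X Y = dten X Y \<bullet> iota [dual C Y, dual C X]"
definition dten2_inv where "dten2_inv X Y = iota_inv [dual C Y, dual C X] \<bullet> dten_inv X Y"

lemma inverses_dten2: "S.inverses [dual C Y, dual C X] [dual C (X \<otimes> Y)] (dten2 X Y) (dten2_inv X Y)"
  unfolding dten2_def dten2_inv_def
  using S.inverses_cmp[OF inverses_iota[of "[dual C Y, dual C X]"]] inverses_dten by simp

lemmas dten2_simps [simp] = S.inversesD[OF inverses_dten2]

lemma dl_tens: "dl (X \<otimes> Y) = dl2 X Y \<bullet> (dten2_inv X Y \<odot> iota_inv [X, Y])"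
proof -
  have "dl (X \<otimes> Y) = dl (X \<otimes> Y) \<bullet> ((dten X Y \<odot> sid [X \<otimes> Y]) \<bullet> (dten_inv X Y \<odot> sid [X \<otimes> Y]))"
    by (simp add: S.interchange[symmetric] del: S.whisker_right)
  also have "\<dots> = (dl (X \<otimes> Y) \<bullet> (dten X Y \<odot> sid [X \<otimes> Y])) \<bullet> (dten_inv X Y \<odot> sid [X \<otimes> Y])"
    by simp
  also have "\<dots> = dl2 X Y \<bullet> ((iota_inv [dual C Y, dual C X] \<odot> iota_inv [X, Y]) \<bullet> (dten_inv X Y \<odot> sid [X \<otimes> Y]))"
    unfolding dten_ev by simp
  also have "(iota_inv [dual C Y, dual C X] \<odot> iota_inv [X, Y]) \<bullet> (dten_inv X Y \<odot> sid [X \<otimes> Y])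
      = dten2_inv X Y \<odot> iota_inv [X, Y]"
    by (simp add: S.interchange[symmetric] dten2_inv_def del: S.whisker_right)
  finally show ?thesis .
qed

text \<open>A cup is determined by its cap, so \<open>dl_tens\<close> suffices.\<close>

lemma bl_tens: "bl (X \<otimes> Y) = (iota [X, Y] \<odot> dten2 X Y) \<bullet> bl2 X Y"
proof (rule S.dpair_coev_unique)
  show "S.dpair [X \<otimes> Y] [dual C (X \<otimes> Y)] (bl (X \<otimes> Y)) (dl (X \<otimes> Y))" by (rule dpair_l)
  show "S.dpair [X \<otimes> Y] [dual C (X \<otimes> Y)] ((iota [X, Y] \<odot> dten2 X Y) \<bullet> bl2 X Y) (dl (X \<otimes> Y))"
    unfolding dl_tens using S.dpair_transport[OF dpair_l2 inverses_iota inverses_dten2] by simp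
qed

text \<open>Here monoidality of \<open>piv\<close> enters: the pivotal cap of a tensor product is
  nested as well. Of the factors from \<open>pv_tens\<close>, the mate slides across the cap and
  \<open>dten\<close> is absorbed by \<open>dten_ev\<close>.\<close>

lemma dr_tens: "dr (X \<otimes> Y) = dr2 X Y \<bullet> (iota_inv [X, Y] \<odot> dten2_inv X Y)"
proof -
  let ?X = "dual C X" and ?Y = "dual C Y"
  let ?T = "dual C Y \<otimes> dual C X" and ?P = "X \<otimes> Y" and ?D = "dual C (X \<otimes> Y)"
  let ?XX = "dual C (dual C X)" and ?YY = "dual C (dual C Y)"
  let ?j = "(pv X \<odot> pv Y) \<bullet> iota_inv [X, Y]"
  let ?k = "dten ?Y ?X \<bullet> iota [?XX, ?YY] \<bullet> ?j"
  have "dr ?P = (dl ?D \<bullet> (smate ?D ?T (dten_inv X Y) \<odot> sid [?D])) \<bullet> (?k \<odot> sid [?D])"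
    unfolding dr_def pv_tens by simp
  also have "dl ?D \<bullet> (smate ?D ?T (dten_inv X Y) \<odot> sid [?D]) = dl ?T \<bullet> (sid [dual C ?T] \<odot> dten_inv X Y)"
    using S.mate_ev[OF dpair_l[of ?D] dpair_l[of ?T], of "dten_inv X Y"] by simp
  also have "(dl ?T \<bullet> (sid [dual C ?T] \<odot> dten_inv X Y)) \<bullet> (?k \<odot> sid [?D])
     = dl ?T \<bullet> ((sid [dual C ?T] \<odot> dten_inv X Y) \<bullet> (?k \<odot> sid [?D]))" by simp
  also have "(sid [dual C ?T] \<odot> dten_inv X Y) \<bullet> (?k \<odot> sid [?D]) = ?k \<odot> dten_inv X Y"
    by (simp add: S.interchange[symmetric] del: S.whisker_right S.whisker_left)
  also have "?k \<odot> dten_inv X Y = (dten ?Y ?X \<odot> sid [?T]) \<bullet> ((iota [?XX, ?YY] \<bullet> ?j) \<odot> dten_inv X Y)"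
    by (simp add: S.interchange[symmetric] del: S.whisker_right S.whisker_left)
  also have "dl ?T \<bullet> ((dten ?Y ?X \<odot> sid [?T]) \<bullet> ((iota [?XX, ?YY] \<bullet> ?j) \<odot> dten_inv X Y))
     = (dl ?T \<bullet> (dten ?Y ?X \<odot> sid [?T])) \<bullet> ((iota [?XX, ?YY] \<bullet> ?j) \<odot> dten_inv X Y)" by simp
  also have "\<dots> = dl2 ?Y ?X \<bullet> ((iota_inv [?XX, ?YY] \<odot> iota_inv [?Y, ?X]) \<bullet> ((iota [?XX, ?YY] \<bullet> ?j) \<odot> dten_inv X Y))"
    unfolding dten_ev by simp
  also have "(iota_inv [?XX, ?YY] \<odot> iota_inv [?Y, ?X]) \<bullet> ((iota [?XX, ?YY] \<bullet> ?j) \<odot> dten_inv X Y)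
     = ?j \<odot> dten2_inv X Y"
  proof -
    have "iota_inv [?XX, ?YY] \<bullet> iota [?XX, ?YY] \<bullet> ?j = ?j"
      using S.rewrite_head[OF iota_simps(7)[of "[?XX, ?YY]"], of ?j] by simp
    then show ?thesis
      by (simp add: S.interchange[symmetric] dten2_inv_def del: S.whisker_right S.whisker_left)
  qed
  also have "?j \<odot> dten2_inv X Y = (pv X \<odot> pv Y \<odot> sid [?Y, ?X]) \<bullet> (iota_inv [X, Y] \<odot> dten2_inv X Y)"
    using S.interchange[of "iota_inv [X, Y]" "pv X \<odot> pv Y" "dten2_inv X Y" "sid [?Y, ?X]"]
    by (simp del: S.whisker_right S.whisker_left)
  also have "dl2 ?Y ?X \<bullet> ((pv X \<odot> pv Y \<odot> sid [?Y, ?X]) \<bullet> (iota_inv [X, Y] \<odot> dten2_inv X Y))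
     = (dl2 ?Y ?X \<bullet> (pv X \<odot> pv Y \<odot> sid [?Y, ?X])) \<bullet> (iota_inv [X, Y] \<odot> dten2_inv X Y)" by simp
  also have "dl2 ?Y ?X \<bullet> (pv X \<odot> pv Y \<odot> sid [?Y, ?X]) = dr2 X Y"
  proof -
    have "(sid [?XX] \<odot> dl ?Y \<odot> sid [?X]) \<bullet> (pv X \<odot> pv Y \<odot> sid [?Y, ?X]) = pv X \<odot> dr Y \<odot> sid [?X]"
      using S.interchange[of "pv Y \<odot> sid [?Y]" "dl ?Y" "sid [?X]" "sid [?X]"]
        S.interchange[of "pv X" "sid [?XX]" "pv Y \<odot> sid [?Y, ?X]" "dl ?Y \<odot> sid [?X]"]
      by (simp add: dr_def del: S.whisker_right S.whisker_left)
    also have "\<dots> = (pv X \<odot> sid [?X]) \<bullet> (sid [X] \<odot> dr Y \<odot> sid [?X])"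
      using S.tns_eq1[of "pv X" "dr Y \<odot> sid [?X]"] by simp
    finally show ?thesis by (simp add: dl2_def dr2_def dr_def)
  qed
  finally show ?thesis .
qed

lemma br_tens: "br (X \<otimes> Y) = (dten2 X Y \<odot> iota [X, Y]) \<bullet> br2 X Y"
proof (rule S.dpair_coev_unique)
  show "S.dpair [dual C (X \<otimes> Y)] [X \<otimes> Y] (br (X \<otimes> Y)) (dr (X \<otimes> Y))" by (rule dpair_r)
  show "S.dpair [dual C (X \<otimes> Y)] [X \<otimes> Y] ((dten2 X Y \<odot> iota [X, Y]) \<bullet> br2 X Y) (dr (X \<otimes> Y))"
    unfolding dr_tens using S.dpair_transport[OF dpair_r2 inverses_dten2 inverses_iota, of X Y] by simp
qed

text \<open>The loop of \<open>X \<otimes> Y\<close> is the loop of \<open>Y\<close> inside the loop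
  of \<open>X\<close>, and the inner one is a scalar.\<close>

lemma pdim_tens: "pdim C (X \<otimes> Y) = pdim C X * pdim C Y"
proof -
  have "dr (X \<otimes> Y) \<bullet> bl (X \<otimes> Y)
      = dr2 X Y \<bullet> ((iota_inv [X, Y] \<odot> dten2_inv X Y) \<bullet> (iota [X, Y] \<odot> dten2 X Y)) \<bullet> bl2 X Y"
    unfolding dr_tens bl_tens by simp
  also have "(iota_inv [X, Y] \<odot> dten2_inv X Y) \<bullet> (iota [X, Y] \<odot> dten2 X Y) = sid [X, Y, dual C Y, dual C X]"
    by (simp add: S.interchange[symmetric])
  also have "dr2 X Y \<bullet> sid [X, Y, dual C Y, dual C X] \<bullet> bl2 X Y
     = dr X \<bullet> (sid [X] \<odot> (dr Y \<bullet> bl Y) \<odot> sid [dual C X]) \<bullet> bl X"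
    by (simp add: dr2_def bl2_def)
  also have "\<dots> = smul (pdim C X * pdim C Y) (sid [])"
    by (simp add: dr_bl mult.commute)
  finally have "scal (dr (X \<otimes> Y) \<bullet> bl (X \<otimes> Y)) = scal (smul (pdim C X * pdim C Y) (sid []))" by simp
  then show ?thesis by (simp only: scal_smul pdim_eq[symmetric])
qed

lemma pdim_unit: "pdim C \<one> = 1"
proof -
  have "smul 1 (sid []) = sid []"
    by (simp add: smul_def sid_def vector_space.vector_space_assms(4)[OF vector_space])
  then have "pdim C \<one> = scal (smul 1 (sid []))" by (simp only: pdim_eq dr_unit)
  then show ?thesis by (simp only: scal_smul)
qed

section \<open>Pivotal rotation and its order\<close>

abbreviation srot where "srot X m f \<equiv> S.rot [X] [dual C X] (dl X) (br X) m f"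

lemma srot_simps [simp]:
  assumes "sval f" "asrc f = []" "atgt f = X # m"
  shows "sval (srot X m f)" "asrc (srot X m f) = []" "atgt (srot X m f) = m @ [X]"
  using assms S.valid_rot[of "dl X" "[dual C X]" "[X]" "br X" f m] by simp_all

text \<open>The nested caps and cups of \<open>X \<otimes> Y\<close> rotate its two strands in
  turn.\<close>

lemma srot_tens:
  assumes [simp]: "sval f" "asrc f = []" "atgt f = X # Y # m"
  shows "srot (X \<otimes> Y) m ((iota [X, Y] \<odot> sid m) \<bullet> f)
    = (sid m \<odot> iota [X, Y]) \<bullet> srot Y (m @ [X]) (srot X (Y # m) f)"
proof -
  have "srot (X \<otimes> Y) m ((iota [X, Y] \<odot> sid m) \<bullet> f)
      = (sid m \<odot> iota [X, Y]) \<bullet> S.rot [X, Y] [dual C Y, dual C X] (dl2 X Y) (br2 X Y) m f"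
    unfolding dl_tens br_tens
    using S.rot_transport[where \<epsilon> = "dl2 X Y" and \<eta> = "br2 X Y" and f = f and m = m,
        OF _ _ _ _ _ _ _ _ _ inverses_iota inverses_dten2]
    by simp
  also have "S.rot [X, Y] [dual C Y, dual C X] (dl2 X Y) (br2 X Y) m f = srot Y (m @ [X]) (srot X (Y # m) f)"
    using S.rot_tns[of "dl X" "[dual C X]" "[X]" "br X" "dl Y" "[dual C Y]" "[Y]" "br Y" f m]
    by (simp add: dl2_def br2_def)
  finally show ?thesis .
qed

text \<open>An invariant is a morphism out of the unit, so \<open>dr_natural\<close> slides it
  across the cap like any other box, and \<open>dr_unit\<close> removes the loop of the unit left
  behind.\<close>

lemma srot_id:
  assumes f [simp]: "sval f" "asrc f = []" "atgt f = [X]"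
  shows "srot X [] f = f"
proof (rule S.rot_id[OF dpair_r])
  let ?o = "iota []" and ?oi = "iota_inv []"
  have o [simp]: "sval ?o" "asrc ?o = []" "atgt ?o = [\<one>]" "sval ?oi" "asrc ?oi = [\<one>]" "atgt ?oi = []"
    "?oi \<bullet> ?o = sid []"
    using iota_simps[of "[]"] by simp_all
  let ?U = "dual C \<one>" and ?X = "dual C X"
  define \<beta> where "\<beta> = Arr [] [?U] (coev C \<one>)"
  have b [simp]: "sval \<beta>" "asrc \<beta> = []" "atgt \<beta> = [?U]"
    using left_dual[of \<one>] by (simp_all add: \<beta>_def is_left_dual_def)
  have bl: "bl \<one> = ?o \<odot> \<beta>" by (rule arr_eqI) (simp_all add: low_stens, simp add: bl_def \<beta>_def low_def)
  let ?f = "f \<bullet> ?oi" and ?g = "dl X \<bullet> (sid [?X] \<odot> f)"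
  have f': "(?f \<odot> sid [?U]) \<bullet> bl \<one> = f \<odot> \<beta>"
    unfolding bl by (simp add: S.interchange[symmetric] del: S.whisker_right)
  \<comment> \<open>As the source of \<open>?f\<close> is the unit, its mate splits into the
    functional \<open>?g\<close> and the invariant \<beta> in the dual of the unit.\<close>
  have "smate \<one> X ?f = (dl X \<odot> sid [?U]) \<bullet> (sid [?X] \<odot> ((?f \<odot> sid [?U]) \<bullet> bl \<one>))"
    by (simp add: S.mate_def)
  also have "\<dots> = (dl X \<odot> sid [?U]) \<bullet> (sid [?X] \<odot> f \<odot> \<beta>)" unfolding f' ..
  also have "\<dots> = ?g \<odot> \<beta>"
    using S.interchange[of "sid [?X] \<odot> f" "dl X" \<beta> "sid [?U]"] by simp
  finally have m: "smate \<one> X ?f = ?g \<odot> \<beta>" .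
  have "dr X \<bullet> (f \<odot> sid [?X]) = dr X \<bullet> (?f \<odot> sid [?X]) \<bullet> (?o \<odot> sid [?X])"
    by (simp add: S.interchange[symmetric] del: S.whisker_right)
  also have "\<dots> = (dr X \<bullet> (?f \<odot> sid [?X])) \<bullet> (?o \<odot> sid [?X])" by simp
  also have "\<dots> = dr \<one> \<bullet> ((sid [\<one>] \<odot> ?g \<odot> \<beta>) \<bullet> (?o \<odot> sid [?X]))"
    using dr_natural[of ?f \<one> X] unfolding m by simp
  also have "(sid [\<one>] \<odot> ?g \<odot> \<beta>) \<bullet> (?o \<odot> sid [?X]) = (?o \<odot> \<beta>) \<bullet> ?g"
  proof -
    define g where "g = ?g"
    have [simp]: "sval g" "asrc g = [?X]" "atgt g = []" by (simp_all add: g_def)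
    have "g \<odot> \<beta> = \<beta> \<bullet> g" using S.tns_eq2[of g \<beta>] by simp
    then have "(sid [\<one>] \<odot> g \<odot> \<beta>) \<bullet> (?o \<odot> sid [?X]) = ?o \<odot> (\<beta> \<bullet> g)"
      using S.interchange[of ?o "sid [\<one>]" "sid [?X]" "\<beta> \<bullet> g"] by (simp del: S.whisker_left)
    also have "\<dots> = (?o \<odot> \<beta>) \<bullet> g"
      using S.interchange[of "sid []" ?o g \<beta>] by simp
    finally show ?thesis by (simp only: g_def)
  qed
  also have "dr \<one> \<bullet> ((?o \<odot> \<beta>) \<bullet> ?g) = ?g"
    using S.rewrite_head[OF dr_unit, of ?g] by (simp add: bl)
  finally show "dl X \<bullet> (sid [?X] \<odot> f) = dr X \<bullet> (f \<odot> sid [?X])" by simp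
qed simp_all

text \<open>
  A full rotation fixes \<open>br X\<close>; this forces \<open>bl X\<close> and \<open>br (X\<^sup>*)\<close> to agree up to \<open>piv X\<close>.
\<close>

lemma dl_br: "dl X \<bullet> br X = smul (pdim C (dual C X)) (sid [])"
proof -
  let ?X = "dual C X" and ?XX = "dual C (dual C X)"
  \<comment> \<open>The pivotal cup of the dual object with the double dual replaced by
    \<open>X\<close>. It has the ends of \<open>bl X\<close>, with which it will be identified, and
    one rotation of \<open>br X\<close> produces it.\<close>
  define g where "g = (pv_inv X \<odot> sid [?X]) \<bullet> br ?X"
  have g [simp]: "sval g" "asrc g = []" "atgt g = [X, ?X]" by (simp_all add: g_def)
  have "(dl ?X \<odot> sid [X]) \<bullet> (sid [?XX] \<odot> br X) = ((dl ?X \<odot> sid [X]) \<bullet> (sid [?XX, ?X] \<odot> pv_inv X)) \<bullet> (sid [?XX] \<odot> bl ?X)"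
    by (simp add: br_def)
  also have "(dl ?X \<odot> sid [X]) \<bullet> (sid [?XX, ?X] \<odot> pv_inv X) = pv_inv X \<bullet> (dl ?X \<odot> sid [?XX])"
    using S.exchange[of "dl ?X" "pv_inv X" "[]"] by simp
  also have "(pv_inv X \<bullet> (dl ?X \<odot> sid [?XX])) \<bullet> (sid [?XX] \<odot> bl ?X) = pv_inv X"
    using S.dpairD(8)[OF dpair_l[of ?X]] by simp
  finally have 1: "(dl ?X \<odot> sid [X]) \<bullet> (sid [?XX] \<odot> br X) = pv_inv X" .
  have "srot ?X [X] (br X) = (((dl ?X \<odot> sid [X]) \<bullet> (sid [?XX] \<odot> br X)) \<odot> sid [?X]) \<bullet> br ?X"
    by (simp add: S.rot_def)
  then have 2: "srot ?X [X] (br X) = g" unfolding 1 g_def .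
  \<comment> \<open>Two rotations of single strands are one rotation of
    \<open>?X \<otimes> X\<close>, which fixes the invariant.\<close>
  have "iota [?X, X] \<bullet> srot X [?X] g = srot (?X \<otimes> X) [] (iota [?X, X] \<bullet> br X)"
    using srot_tens[of "br X" ?X X "[]"] by (simp add: 2)
  also have "\<dots> = iota [?X, X] \<bullet> br X" by (rule srot_id) simp_all
  finally have "iota_inv [?X, X] \<bullet> iota [?X, X] \<bullet> srot X [?X] g = iota_inv [?X, X] \<bullet> iota [?X, X] \<bullet> br X"
    by simp
  then have 3: "srot X [?X] g = br X"
    using S.rewrite_head[OF iota_simps(7)[of "[?X, X]"], of "srot X [?X] g"]
      S.rewrite_head[OF iota_simps(7)[of "[?X, X]"], of "br X"] by simp
  \<comment> \<open>\<open>?h\<close> is \<open>g\<close> with one strand bent down. As rotating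
    \<open>g\<close> gives \<open>br X\<close> and a cup is nondegenerate, \<open>?h\<close> is an
    identity.\<close>
  let ?h = "(dl X \<odot> sid [?X]) \<bullet> (sid [?X] \<odot> g)"
  have "(?h \<odot> sid [X]) \<bullet> br X = br X" using 3 by (simp add: S.rot_def)
  then have h: "?h = sid [?X]" by (intro S.dpair_coev_cancel[OF dpair_r[of X]]) simp_all
  have "g = ((sid [X] \<odot> dl X \<odot> sid [?X]) \<bullet> (bl X \<odot> sid [X, ?X])) \<bullet> g"
    using S.zigzag_left[OF dpair_l[of X], of "[]" "[?X]"] by simp
  also have "\<dots> = (sid [X] \<odot> dl X \<odot> sid [?X]) \<bullet> ((bl X \<odot> sid [X, ?X]) \<bullet> g)" by simp
  also have "(bl X \<odot> sid [X, ?X]) \<bullet> g = (sid [X, ?X] \<odot> g) \<bullet> bl X"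
    using S.exchange[of "bl X" g "[]"] by simp
  also have "(sid [X] \<odot> dl X \<odot> sid [?X]) \<bullet> ((sid [X, ?X] \<odot> g) \<bullet> bl X) = (sid [X] \<odot> ?h) \<bullet> bl X"
    by simp
  finally have gb: "g = bl X" unfolding h by simp
  have "S.dpair [X] [?X] g (dr ?X \<bullet> (sid [?X] \<odot> pv X))"
    using S.dpair_transport[OF dpair_r[of ?X] S.inverses_sym[OF inverses_pv[of X]] S.inverses_I]
    by (simp add: g_def)
  then have "dl X = dr ?X \<bullet> (sid [?X] \<odot> pv X)"
    unfolding gb using S.dpair_ev_unique dpair_l by blast
  then have "dl X \<bullet> br X = dr ?X \<bullet> ((sid [?X] \<odot> pv X) \<bullet> (sid [?X] \<odot> pv_inv X)) \<bullet> bl ?X"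
    by (simp add: br_def)
  also have "(sid [?X] \<odot> pv X) \<bullet> (sid [?X] \<odot> pv_inv X) = sid [?X, ?XX]"
    by (simp add: S.interchange[symmetric] del: S.whisker_left)
  finally show ?thesis by (simp add: dr_bl)
qed

definition rotate_head where "rotate_head f = srot (hd (atgt f)) (tl (atgt f)) f"

lemma rotate_head_simps [simp]:
  assumes "sval f" "asrc f = []" "atgt f = X # m"
  shows "sval (rotate_head f)" "asrc (rotate_head f) = []" "atgt (rotate_head f) = m @ [X]"
  using assms by (simp_all add: rotate_head_def)

text \<open>Induction through \<open>srot_tens\<close>: naturality lets the tail rotate as one
  strand, and the hypothesis resolves this into single rotations. Validity and ends are carried
  along because the diagram calculus needs them.\<close>

lemma srot_tens_list:
  assumes "l \<noteq> []" "sval f" "asrc f = []" "atgt f = l @ m"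
  shows "srot (tens_list l) m ((iota l \<odot> sid m) \<bullet> f) = (sid m \<odot> iota l) \<bullet> (rotate_head ^^ length l) f
    \<and> sval ((rotate_head ^^ length l) f) \<and> asrc ((rotate_head ^^ length l) f) = []
    \<and> atgt ((rotate_head ^^ length l) f) = m @ l"
  using assms
proof (induction l arbitrary: f m rule: list_nonempty_induct)
  case (single X)
  have "iota [X] = sid [X]" by (rule arr_eqI) simp_all
  then show ?case using single by (simp add: rotate_head_def)
next
  case (cons X l)
  note [simp] = cons.prems
  let ?Y = "tens_list l"
  let ?f = "(sid [X] \<odot> iota l \<odot> sid m) \<bullet> f"
  have R [simp]: "rotate_head f = srot X (l @ m) f" by (simp add: rotate_head_def)
  have iota: "iota (X # l) = iota [X, ?Y] \<bullet> (sid [X] \<odot> iota l)"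
    by (rule arr_eqI) (simp_all add: low_stens)
  have IH: "srot ?Y (m @ [X]) ((iota l \<odot> sid (m @ [X])) \<bullet> rotate_head f)
        = (sid (m @ [X]) \<odot> iota l) \<bullet> (rotate_head ^^ length l) (rotate_head f)"
    "sval ((rotate_head ^^ length l) (rotate_head f))" "asrc ((rotate_head ^^ length l) (rotate_head f)) = []"
    "atgt ((rotate_head ^^ length l) (rotate_head f)) = m @ X # l"
    using cons.IH[of "rotate_head f" "m @ [X]"] by simp_all
  have "srot (tens_list (X # l)) m ((iota (X # l) \<odot> sid m) \<bullet> f)
     = srot (X \<otimes> ?Y) m ((iota [X, ?Y] \<odot> sid m) \<bullet> ?f)"
    unfolding iota by simp
  also have "\<dots> = (sid m \<odot> iota [X, ?Y]) \<bullet> srot ?Y (m @ [X]) (srot X (?Y # m) ?f)"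
    by (rule srot_tens) simp_all
  also have "srot X (?Y # m) ?f = (iota l \<odot> sid (m @ [X])) \<bullet> rotate_head f"
    using S.rot_natural[of "dl X" "[dual C X]" "[X]" "br X" f "l @ m" "iota l \<odot> sid m" "?Y # m"] by simp
  also have "srot ?Y (m @ [X]) ((iota l \<odot> sid (m @ [X])) \<bullet> rotate_head f)
      = (sid (m @ [X]) \<odot> iota l) \<bullet> (rotate_head ^^ length l) (rotate_head f)" by (rule IH(1))
  also have "(sid m \<odot> iota [X, ?Y]) \<bullet> (sid (m @ [X]) \<odot> iota l) \<bullet> (rotate_head ^^ length l) (rotate_head f)
      = (sid m \<odot> iota (X # l)) \<bullet> (rotate_head ^^ length l) (rotate_head f)"
    unfolding iota using IH(2-4) by simp
  finally show ?case using IH(2-4) by (simp add: funpow_swap1)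
qed

text \<open>The whole list rotates as the one object \<open>tens_list l\<close> with nothing left
  over, where \<open>srot_id\<close> applies.\<close>

lemma rotate_head_order:
  assumes "l \<noteq> []" "sval f" "asrc f = []" "atgt f = l"
  shows "(rotate_head ^^ length l) f = f"
proof -
  let ?g = "(rotate_head ^^ length l) f"
  note [simp] = assms
  have g [simp]: "sval ?g" "asrc ?g = []" "atgt ?g = l"
    and "srot (tens_list l) [] (iota l \<bullet> f) = iota l \<bullet> ?g"
    using srot_tens_list[of l f "[]"] by simp_all
  then have "iota l \<bullet> ?g = iota l \<bullet> f" by (simp add: srot_id)
  then have "iota_inv l \<bullet> iota l \<bullet> ?g = iota_inv l \<bullet> iota l \<bullet> f" by simp
  then show ?thesis
    using S.rewrite_head[OF iota_simps(7)[of l], of ?g] S.rewrite_head[OF iota_simps(7)[of l], of f]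
    by simp
qed

section \<open>The operator defining the indicators as a rotation\<close>

lemma tens_list_replicate: "tens_list (replicate n V) = tpow C V n"
proof (induction n)
  case (Suc n)
  then show ?case by (cases n) simp_all
qed simp

lemma tpow_assoc_eq: "tpow_assoc C V m = amor (phi (replicate m V) [V])"
  by (induction m) (simp_all add: tens_list_replicate)

text \<open>\<open>D_map\<close> ends in the double dual. Applying the inverse of \<open>piv\<close>
  directly to the cup turns that cup into \<open>br V\<close>, and \<open>tpow_assoc\<close> is the
  \<open>phi\<close> of the strict tensor product.\<close>

lemma E_map_eq:
  assumes f: "f \<in> hom C \<one> (tpow C V (Suc m))"
  shows "Arr [] (replicate (Suc m) V) (E_map C V (Suc m) f) = rotate_head (Arr [] (replicate (Suc m) V) f)"
proof -
  let ?l = "replicate m V" and ?V = "dual C V" and ?VV = "dual C (dual C V)"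
  define F where "F = Arr [] (V # ?l) f"
  have t: "V \<otimes> tpow C V m = tpow C V (Suc m)"
    using tens_list_replicate[of "Suc m" V] by (simp add: tens_list_replicate)
  have [simp]: "sval F" "asrc F = []" "atgt F = V # ?l" "amor F = f"
    using f by (simp_all add: F_def tens_list_replicate t)
  define f' where "f' = (dl V \<odot> sid ?l) \<bullet> (sid [?V] \<odot> F)"
  have f' [simp]: "sval f'" "asrc f' = [?V]" "atgt f' = ?l" by (simp_all add: f'_def)
  have amor_f': "amor f' = (ev C V \<boxtimes> ident C (tpow C V m)) \<cdot> assoc_inv C (dual C V) V (tpow C V m) \<cdot> (ident C (dual C V) \<boxtimes> f)"
  proof -
    have "low f' = ((low (dl V) \<star> aid (tpow C V m)) \<bullet> aassoc_inv (dual C V) V (tpow C V m)) \<bullet> (aid ?V \<star> low F)"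
      by (simp add: f'_def low_stens tens_list_replicate)
    then have "amor (low f') = amor (((low (dl V) \<star> aid (tpow C V m)) \<bullet> aassoc_inv (dual C V) V (tpow C V m)) \<bullet> (aid ?V \<star> low F))"
      by (rule arg_cong)
    then show ?thesis by (simp add: dl_def)
  qed
  have "srot V ?l F = ((f' \<odot> sid [V]) \<bullet> (sid [?V] \<odot> pv_inv V)) \<bullet> bl ?V"
    by (simp add: S.rot_def f'_def br_def)
  also have "(f' \<odot> sid [V]) \<bullet> (sid [?V] \<odot> pv_inv V) = (sid ?l \<odot> pv_inv V) \<bullet> (f' \<odot> sid [?VV])"
    using S.exchange[of f' "pv_inv V" "[]"] by simp
  also have "((sid ?l \<odot> pv_inv V) \<bullet> (f' \<odot> sid [?VV])) \<bullet> bl ?V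
     = (sid ?l \<odot> pv_inv V) \<bullet> ((f' \<odot> sid [?VV]) \<bullet> bl ?V)" by simp
  finally have r: "srot V ?l F = (sid ?l \<odot> pv_inv V) \<bullet> ((f' \<odot> sid [?VV]) \<bullet> bl ?V)" .
  have "low (srot V ?l F) = (phi ?l [V] \<bullet> (aid (tpow C V m) \<star> low (pv_inv V))) \<bullet> ((low f' \<star> aid ?VV) \<bullet> low (bl ?V))"
    unfolding r by (simp add: low_stens tens_list_replicate)
  then have "amor (low (srot V ?l F)) = amor ((phi ?l [V] \<bullet> (aid (tpow C V m) \<star> low (pv_inv V))) \<bullet> ((low f' \<star> aid ?VV) \<bullet> low (bl ?V)))"
    by (rule arg_cong)
  then have "amor (srot V ?l F) = E_map C V (Suc m) f"
    by (simp add: E_map_def D_map_def Let_def tpow_assoc_eq amor_f' pv_inv_def bl_def)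
  moreover have "asrc (srot V ?l F) = []" "atgt (srot V ?l F) = V # ?l"
    by (simp_all add: replicate_append_same)
  moreover have "rotate_head F = srot V ?l F" by (simp add: rotate_head_def)
  ultimately show ?thesis
    by (cases "srot V ?l F") (simp add: F_def[symmetric])
qed

end

section \<open>Fusion multiplicities and dimensions\<close>

context linear_category
begin

interpretation vs: vector_space "scl C" by (rule vector_space)

lemma zero_in_hom: "0 \<in> hom C X Y"
  using vs.subspace_0[OF hom_subspace] .

lemma comp_add_right:
  assumes "f \<in> hom C X Y" "f' \<in> hom C X Y" "g \<in> hom C Y Z"
  shows "g \<cdot> (f + f') = (g \<cdot> f) + (g \<cdot> f')"
  using comp_bilinear[of Y Z X] assms by (auto simp: bilinear_on_def)

lemma comp_add_left:
  assumes "f \<in> hom C X Y" "g \<in> hom C Y Z" "g' \<in> hom C Y Z"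
  shows "(g + g') \<cdot> f = (g \<cdot> f) + (g' \<cdot> f)"
  using comp_bilinear[of Y Z X] assms by (auto simp: bilinear_on_def)

lemma comp_scale:
  assumes "f \<in> hom C X Y" "g \<in> hom C Y Z"
  shows "g \<cdot> scl C k f = scl C k (g \<cdot> f)" "scl C k g \<cdot> f = scl C k (g \<cdot> f)"
  using comp_bilinear[of Y Z X] assms by (auto simp: bilinear_on_def)

lemma comp_zero:
  shows "g \<in> hom C Y Z \<Longrightarrow> g \<cdot> 0 = 0" "f \<in> hom C X Y \<Longrightarrow> 0 \<cdot> f = 0"
  using comp_scale(1)[OF zero_in_hom, of g Y Z 0] comp_scale(2)[OF _ zero_in_hom, of f X Y 0] by simp_all

lemma sum_in_hom: "(\<And>a. a \<in> A \<Longrightarrow> f a \<in> hom C X Y) \<Longrightarrow> sum f A \<in> hom C X Y"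
  by (rule vs.subspace_sum[OF hom_subspace])

lemma comp_sum_right:
  assumes "g \<in> hom C Y Z" "\<And>a. a \<in> A \<Longrightarrow> f a \<in> hom C X Y"
  shows "g \<cdot> (\<Sum>a\<in>A. f a) = (\<Sum>a\<in>A. g \<cdot> f a)"
  using assms(2)
proof (induction A rule: infinite_finite_induct)
  case (insert x A)
  then show ?case using sum_in_hom[of A f X Y] comp_add_right[of "f x" X Y "sum f A" g Z] assms(1) by simp
qed (simp_all add: comp_zero(1)[OF assms(1)])

lemma comp_sum_left:
  assumes "f \<in> hom C X Y" "\<And>a. a \<in> A \<Longrightarrow> g a \<in> hom C Y Z"
  shows "(\<Sum>a\<in>A. g a) \<cdot> f = (\<Sum>a\<in>A. g a \<cdot> f)"
  using assms(2)
proof (induction A rule: infinite_finite_induct)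
  case (insert x A)
  then show ?case using sum_in_hom[of A g Y Z] comp_add_left[of f X Y "g x" Z "sum g A"] assms(1) by simp
qed (simp_all add: comp_zero(2)[OF assms(1)])

lemma inverse_pair_sym: "inverse_pair C X Y f g \<Longrightarrow> inverse_pair C Y X g f"
  by (simp add: inverse_pair_def)

lemma isomorphic_sym: "isomorphic C X Y \<Longrightarrow> isomorphic C Y X"
  unfolding isomorphic_def is_iso_def using inverse_pair_sym by blast

lemma isomorphic_refl: "isomorphic C X X"
  unfolding isomorphic_def is_iso_def inverse_pair_def using ident_in_hom comp_ident by blast

lemma inverse_pair_comp:
  assumes "inverse_pair C X Y f f'" "inverse_pair C Y Z g g'"
  shows "inverse_pair C X Z (g \<cdot> f) (f' \<cdot> g')"
  using ainv_acmp[of "Arr X Y f" "Arr Y X f'" "Arr Y Z g" "Arr Z Y g'"] assms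
  by (simp add: ainv_iff) (simp add: acmp_def ainv_iff)

lemma isomorphic_trans: "isomorphic C X Y \<Longrightarrow> isomorphic C Y Z \<Longrightarrow> isomorphic C X Z"
  unfolding isomorphic_def is_iso_def using inverse_pair_comp by blast

end

section \<open>Schur's lemma and multiplicities\<close>

context abelian_category
begin

interpretation vs: vector_space "scl C" by (rule vector_space)

lemma kernel_monic:
  assumes k: "is_kernel C X Y f K k" and f: "f \<in> hom C X Y"
  shows "monic C K X k"
  unfolding monic_def
proof (intro conjI allI ballI impI)
  show kh: "k \<in> hom C K X" using k by (simp add: is_kernel_def)
  fix W u v assume uv: "u \<in> hom C W K" "v \<in> hom C W K" "k \<cdot> u = k \<cdot> v"
  have "f \<cdot> (k \<cdot> u) = (f \<cdot> k) \<cdot> u" by (rule comp_assoc[OF f kh uv(1), symmetric])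
  also have "\<dots> = 0" using k comp_zero(2)[OF uv(1)] by (simp add: is_kernel_def)
  finally have "\<exists>!w. w \<in> hom C W K \<and> k \<cdot> w = k \<cdot> u"
    using k comp_in_hom[OF kh uv(1)] unfolding is_kernel_def by blast
  then show "u = v" using uv by metis
qed

text \<open>The kernel is a subobject of the simple \<open>U\<close> but not all of it, so it is
  zero. Then \<open>f\<close> is monic from a nonzero object into the simple
  \<open>W\<close>.\<close>

lemma schur:
  assumes U: "simple C U" and W: "simple C W" and f: "f \<in> hom C U W" and nz: "f \<noteq> 0"
  shows "is_iso C U W f"
proof -
  obtain K k where k: "is_kernel C U W f K k" using kernels[OF f] by blast
  then have kh: "k \<in> hom C K U" and fk: "f \<cdot> k = 0" by (auto simp: is_kernel_def)
  have "\<not> is_iso C K U k"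
  proof
    assume "is_iso C K U k"
    then obtain g where g: "inverse_pair C K U k g" by (auto simp: is_iso_def)
    then have gh: "g \<in> hom C U K" by (simp add: inverse_pair_def)
    have "f = f \<cdot> (k \<cdot> g)" using g comp_ident[OF f] by (simp add: inverse_pair_def)
    also have "\<dots> = (f \<cdot> k) \<cdot> g" by (rule comp_assoc[OF f kh gh, symmetric])
    finally show False using nz by (simp add: fk comp_zero(2)[OF gh])
  qed
  then have K: "zero_object C K" using U kernel_monic[OF k f] unfolding simple_def by blast
  have "monic C U W f"
    unfolding monic_def
  proof (intro conjI allI ballI impI)
    fix X u v assume uv: "u \<in> hom C X U" "v \<in> hom C X U" "f \<cdot> u = f \<cdot> v"
    have d: "u - v \<in> hom C X U" using vs.subspace_diff[OF hom_subspace] uv by blast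
    have "f \<cdot> u = (f \<cdot> (u - v)) + (f \<cdot> v)" using comp_add_right[OF d uv(2) f] by simp
    then have "f \<cdot> (u - v) = 0" using uv(3) by simp
    then obtain w where "w \<in> hom C X K" "k \<cdot> w = u - v"
      using k d unfolding is_kernel_def by blast
    then have "u - v = 0" using K comp_zero(1)[OF kh] by (auto simp: zero_object_def)
    then show "u = v" by simp
  qed (rule f)
  then show ?thesis using U W unfolding simple_def by blast
qed

end

context pivotal_fusion_category
begin

interpretation vs: vector_space "scl C" by (rule vector_space)

lemma hom_finite_dim: "finite_dim_subspace (scl C) (hom C X Y)"
  by unfold_locales (rule finite_dim_hom)

abbreviation hdim where "hdim X Y \<equiv> vector_space.dim (scl C) (hom C X Y)"

text \<open>By Schur only the summands isomorphic to \<open>U\<close> matter. Their inclusions and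
  projections, transferred to \<open>U\<close> along chosen isomorphisms, form dual families that
  are complete on both sides.\<close>

lemma isotypic:
  assumes U: "simple C U" and S: "\<And>s. s < k \<Longrightarrow> simple C (S s)" and X: "direct_sum C X k S"
  defines "K \<equiv> {s. s < k \<and> isomorphic C U (S s)}"
  obtains a b where "\<And>s. s \<in> K \<Longrightarrow> a s \<in> hom C U X" "\<And>s. s \<in> K \<Longrightarrow> b s \<in> hom C X U"
    "\<And>s t. s \<in> K \<Longrightarrow> t \<in> K \<Longrightarrow> b t \<cdot> a s = (if s = t then ident C U else 0)"
    "\<And>x. x \<in> hom C U X \<Longrightarrow> (\<Sum>s\<in>K. a s \<cdot> (b s \<cdot> x)) = x"
    "\<And>x. x \<in> hom C X U \<Longrightarrow> (\<Sum>s\<in>K. (x \<cdot> a s) \<cdot> b s) = x"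
proof -
  obtain i p where ip: "\<And>s. s < k \<Longrightarrow> i s \<in> hom C (S s) X" "\<And>s. s < k \<Longrightarrow> p s \<in> hom C X (S s)"
    "\<And>s t. s < k \<Longrightarrow> t < k \<Longrightarrow> p s \<cdot> i t = (if s = t then ident C (S s) else 0)"
    "(\<Sum>s<k. i s \<cdot> p s) = ident C X"
    using X unfolding direct_sum_def by blast
  have "\<forall>s\<in>K. \<exists>f g. inverse_pair C U (S s) f g"
    by (auto simp: K_def isomorphic_def is_iso_def)
  then obtain f g where fg: "\<And>s. s \<in> K \<Longrightarrow> inverse_pair C U (S s) (f s) (g s)" by metis
  then have f: "s \<in> K \<Longrightarrow> f s \<in> hom C U (S s)" and g: "s \<in> K \<Longrightarrow> g s \<in> hom C (S s) U"
    and gf: "s \<in> K \<Longrightarrow> g s \<cdot> f s = ident C U" and fg': "s \<in> K \<Longrightarrow> f s \<cdot> g s = ident C (S s)" for s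
    by (auto simp: inverse_pair_def)
  have Kk: "s \<in> K \<Longrightarrow> s < k" for s by (simp add: K_def)
  note ia = ip(1)[OF Kk] and pa = ip(2)[OF Kk]
  let ?a = "\<lambda>s. i s \<cdot> f s" and ?b = "\<lambda>s. g s \<cdot> p s"
  have a: "s \<in> K \<Longrightarrow> ?a s \<in> hom C U X" and b: "s \<in> K \<Longrightarrow> ?b s \<in> hom C X U" for s
    using comp_in_hom ia pa f g by blast+
  have ab: "?a s \<cdot> ?b s = i s \<cdot> p s" if s: "s \<in> K" for s
  proof -
    have "?a s \<cdot> ?b s = i s \<cdot> (f s \<cdot> ?b s)" by (rule comp_assoc[OF ia f b]) fact+
    also have "f s \<cdot> ?b s = (f s \<cdot> g s) \<cdot> p s" by (rule comp_assoc[OF f g pa, symmetric]) fact+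
    finally show ?thesis using fg'[OF s] ident_comp[OF pa[OF s]] by simp
  qed
  show ?thesis
  proof (rule that[of ?a ?b])
    show "?b t \<cdot> ?a s = (if s = t then ident C U else 0)" if s: "s \<in> K" and t: "t \<in> K" for s t
    proof -
      have "?b t \<cdot> ?a s = g t \<cdot> (p t \<cdot> ?a s)" by (rule comp_assoc[OF g pa a]) fact+
      also have "p t \<cdot> ?a s = (p t \<cdot> i s) \<cdot> f s" by (rule comp_assoc[OF pa ia f, symmetric]) fact+
      also have "p t \<cdot> i s = (if t = s then ident C (S s) else 0)" using ip(3)[OF Kk[OF t] Kk[OF s]] by simp
      finally show ?thesis
        using gf[OF s] ident_comp[OF f[OF s]] comp_zero(2)[OF f[OF s]] comp_zero(1)[OF g[OF t]] by auto
    qed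
    show "(\<Sum>s\<in>K. ?a s \<cdot> (?b s \<cdot> x)) = x" if x: "x \<in> hom C U X" for x
    proof -
      have "x = (\<Sum>s<k. i s \<cdot> p s) \<cdot> x" using ip(4) ident_comp[OF x] by simp
      also have "\<dots> = (\<Sum>s<k. (i s \<cdot> p s) \<cdot> x)"
        by (rule comp_sum_left[OF x]) (use comp_in_hom ip in blast)
      also have "\<dots> = (\<Sum>s\<in>K. (i s \<cdot> p s) \<cdot> x)"
      proof (rule sum.mono_neutral_right)
        show "\<forall>s\<in>{..<k} - K. (i s \<cdot> p s) \<cdot> x = 0"
        proof
          fix s assume s: "s \<in> {..<k} - K"
          then have sk: "s < k" by simp
          have h: "p s \<cdot> x \<in> hom C U (S s)" using comp_in_hom ip(2)[OF sk] x by blast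
          then have "p s \<cdot> x = 0"
            using schur[OF U S[OF sk] h] s by (auto simp: K_def isomorphic_def)
          then show "(i s \<cdot> p s) \<cdot> x = 0"
            using comp_assoc[OF ip(1)[OF sk] ip(2)[OF sk] x] comp_zero(1)[OF ip(1)[OF sk]] by simp
        qed
      qed (auto simp: K_def)
      also have "\<dots> = (\<Sum>s\<in>K. ?a s \<cdot> (?b s \<cdot> x))"
        by (intro sum.cong refl) (simp add: ab[symmetric] comp_assoc[OF a b x])
      finally show ?thesis by simp
    qed
    show "(\<Sum>s\<in>K. (x \<cdot> ?a s) \<cdot> ?b s) = x" if x: "x \<in> hom C X U" for x
    proof -
      have "x = x \<cdot> (\<Sum>s<k. i s \<cdot> p s)" using ip(4) comp_ident[OF x] by simp
      also have "\<dots> = (\<Sum>s<k. x \<cdot> (i s \<cdot> p s))"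
        by (rule comp_sum_right[OF x]) (use comp_in_hom ip in blast)
      also have "\<dots> = (\<Sum>s\<in>K. x \<cdot> (i s \<cdot> p s))"
      proof (rule sum.mono_neutral_right)
        show "\<forall>s\<in>{..<k} - K. x \<cdot> (i s \<cdot> p s) = 0"
        proof
          fix s assume s: "s \<in> {..<k} - K"
          then have sk: "s < k" by simp
          have h: "x \<cdot> i s \<in> hom C (S s) U" using comp_in_hom ip(1)[OF sk] x by blast
          then have "x \<cdot> i s = 0"
            using schur[OF S[OF sk] U h] s isomorphic_sym[of "S s" U] by (auto simp: K_def isomorphic_def)
          then show "x \<cdot> (i s \<cdot> p s) = 0"
            using comp_assoc[OF x ip(1)[OF sk] ip(2)[OF sk]] comp_zero(2)[OF ip(2)[OF sk]] by simp
        qed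
      qed (auto simp: K_def)
      also have "\<dots> = (\<Sum>s\<in>K. (x \<cdot> ?a s) \<cdot> ?b s)"
        by (intro sum.cong refl) (simp add: ab[symmetric] comp_assoc[OF x a b])
      finally show ?thesis by simp
    qed
  qed (use a b in blast)+
qed

text \<open>As the endomorphisms of \<open>U\<close> are scalars, \<open>b s \<cdot> x\<close> and
  \<open>x \<cdot> a s\<close> are the coordinates of \<open>x\<close> in the two families.\<close>

lemma hdim_card_family:
  assumes U: "simple C U" and K: "finite K"
    and a: "\<And>s. s \<in> K \<Longrightarrow> a s \<in> hom C U X" and b: "\<And>s. s \<in> K \<Longrightarrow> b s \<in> hom C X U"
    and ba: "\<And>s t. s \<in> K \<Longrightarrow> t \<in> K \<Longrightarrow> b t \<cdot> a s = (if s = t then ident C U else 0)"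
    and l: "\<And>x. x \<in> hom C U X \<Longrightarrow> (\<Sum>s\<in>K. a s \<cdot> (b s \<cdot> x)) = x"
    and r: "\<And>x. x \<in> hom C X U \<Longrightarrow> (\<Sum>s\<in>K. (x \<cdot> a s) \<cdot> b s) = x"
  shows "hdim U X = card K" and "hdim X U = card K"
proof -
  have End: "\<exists>c. x = scl C c (ident C U)" if "x \<in> hom C U U" for x
    using simple_End[OF U] that by (auto simp: bij_betw_def)
  have inj: "c = 0" if "scl C c (ident C U) = 0" for c
    using scl_ident_inj[OF U, of c 0] that by simp
  show "hdim U X = card K"
  proof (rule finite_dim_subspace.dim_eq_card_family[OF hom_finite_dim K, of a])
    show "a s \<in> hom C U X" if "s \<in> K" for s by (rule a[OF that])
    fix x assume x: "x \<in> hom C U X"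
    have "\<forall>s\<in>K. \<exists>c. b s \<cdot> x = scl C c (ident C U)"
      by (intro ballI End comp_in_hom[OF b x])
    from bchoice[OF this] obtain c where c: "\<And>s. s \<in> K \<Longrightarrow> b s \<cdot> x = scl C (c s) (ident C U)"
      by blast
    have "a s \<cdot> (b s \<cdot> x) = scl C (c s) (a s)" if s: "s \<in> K" for s
      using c[OF s] comp_scale(1)[OF ident_in_hom a[OF s]] comp_ident[OF a[OF s]] by simp
    then have "x = (\<Sum>s\<in>K. scl C (c s) (a s))" using l[OF x] by simp
    then show "\<exists>c. x = (\<Sum>s\<in>K. scl C (c s) (a s))" by blast
  next
    fix c t assume 0: "(\<Sum>s\<in>K. scl C (c s) (a s)) = 0" and t: "t \<in> K"
    have "0 = b t \<cdot> (\<Sum>s\<in>K. scl C (c s) (a s))" using 0 comp_zero(1)[OF b[OF t]] by simp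
    also have "\<dots> = (\<Sum>s\<in>K. b t \<cdot> scl C (c s) (a s))"
      by (rule comp_sum_right[OF b[OF t] hom_scale[OF a]])
    also have "\<dots> = (\<Sum>s\<in>K. if s = t then scl C (c t) (ident C U) else 0)"
      using comp_scale(1)[OF a b[OF t]] ba[OF _ t] by (intro sum.cong) auto
    also have "\<dots> = scl C (c t) (ident C U)" using t K by simp
    finally show "c t = 0" using inj by simp
  qed
  show "hdim X U = card K"
  proof (rule finite_dim_subspace.dim_eq_card_family[OF hom_finite_dim K, of b])
    show "b s \<in> hom C X U" if "s \<in> K" for s by (rule b[OF that])
    fix x assume x: "x \<in> hom C X U"
    have "\<forall>s\<in>K. \<exists>c. x \<cdot> a s = scl C c (ident C U)"
      by (intro ballI End comp_in_hom[OF x a])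
    from bchoice[OF this] obtain c where c: "\<And>s. s \<in> K \<Longrightarrow> x \<cdot> a s = scl C (c s) (ident C U)"
      by blast
    have "(x \<cdot> a s) \<cdot> b s = scl C (c s) (b s)" if s: "s \<in> K" for s
      using c[OF s] comp_scale(2)[OF b[OF s] ident_in_hom] ident_comp[OF b[OF s]] by simp
    then have "x = (\<Sum>s\<in>K. scl C (c s) (b s))" using r[OF x] by simp
    then show "\<exists>c. x = (\<Sum>s\<in>K. scl C (c s) (b s))" by blast
  next
    fix c t assume 0: "(\<Sum>s\<in>K. scl C (c s) (b s)) = 0" and t: "t \<in> K"
    have "0 = (\<Sum>s\<in>K. scl C (c s) (b s)) \<cdot> a t" using 0 comp_zero(2)[OF a[OF t]] by simp
    also have "\<dots> = (\<Sum>s\<in>K. scl C (c s) (b s) \<cdot> a t)"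
      by (rule comp_sum_left[OF a[OF t] hom_scale[OF b]])
    also have "\<dots> = (\<Sum>s\<in>K. if s = t then scl C (c t) (ident C U) else 0)"
      using comp_scale(2)[OF a[OF t] b] ba[OF t] by (intro sum.cong) auto
    also have "\<dots> = scl C (c t) (ident C U)" using t K by simp
    finally show "c t = 0" using inj by simp
  qed
qed

lemma hdim_simple:
  assumes U: "simple C U" and S: "\<And>s. s < k \<Longrightarrow> simple C (S s)" and X: "direct_sum C X k S"
  shows "hdim U X = card {s. s < k \<and> isomorphic C U (S s)}"
    and "hdim X U = card {s. s < k \<and> isomorphic C U (S s)}"
  by (rule isotypic[OF U S X]; (assumption | rule hdim_card_family[OF U] | simp))+

text \<open>Both dimensions count the summands isomorphic to \<open>U\<close>. Multiplicities are
  counted with the simple object as source, whereas \<open>hdim_adjoint\<close> can leave it as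
  target.\<close>

lemma hdim_sym:
  assumes "simple C U"
  shows "hdim U X = hdim X U"
proof -
  obtain k S where "\<forall>s<k. simple C (S s)" "direct_sum C X k S" using semisimple[of X] by blast
  then show ?thesis using hdim_simple[OF assms, of k S X] by simp
qed

section \<open>Additivity of the pivotal dimension\<close>

definition ptrace where "ptrace X f = amor (dr X) \<cdot> ((f \<boxtimes> ident C (dual C X)) \<cdot> coev C X)"

lemma amor_dr: "amor (dr X) \<in> hom C (X \<otimes> dual C X) \<one>"
  using br_dr_simps(4)[of X] by (simp add: sval_def aval_def del: br_dr_simps(4))

lemma coev_in_hom: "coev C X \<in> hom C \<one> (X \<otimes> dual C X)"
  using left_dual by (simp add: is_left_dual_def)

lemma ptrace_eq:
  assumes "f \<in> hom C X X"
  shows "ptrace X f = amor (dr X \<bullet> (Arr [X] [X] f \<odot> sid [dual C X]) \<bullet> bl X)"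
proof -
  have "amor (dr X \<bullet> (Arr [X] [X] f \<odot> sid [dual C X]) \<bullet> bl X)
     = amor (low (dr X \<bullet> (Arr [X] [X] f \<odot> sid [dual C X]) \<bullet> bl X))" by simp
  also have "low (dr X \<bullet> (Arr [X] [X] f \<odot> sid [dual C X]) \<bullet> bl X)
     = low (dr X) \<bullet> (Arr X X f \<star> aid (dual C X)) \<bullet> low (bl X)"
    using assms by (simp add: low_stens low_Arr)
  finally show ?thesis by (simp add: ptrace_def bl_def)
qed

lemma ptrace_ident: "ptrace X (ident C X) = scl C (pdim C X) (ident C \<one>)"
proof -
  have "Arr [X] [X] (ident C X) = sid [X]" by (simp add: sid_def)
  then show ?thesis unfolding ptrace_eq[OF ident_in_hom] by (simp add: dr_bl) (simp add: sid_def)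
qed

lemma ptrace_cyclic:
  assumes f: "f \<in> hom C X Y" and g: "g \<in> hom C Y X"
  shows "ptrace Y (f \<cdot> g) = ptrace X (g \<cdot> f)"
  unfolding ptrace_eq[OF comp_in_hom[OF f g]] ptrace_eq[OF comp_in_hom[OF g f]]
  using trace_cyclic[of "Arr [X] [Y] f" X Y "Arr [Y] [X] g"] f g by (simp add: acmp_def)

lemma ptrace_sum:
  assumes "\<And>s. s \<in> A \<Longrightarrow> f s \<in> hom C X X"
  shows "ptrace X (\<Sum>s\<in>A. f s) = (\<Sum>s\<in>A. ptrace X (f s))"
proof -
  let ?i = "ident C (dual C X)"
  have t: "h \<boxtimes> ?i \<in> hom C (X \<otimes> dual C X) (X \<otimes> dual C X)" if "h \<in> hom C X X" for h
    using tens_in_hom[OF that ident_in_hom] .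
  have add: "(h + h') \<boxtimes> ?i = h \<boxtimes> ?i + h' \<boxtimes> ?i" if "h \<in> hom C X X" "h' \<in> hom C X X" for h h'
    using tens_bilinear[of X X "dual C X" "dual C X"] that ident_in_hom by (auto simp: bilinear_on_def)
  have zero: "0 \<boxtimes> ?i = 0" using add[OF zero_in_hom zero_in_hom] by simp
  have "(\<Sum>s\<in>A. f s) \<boxtimes> ?i = (\<Sum>s\<in>A. f s \<boxtimes> ?i)"
    using assms
  proof (induction A rule: infinite_finite_induct)
    case (insert x A)
    then show ?case using sum_in_hom[of A f X X] by (simp add: add)
  qed (simp_all add: zero)
  moreover have "(\<Sum>s\<in>A. f s \<boxtimes> ?i) \<cdot> coev C X = (\<Sum>s\<in>A. (f s \<boxtimes> ?i) \<cdot> coev C X)"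
    by (rule comp_sum_left[OF coev_in_hom]) (use t assms in blast)
  moreover have "amor (dr X) \<cdot> (\<Sum>s\<in>A. (f s \<boxtimes> ?i) \<cdot> coev C X) = (\<Sum>s\<in>A. amor (dr X) \<cdot> ((f s \<boxtimes> ?i) \<cdot> coev C X))"
    by (rule comp_sum_right[OF amor_dr]) (use comp_in_hom[OF t coev_in_hom] assms in blast)
  ultimately show ?thesis by (simp add: ptrace_def)
qed

lemma pdim_eqI: "scl C c (ident C \<one>) = scl C (pdim C X) (ident C \<one>) \<Longrightarrow> pdim C X = c"
  by (drule iffD1[OF scl_ident_inj[OF simple_unit]]) (rule sym)

lemma pdim_isomorphic:
  assumes "isomorphic C X Y"
  shows "pdim C X = pdim C Y"
proof -
  obtain f g where "inverse_pair C X Y f g" using assms by (auto simp: isomorphic_def is_iso_def)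
  then have "ptrace Y (ident C Y) = ptrace X (ident C X)"
    using ptrace_cyclic[of f X Y g] by (simp add: inverse_pair_def)
  then show ?thesis unfolding ptrace_ident by (rule pdim_eqI)
qed

text \<open>The identity of \<open>X\<close> is the sum of the \<open>i s \<cdot> p s\<close>, and
  cyclicity turns each trace into that of \<open>p s \<cdot> i s\<close>, an identity.\<close>

lemma pdim_direct_sum:
  assumes "direct_sum C X k S"
  shows "pdim C X = (\<Sum>s<k. pdim C (S s))"
proof -
  obtain i p where ip: "\<And>s. s < k \<Longrightarrow> i s \<in> hom C (S s) X" "\<And>s. s < k \<Longrightarrow> p s \<in> hom C X (S s)"
    "\<And>s t. s < k \<Longrightarrow> t < k \<Longrightarrow> p s \<cdot> i t = (if s = t then ident C (S s) else 0)"
    "(\<Sum>s<k. i s \<cdot> p s) = ident C X"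
    using assms unfolding direct_sum_def by blast
  have "scl C (pdim C X) (ident C \<one>) = ptrace X (\<Sum>s<k. i s \<cdot> p s)"
    by (simp add: ip(4) ptrace_ident)
  also have "\<dots> = (\<Sum>s<k. ptrace X (i s \<cdot> p s))"
    by (rule ptrace_sum) (use comp_in_hom ip in blast)
  also have "\<dots> = (\<Sum>s<k. scl C (pdim C (S s)) (ident C \<one>))"
    by (rule sum.cong) (use ptrace_cyclic[OF ip(1,2)] ip(3) ptrace_ident in auto)
  also have "\<dots> = scl C (\<Sum>s<k. pdim C (S s)) (ident C \<one>)" by (simp add: vs.scale_sum_left)
  finally show ?thesis by (intro pdim_eqI) (rule sym)
qed

text \<open>The summands of \<open>X\<close> are grouped by the unique element of \<open>I\<close>
  to which each is isomorphic.\<close>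

lemma pdim_hdim:
  assumes I: "Irr_reps C I" "finite I"
  shows "pdim C X = (\<Sum>U\<in>I. of_nat (hdim U X) * pdim C U)"
proof -
  obtain k S where S: "\<And>s. s < k \<Longrightarrow> simple C (S s)" and X: "direct_sum C X k S"
    using semisimple[of X] by blast
  have 1: "(\<Sum>U\<in>I. if isomorphic C U (S s) then pdim C U else 0) = pdim C (S s)" if s: "s < k" for s
  proof -
    have "\<exists>!W. W \<in> I \<and> isomorphic C (S s) W" using I(1) S[OF s] by (simp add: Irr_reps_def)
    then obtain W where W: "W \<in> I" "isomorphic C (S s) W"
      and uniq: "\<And>W'. W' \<in> I \<Longrightarrow> isomorphic C (S s) W' \<Longrightarrow> W' = W" by blast
    have "isomorphic C U (S s) \<longleftrightarrow> U = W" if "U \<in> I" for U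
      using isomorphic_sym W(2) uniq[OF that] by blast
    then have "(\<Sum>U\<in>I. if isomorphic C U (S s) then pdim C U else 0) = (\<Sum>U\<in>I. if U = W then pdim C W else 0)"
      by (intro sum.cong) auto
    also have "\<dots> = pdim C W" using W I(2) by simp
    finally show ?thesis using pdim_isomorphic[OF W(2)] by simp
  qed
  have "pdim C X = (\<Sum>s<k. \<Sum>U\<in>I. if isomorphic C U (S s) then pdim C U else 0)"
    unfolding pdim_direct_sum[OF X] by (rule sum.cong) (simp_all add: 1)
  also have "\<dots> = (\<Sum>U\<in>I. \<Sum>s<k. if isomorphic C U (S s) then pdim C U else 0)" by (rule sum.swap)
  also have "\<dots> = (\<Sum>U\<in>I. of_nat (hdim U X) * pdim C U)"
  proof (rule sum.cong)
    fix U assume "U \<in> I"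
    then have U: "simple C U" using I by (simp add: Irr_reps_def)
    have "(\<Sum>s<k. if isomorphic C U (S s) then pdim C U else 0) = (\<Sum>s\<in>{s. s < k \<and> isomorphic C U (S s)}. pdim C U)"
      by (rule sum.mono_neutral_cong_right) auto
    then show "(\<Sum>s<k. if isomorphic C U (S s) then pdim C U else 0) = of_nat (hdim U X) * pdim C U"
      by (simp add: hdim_simple(1)[OF U S X])
  qed simp
  finally show ?thesis .
qed

text \<open>Bending the strand \<open>V\<close> up and down; the two zigzags make \<open>?F\<close>
  and \<open>?G\<close> mutually inverse. Both are maps between Hom-spaces of \<open>C\<close>, and
  \<open>SF\<close> and \<open>SG\<close> translate them into diagrams.\<close>

lemma hdim_adjoint: "hdim U (V \<otimes> W) = hdim (dual C V \<otimes> U) W"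
proof -
  let ?V = "dual C V"
  have ev: "ev C V \<in> hom C (?V \<otimes> V) \<one>" using left_dual by (simp add: is_left_dual_def)
  define A where "A = (ev C V \<boxtimes> ident C W) \<cdot> assoc_inv C ?V V W"
  define B where "B = assoc C V ?V U \<cdot> (coev C V \<boxtimes> ident C U)"
  have A: "A \<in> hom C (?V \<otimes> V \<otimes> W) W"
    using tens_in_hom[OF ev ident_in_hom[of W]] aassoc_simps(5)[of ?V V W] comp_in_hom
    unfolding A_def by (auto simp: aval_def)
  have B: "B \<in> hom C U (V \<otimes> ?V \<otimes> U)"
    using tens_in_hom[OF coev_in_hom[of V] ident_in_hom[of U]] aassoc_simps(1)[of V ?V U] comp_in_hom
    unfolding B_def by (auto simp: aval_def)
  let ?F = "\<lambda>f. A \<cdot> (ident C ?V \<boxtimes> f)" and ?G = "\<lambda>g. (ident C V \<boxtimes> g) \<cdot> B"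
  have tF: "f \<in> hom C U (V \<otimes> W) \<Longrightarrow> ident C ?V \<boxtimes> f \<in> hom C (?V \<otimes> U) (?V \<otimes> V \<otimes> W)" for f
    using tens_in_hom[OF ident_in_hom] by blast
  have tG: "g \<in> hom C (?V \<otimes> U) W \<Longrightarrow> ident C V \<boxtimes> g \<in> hom C (V \<otimes> ?V \<otimes> U) (V \<otimes> W)" for g
    using tens_in_hom[OF ident_in_hom] by blast
  have SF: "Arr [?V, U] [W] (?F f) = (dl V \<odot> sid [W]) \<bullet> (sid [?V] \<odot> Arr [U] [V, W] f)"
    if f: "f \<in> hom C U (V \<otimes> W)" for f
  proof (rule arr_eqI)
    have "low ((dl V \<odot> sid [W]) \<bullet> (sid [?V] \<odot> Arr [U] [V, W] f))
      = ((low (dl V) \<star> aid W) \<bullet> aassoc_inv ?V V W) \<bullet> (aid ?V \<star> Arr U (V \<otimes> W) f)"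
      using f by (simp add: low_stens low_Arr)
    also have "\<dots> = low (Arr [?V, U] [W] (?F f))"
      by (simp add: A_def acmp_def atens_def dl_def aassoc_inv_def low_def aid_def)
    finally show "low (Arr [?V, U] [W] (?F f)) = low ((dl V \<odot> sid [W]) \<bullet> (sid [?V] \<odot> Arr [U] [V, W] f))" ..
  qed simp_all
  have SG: "Arr [U] [V, W] (?G g) = (sid [V] \<odot> Arr [?V, U] [W] g) \<bullet> (bl V \<odot> sid [U])"
    if g: "g \<in> hom C (?V \<otimes> U) W" for g
  proof (rule arr_eqI)
    have "low ((sid [V] \<odot> Arr [?V, U] [W] g) \<bullet> (bl V \<odot> sid [U]))
      = (aid V \<star> Arr (?V \<otimes> U) W g) \<bullet> (aassoc V ?V U \<bullet> (low (bl V) \<star> aid U))"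
      using g by (simp add: low_stens low_Arr)
    also have "\<dots> = low (Arr [U] [V, W] (?G g))"
      by (simp add: B_def acmp_def atens_def bl_def aassoc_def low_def aid_def)
    finally show "low (Arr [U] [V, W] (?G g)) = low ((sid [V] \<odot> Arr [?V, U] [W] g) \<bullet> (bl V \<odot> sid [U]))" ..
  qed simp_all
  have F: "?F f \<in> hom C (?V \<otimes> U) W" if "f \<in> hom C U (V \<otimes> W)" for f
    using comp_in_hom[OF A tF[OF that]] .
  have G: "?G g \<in> hom C U (V \<otimes> W)" if "g \<in> hom C (?V \<otimes> U) W" for g
    using comp_in_hom[OF tG[OF that] B] .
  show ?thesis
  proof (rule finite_dim_subspace.dim_eq_of_bij[OF hom_finite_dim hom_finite_dim, where F = ?F and G = ?G])
    fix f assume f: "f \<in> hom C U (V \<otimes> W)"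
    define f' where "f' = Arr [U] [V, W] f"
    have f' [simp]: "sval f'" "asrc f' = [U]" "atgt f' = [V, W]" using f by (simp_all add: f'_def)
    have "Arr [U] [V, W] (?G (?F f)) = ((sid [V] \<odot> dl V \<odot> sid [W]) \<bullet> (sid [V, ?V] \<odot> f')) \<bullet> (bl V \<odot> sid [U])"
      unfolding SG[OF F[OF f]] SF[OF f] by (simp add: f'_def[symmetric])
    also have "\<dots> = (sid [V] \<odot> dl V \<odot> sid [W]) \<bullet> ((sid [V, ?V] \<odot> f') \<bullet> (bl V \<odot> sid [U]))" by simp
    also have "(sid [V, ?V] \<odot> f') \<bullet> (bl V \<odot> sid [U]) = (bl V \<odot> sid [V, W]) \<bullet> f'"
      using S.exchange[of "bl V" f' "[]"] by simp
    also have "(sid [V] \<odot> dl V \<odot> sid [W]) \<bullet> ((bl V \<odot> sid [V, W]) \<bullet> f') = f'"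
      using S.rewrite_head[OF S.zigzag_left[OF dpair_l[of V], of "[]" "[W]"], of f'] by simp
    finally show "?G (?F f) = f" by (simp add: f'_def)
  next
    fix g assume g: "g \<in> hom C (?V \<otimes> U) W"
    define g' where "g' = Arr [?V, U] [W] g"
    have g' [simp]: "sval g'" "asrc g' = [?V, U]" "atgt g' = [W]" using g by (simp_all add: g'_def)
    have "Arr [?V, U] [W] (?F (?G g)) = (dl V \<odot> sid [W]) \<bullet> ((sid [?V, V] \<odot> g') \<bullet> (sid [?V] \<odot> bl V \<odot> sid [U]))"
      unfolding SF[OF G[OF g]] SG[OF g] by (simp add: g'_def[symmetric])
    also have "\<dots> = ((dl V \<odot> sid [W]) \<bullet> (sid [?V, V] \<odot> g')) \<bullet> (sid [?V] \<odot> bl V \<odot> sid [U])" by simp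
    also have "(dl V \<odot> sid [W]) \<bullet> (sid [?V, V] \<odot> g') = g' \<bullet> (dl V \<odot> sid [?V, U])"
      using S.exchange[of "dl V" g' "[]"] by simp
    also have "(g' \<bullet> (dl V \<odot> sid [?V, U])) \<bullet> (sid [?V] \<odot> bl V \<odot> sid [U]) = g'"
      using S.zigzag_right[OF dpair_l[of V], of "[]" "[U]"] by simp
    finally show "?F (?G g) = g" by (simp add: g'_def)
  next
    fix f f' assume f: "f \<in> hom C U (V \<otimes> W)" "f' \<in> hom C U (V \<otimes> W)"
    then have "ident C ?V \<boxtimes> (f + f') = ident C ?V \<boxtimes> f + ident C ?V \<boxtimes> f'"
      using tens_bilinear[of ?V ?V U "V \<otimes> W"] ident_in_hom by (auto simp: bilinear_on_def)
    then show "?F (f + f') = ?F f + ?F f'"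
      using comp_add_right[OF tF[OF f(1)] tF[OF f(2)] A] by simp
  next
    fix c f assume f: "f \<in> hom C U (V \<otimes> W)"
    then have "ident C ?V \<boxtimes> scl C c f = scl C c (ident C ?V \<boxtimes> f)"
      using tens_bilinear[of ?V ?V U "V \<otimes> W"] ident_in_hom by (auto simp: bilinear_on_def)
    then show "?F (scl C c f) = scl C c (?F f)"
      using comp_scale(1)[OF tF[OF f] A] by simp
  qed (fact F G)+
qed

section \<open>Dimensions of dual objects\<close>

lemma finite_Irr:
  assumes "Irr_reps C I"
  shows "finite I"
proof -
  obtain J where J: "finite J" "\<And>V. simple C V \<Longrightarrow> \<exists>W\<in>J. isomorphic C V W"
    using finitely_many_simples by blast
  have sI: "V \<in> I \<Longrightarrow> simple C V" for V using assms by (simp add: Irr_reps_def)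
  have "\<forall>V\<in>I. \<exists>W. W \<in> J \<and> isomorphic C V W" using J(2)[OF sI] by blast
  from bchoice[OF this] obtain r where r: "\<And>V. V \<in> I \<Longrightarrow> r V \<in> J \<and> isomorphic C V (r V)" by blast
  have "inj_on r I"
  proof (rule inj_onI)
    fix V W assume VW: "V \<in> I" "W \<in> I" "r V = r W"
    have "isomorphic C V (r V)" "isomorphic C (r V) W"
      using r[OF VW(1)] r[OF VW(2)] VW(3) isomorphic_sym[of W "r W"] by simp_all
    then have "isomorphic C V W" by (rule isomorphic_trans)
    moreover have "\<exists>!W. W \<in> I \<and> isomorphic C V W" using assms sI[OF VW(1)] by (simp add: Irr_reps_def)
    ultimately show "V = W" using VW isomorphic_refl[of V] by blast
  qed
  moreover have "finite (r ` I)" by (rule finite_subset[OF _ J(1)]) (use r in blast)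
  ultimately show ?thesis by (rule finite_imageD[rotated])
qed

text \<open>
  The dimensions of the simple objects form a common eigenvector of tensoring with \<open>V\<close> and, by
  adjunction, of the transposed operation of tensoring with \<open>V\<^sup>*\<close>; compare the eigenvalues.
\<close>

lemma pdim_dual_cnj:
  assumes I: "Irr_reps C I"
  shows "pdim C (dual C V) = cnj (pdim C V)"
proof -
  have fin: "finite I" by (rule finite_Irr[OF I])
  have sI: "W \<in> I \<Longrightarrow> simple C W" for W using I by (simp add: Irr_reps_def)
  let ?p = "pdim C" and ?N = "\<lambda>U W. of_nat (hdim U (V \<otimes> W)) :: complex"
  let ?S = "\<Sum>W\<in>I. cnj (?p W) * ?p W"
  have 1: "?p V * ?p W = (\<Sum>U\<in>I. ?N U W * ?p U)" for W
    using pdim_hdim[OF I fin, of "V \<otimes> W"] by (simp add: pdim_tens)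
  have 2: "?p (dual C V) * ?p U = (\<Sum>W\<in>I. ?N U W * ?p W)" for U
  proof -
    \<comment> \<open>The matrix of tensoring with the dual of \<open>V\<close> is the transpose of
      that of \<open>V\<close>.\<close>
    have "hdim W (dual C V \<otimes> U) = hdim U (V \<otimes> W)" if "W \<in> I" for W
      by (simp only: hdim_sym[OF sI[OF that], of "dual C V \<otimes> U"] hdim_adjoint[of U V W])
    then show ?thesis
      unfolding pdim_tens[symmetric] pdim_hdim[OF I fin, of "dual C V \<otimes> U"] by simp
  qed
  \<comment> \<open>The Hermitian product of the dimension vector with its image under the matrix of
    \<open>V\<close>. The entries are natural numbers, so moving the matrix to the conjugated
    argument only transposes it.\<close>
  have "?p V * ?S = (\<Sum>W\<in>I. cnj (?p W) * (?p V * ?p W))"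
    by (simp add: sum_distrib_left mult.left_commute)
  also have "\<dots> = (\<Sum>W\<in>I. \<Sum>U\<in>I. cnj (?p W) * (?N U W * ?p U))"
    unfolding 1 by (simp add: sum_distrib_left)
  also have "\<dots> = (\<Sum>U\<in>I. \<Sum>W\<in>I. cnj (?p W) * (?N U W * ?p U))" by (rule sum.swap)
  also have "\<dots> = (\<Sum>U\<in>I. ?p U * cnj (\<Sum>W\<in>I. ?N U W * ?p W))"
    by (simp add: sum_distrib_left mult_ac)
  also have "\<dots> = cnj (?p (dual C V)) * ?S"
    unfolding 2[symmetric] by (simp add: sum_distrib_left mult_ac)
  finally have eq: "?p V * ?S = cnj (?p (dual C V)) * ?S" .
  have S: "?S = complex_of_real (\<Sum>W\<in>I. (cmod (?p W))\<^sup>2)"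
    unfolding of_real_sum complex_norm_square by (simp add: mult.commute)
  \<comment> \<open>The unit contributes 1 to this sum of squares, so \<open>?S\<close> can be
    cancelled.\<close>
  obtain W where W: "W \<in> I" "isomorphic C \<one> W" using I simple_unit unfolding Irr_reps_def by blast
  have "?p W = 1" using pdim_isomorphic[OF W(2)] pdim_unit by simp
  then have "(\<Sum>W\<in>I. (cmod (?p W))\<^sup>2) > 0" by (intro sum_pos2[OF fin W(1)]) auto
  then have "?S \<noteq> 0" unfolding S using of_real_eq_0_iff by (metis less_irrefl)
  then have "?p V = cnj (?p (dual C V))" using eq by simp
  then show ?thesis by simp
qed

end

section \<open>Indicators in the presence of a braiding\<close>

context pivotal_fusion_category
begin

lemma post_comp_lin:
  assumes "finite_dim_subspace (scl C) (hom C X Y)" "g \<in> hom C Y Y"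
  shows "finite_dim_subspace.lin_on (scl C) (hom C X Y) (\<lambda>x. g \<cdot> x)"
  unfolding finite_dim_subspace.lin_on_def[OF assms(1)]
  using comp_in_hom[OF assms(2)] comp_add_right[OF _ _ assms(2)] comp_scale(1)[OF _ assms(2)] by blast

lemma FS_indicator_pdim_real:
  assumes c: "braiding C c" and V: "simple C V" and I: "Irr_reps C I" and n: "n \<ge> 1"
  shows "FS_indicator C n V * pdim C V \<in> \<real>"
proof -
  interpret B: strict_braided sval asrc atgt acmp stens sid "sbraid c" "sbraid_inv c"
    by (rule strict_braided[OF c])
  obtain m where m: "n = Suc m" using n by (cases n) auto
  let ?W = "replicate m V" and ?l = "replicate n V" and ?V = "dual C V"
  let ?c = "sbraid c" and ?ci = "sbraid_inv c"
  have l: "V # ?W = ?l" "?W @ [V] = ?l" by (simp_all add: m replicate_append_same)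
  have F: "tens_list ?l = tpow C V n" by (rule tens_list_replicate)
  define H where "H = hom C \<one> (tpow C V n)"
  interpret H: finite_dim_subspace "scl C" H unfolding H_def by (rule hom_finite_dim)

  \<comment> \<open>The curls that \<open>rot_braid\<close> produces for the braiding and for its
    reverse; \<open>V\<close> being simple, they are scalars.\<close>
  let ?th = "B.drinfeld [V] [?V] (br V) (dl V)"
  let ?th' = "strict_braided.drinfeld acmp stens sid (\<lambda>l m. ?ci m l) [V] [?V] (br V) (dl V)"
  have "sval ?th" "asrc ?th = [V]" "atgt ?th = [V]" by (simp_all add: B.drinfeld_def)
  then obtain t where t: "?th = smul t (sid [V])" using End_simple[OF V] by blast
  have "sval ?th'" "asrc ?th' = [V]" "atgt ?th' = [V]"
    by (simp_all add: strict_braided.drinfeld_def[OF B.reverse])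
  then obtain t' where t': "?th' = smul t' (sid [V])" using End_simple[OF V] by blast

  have tt': "t' * t * pdim C V = cnj (pdim C V)"
  proof -
    \<comment> \<open>Up to a crossing, the reversed curl turns the cap \<open>dr V\<close> into
      \<open>dl V\<close>, and the other curl turns the cup \<open>bl V\<close> into
      \<open>br V\<close>. In the composite the crossings cancel and the loop of \<open>V\<close>
      becomes that of its dual.\<close>
    have 1: "smul t' (dr V) = dl V \<bullet> ?ci [?V] [V]"
      using strict_braided.drinfeld_ev[OF B.reverse dpair_r[of V], of "dl V"] unfolding t' by simp
    have 2: "smul t (bl V) = ?c [?V] [V] \<bullet> br V"
      using B.drinfeld_coev[OF dpair_l[of V], of "br V"] unfolding t by simp
    have "smul (t' * t * pdim C V) (sid []) = smul t' (dr V) \<bullet> smul t (bl V)"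
      by (simp add: dr_bl mult.commute mult.left_commute)
    also have "\<dots> = dl V \<bullet> ?ci [?V] [V] \<bullet> ?c [?V] [V] \<bullet> br V" unfolding 1 2 by simp
    also have "?ci [?V] [V] \<bullet> ?c [?V] [V] \<bullet> br V = br V"
      using S.rewrite_head[OF B.braid_simps(7)[of "[?V]" "[V]"], of "br V"] by simp
    also have "dl V \<bullet> br V = smul (cnj (pdim C V)) (sid [])"
      by (simp add: dl_br pdim_dual_cnj[OF I])
    finally have "scal (smul (t' * t * pdim C V) (sid [])) = scal (smul (cnj (pdim C V)) (sid []))" by simp
    then show ?thesis by (simp only: scal_smul)
  qed

  have arr: "sval (Arr [] ?l x)" if "x \<in> H" for x using that by (simp add: H_def F)
  \<comment> \<open>One rotation computed twice, through the reversed braiding in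
    \<open>rot1\<close> and through the given one in \<open>rot2\<close>.\<close>
  have rot1: "rotate_head (Arr [] ?l x) = smul t' (?c [V] ?W \<bullet> Arr [] ?l x)"
    and rot2: "rotate_head (Arr [] ?l x) = smul t (?ci ?W [V] \<bullet> Arr [] ?l x)" if x: "x \<in> H" for x
  proof -
    define X where "X = Arr [] ?l x"
    have X [simp]: "sval X" "asrc X = []" "atgt X = V # ?W" using arr[OF x] by (simp_all add: X_def m)
    have "rotate_head X = srot V ?W X" by (simp add: rotate_head_def)
    then have "rotate_head X = smul t' (?c [V] ?W \<bullet> X)" "rotate_head X = smul t (?ci ?W [V] \<bullet> X)"
      using strict_braided.rot_braid[OF B.reverse, of "dl V" "[?V]" "[V]" "br V" X ?W]
        B.rot_braid[of "dl V" "[?V]" "[V]" "br V" X ?W]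
      by (simp_all add: t t')
    then show "rotate_head (Arr [] ?l x) = smul t' (?c [V] ?W \<bullet> Arr [] ?l x)"
      "rotate_head (Arr [] ?l x) = smul t (?ci ?W [V] \<bullet> Arr [] ?l x)" by (simp_all add: X_def)
  qed

  \<comment> \<open>As all strands carry the label \<open>V\<close>, the lists \<open>V # ?W\<close>
    and \<open>?W @ [V]\<close> coincide. Both crossings are thus endomorphisms of one tensor power
    and can be conjugate.\<close>
  define g where "g = amor (?c [V] ?W)"
  define g' where "g' = amor (?c ?W [V])"
  define gi where "gi = amor (?ci ?W [V])"
  define h where "h = amor (B.half_twist V n)"
  define hi where "hi = amor (B.half_twist_inv V n)"
  let ?P = "tpow C V n"
  have hom: "g \<in> hom C ?P ?P" "g' \<in> hom C ?P ?P" "gi \<in> hom C ?P ?P" "h \<in> hom C ?P ?P" "hi \<in> hom C ?P ?P"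
    using B.braid_simps(1)[of "[V]" ?W] B.braid_simps(1,4)[of ?W "[V]"]
      S.inversesD(1,4)[OF B.half_twist_inverses[of n V]] S.inversesD(2,3,5,6)[OF B.half_twist_inverses[of n V]]
    unfolding sval_def aval_def
    by (simp_all add: g_def g'_def gi_def h_def hi_def l F del: tens_list.simps)
  have gig': "gi \<cdot> g' = ident C ?P"
    using arg_cong[OF B.braid_simps(7)[of ?W "[V]"], of amor]
    by (simp add: gi_def g'_def sid_def l F del: tens_list.simps B.braid_simps)
  have hih: "hi \<cdot> h = ident C ?P" and hhi: "h \<cdot> hi = ident C ?P"
    using arg_cong[OF S.inversesD(7)[OF B.half_twist_inverses[of n V]], of amor]
      arg_cong[OF S.inversesD(8)[OF B.half_twist_inverses[of n V]], of amor]
    by (simp_all add: h_def hi_def sid_def F)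
  have conj: "h \<cdot> g = g' \<cdot> h"
    using arg_cong[OF B.half_twist_conj[of V m], of amor]
    by (simp add: h_def g_def g'_def m del: B.half_twist.simps)

  have lin: "k \<in> hom C ?P ?P \<Longrightarrow> H.lin_on (\<lambda>x. k \<cdot> x)" for k
    using post_comp_lin[OF hom_finite_dim] unfolding H_def by blast
  have in_H: "k \<in> hom C ?P ?P \<Longrightarrow> x \<in> H \<Longrightarrow> k \<cdot> x \<in> H" for k x
    using comp_in_hom unfolding H_def by blast
  have assocH: "k \<in> hom C ?P ?P \<Longrightarrow> k' \<in> hom C ?P ?P \<Longrightarrow> x \<in> H \<Longrightarrow> k \<cdot> (k' \<cdot> x) = (k \<cdot> k') \<cdot> x" for k k' x
    using comp_assoc unfolding H_def by metis
  have idH: "x \<in> H \<Longrightarrow> ident C ?P \<cdot> x = x" for x using ident_comp unfolding H_def by blast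

  define E where "E x = scl C t' (g \<cdot> x)" for x
  have linE: "H.lin_on E" unfolding E_def by (intro H.lin_on_scale lin hom)
  have E_eq: "E_map C V n x = E x" "E x = scl C t (gi \<cdot> x)" if x: "x \<in> H" for x
  proof -
    have "Arr [] ?l (E_map C V n x) = rotate_head (Arr [] ?l x)"
      using E_map_eq[of x V m] x unfolding H_def m by simp
    from arg_cong[OF this, of amor] have "E_map C V n x = amor (rotate_head (Arr [] ?l x))" by simp
    then show "E_map C V n x = E x" by (simp add: rot1[OF x] E_def g_def)
    show "E x = scl C t (gi \<cdot> x)"
      using arg_cong[OF trans[OF rot1[OF x, symmetric] rot2[OF x]], of amor] by (simp add: E_def g_def gi_def)
  qed
  have E_rot: "Arr [] ?l (E x) = rotate_head (Arr [] ?l x)" if x: "x \<in> H" for x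
    using E_map_eq[of x V m] x E_eq(1)[OF x] unfolding H_def m by simp
  have E_pow: "(E ^^ k) x \<in> H \<and> Arr [] ?l ((E ^^ k) x) = (rotate_head ^^ k) (Arr [] ?l x)" if x: "x \<in> H" for k x
    by (induction k) (use x E_rot H.lin_onD(1)[OF linE] in auto)
  have order: "(E ^^ n) x = x" if x: "x \<in> H" for x
    using E_pow[OF x, of n] rotate_head_order[of ?l "Arr [] ?l x"] arr[OF x] n
    by (simp del: sval_Arr)
  \<comment> \<open>\<open>E\<close> is \<open>t\<close> times composition with the inverse of
    \<open>g'\<close>. Applying \<open>E ^^ m\<close>, the inverse of \<open>E\<close> because
    \<open>n = m + 1\<close>, to \<open>E (g' \<cdot> x) = scl C t x\<close> gives \<open>g'\<close>
    without dividing by \<open>t\<close>.\<close>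
  have "g' \<cdot> x = scl C t ((E ^^ m) x)" if x: "x \<in> H" for x
  proof -
    have "E (g' \<cdot> x) = scl C t x"
      using E_eq(2)[OF in_H[OF hom(2) x]] by (simp add: assocH hom x gig' idH)
    then have "(E ^^ n) (g' \<cdot> x) = (E ^^ m) (scl C t x)" by (simp add: m funpow_swap1)
    then show ?thesis
      using order[OF in_H[OF hom(2) x]] H.lin_onD(3)[OF H.lin_on_funpow[OF linE] x] by simp
  qed
  then have "H.trace (\<lambda>x. g' \<cdot> x) = H.trace (\<lambda>x. scl C t ((E ^^ m) x))"
    by (intro H.trace_cong lin hom)
  also have "\<dots> = t * cnj (H.trace E)"
    using H.trace_finite_order[OF linE _ order] n
    by (simp add: H.trace_scale[OF H.lin_on_funpow[OF linE]] m)
  finally have tr_g': "H.trace (\<lambda>x. g' \<cdot> x) = t * cnj (H.trace E)" .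
  \<comment> \<open>The half twist gives the two crossings equal traces; this links the trace of
    \<open>E\<close>, which is \<open>t'\<close> times that of \<open>g\<close>, to the trace of
    \<open>g'\<close> just computed.\<close>
  have "g' \<cdot> x = h \<cdot> (g \<cdot> (hi \<cdot> x))" if x: "x \<in> H" for x
  proof -
    have "h \<cdot> (g \<cdot> (hi \<cdot> x)) = (h \<cdot> g) \<cdot> (hi \<cdot> x)" by (intro assocH hom in_H x)
    also have "\<dots> = g' \<cdot> (h \<cdot> (hi \<cdot> x))" unfolding conj by (intro assocH[symmetric] hom in_H x)
    also have "h \<cdot> (hi \<cdot> x) = x" by (simp add: assocH hom x hhi idH)
    finally show ?thesis by simp
  qed
  then have "H.trace (\<lambda>x. g' \<cdot> x) = H.trace (\<lambda>x. h \<cdot> (g \<cdot> (hi \<cdot> x)))"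
    by (intro H.trace_cong lin hom)
  also have "\<dots> = H.trace (\<lambda>x. g \<cdot> (hi \<cdot> (h \<cdot> x)))"
    by (rule H.trace_comm[OF lin H.lin_on_comp[OF lin lin]]) (fact hom)+
  also have "\<dots> = H.trace (\<lambda>x. g \<cdot> x)"
  proof (rule H.trace_cong[OF H.lin_on_comp[OF lin H.lin_on_comp[OF lin lin]]])
    fix x assume x: "x \<in> H"
    have "hi \<cdot> (h \<cdot> x) = x" by (simp add: assocH hom x hih idH)
    then show "g \<cdot> (hi \<cdot> (h \<cdot> x)) = g \<cdot> x" by simp
  qed (fact hom)+
  finally have "H.trace E = t' * (t * cnj (H.trace E))"
    using H.trace_scale[OF lin[OF hom(1)], of t'] tr_g' by (simp add: E_def[abs_def])
  then have "H.trace E * pdim C V = t' * (t * cnj (H.trace E)) * pdim C V"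
    by (rule arg_cong[where f = "\<lambda>z. z * pdim C V"])
  also have "\<dots> = (t' * t * pdim C V) * cnj (H.trace E)" by (simp only: mult_ac)
  also have "\<dots> = cnj (H.trace E * pdim C V)"
    unfolding tt' by (simp add: mult.commute)
  finally have "H.trace E * pdim C V = cnj (H.trace E * pdim C V)" .
  then have "H.trace E * pdim C V \<in> \<real>" unfolding Reals_cnj_iff by (rule sym)
  moreover have "FS_indicator C n V = H.trace E"
    unfolding FS_indicator_def H_def[symmetric]
    by (rule H.trace_cong[OF linE, symmetric]) (simp add: E_eq(1))
  ultimately show ?thesis by simp
qed

end

theorem corollary3p6:
  fixes C :: "('o, 'm::ab_group_add) pivotal_data" and I :: "'o set" and n :: nat
  assumes "pivotal_fusion_category C"
    and "Irr_reps C I"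
    and "n \<ge> 1"
    and "\<exists>c. braiding C c"
  shows "FS_indicator_cat C I n \<in> \<real>"
proof -
  interpret pivotal_fusion_category C by (rule assms(1))
  obtain c where c: "braiding C c" using assms(4) by blast
  show ?thesis
    unfolding FS_indicator_cat_def
    using FS_indicator_pdim_real[OF c _ assms(2,3)] assms(2)
    by (intro sum_in_Reals) (simp add: Irr_reps_def)
qed

end
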